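(* Let $\Omega\subseteq\mathbb{R}^d$, $d\ge2$, be a bounded Lipschitz domain, $I:=(0,T)$, $T<\infty$, $Q_T:=I\times\Omega$ and $q,p\in\mathcal{P}^{\log}(Q_T)$ with $q^-,p^->1$. Let $A(t):X^{q,p}_{\varepsilon}(t)\to X^{q,p}_{\varepsilon}(t)^*$, $t\in I$, be a family of operators with the following properties: (C.1) $A(t):X^{q,p}_{\varepsilon}(t)\to X^{q,p}_{\varepsilon}(t)^*$ is demi-continuous for almost every $t\in I$. (C.2) $t\mapsto\langle A(t)\mathbf{u},\mathbf{v}\rangle_{X^{q,p}_{\varepsilon}(t)}:I\to\mathbb{R}$ is Lebesgue measurable for every $\mathbf{u},\mathbf{v}\in X^{q,p}_+$. (C.3) There exist a function $\alpha\in L^1(I,\mathbb{R}_{\ge0})$ and a non-decreasing function $\mathscr{B}:\mathbb{R}_{\ge0}\to\mathbb{R}_{\ge0}$ such that for almost every $t\in I$ and every $\mathbf{u},\mathbf{v}\in X^{q,p}_{\varepsilon}(t)$ $$|\langle A(t)\mathbf{u},\mathbf{v}\rangle_{X^{q,p}_{\varepsilon}(t)}|\le\mathscr{B}(\|\mathbf{u}\|_Y)\big(\alpha(t)+\rho_{q(t,\cdot)}(\mathbf{u})+\rho_{p(t,\cdot)}(\boldsymbol{\varepsilon}(\mathbf{u}))+\rho_{q(t,\cdot)}(\mathbf{v})+\rho_{p(t,\cdot)}(\boldsymbol{\varepsilon}(\mathbf{v}))\big).$$ Then the operator $\mathcal{A}:\mathcal{X}^{q,p}_{\varepsilon}(Q_T)\cap\mathcal{Y}^\infty(Q_T)\to\mathcal{X}^{q,p}_{\varepsilon}(Q_T)^*$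 given by $$\langle\mathcal{A}\boldsymbol{u},\boldsymbol{v}\rangle_{\mathcal{X}^{q,p}_{\varepsilon}(Q_T)}:=\int_I\langle A(t)(\boldsymbol{u}(t)),\boldsymbol{v}(t)\rangle_{X^{q,p}_{\varepsilon}(t)}\,dt$$ for $\boldsymbol{u}\in\mathcal{X}^{q,p}_{\varepsilon}(Q_T)\cap\mathcal{Y}^\infty(Q_T)$ and $\boldsymbol{v}\in\mathcal{X}^{q,p}_{\varepsilon}(Q_T)$ is well-defined and bounded.
   Context: **Variable exponents.** For bounded measurable $G\subseteq\mathbb{R}^n$, $\mathcal{P}^\infty(G)$ is the set of measurable $p:G\to[1,\infty)$ with $p^+:=\operatorname{ess\,sup}_G p<\infty$; $p^-:=\operatorname{ess\,inf}_G p$. $L^{p(\cdot)}(G)$ is the space of measurable $f$ with finite modular $\rho_{p(\cdot)}(f):=\int_G|f(x)|^{p(x)}dx$, with the Luxemburg norm $\|f\|_{L^{p(\cdot)}(G)}:=\inf\{\lambda>0:\rho_{p(\cdot)}(f/\lambda)\le1\}$ (likewise for vector- and matrix-valued functions). $\mathcal{P}^{\log}(G)$ is the set of $p\in\mathcal{P}^\infty(G)$ that are globally log-Hölder continuous; for bounded $G$ this means that there is $c>0$ with $|p(x)-p(y)|\le c/\log(e+1/|x-y|)$ for all $x,y\in G$ (the additional decay condition is automatic on bounded sets). **Spaces.** $\mathbb{M}^{d\times d}_{\mathrm{sym}}$ denotes the symmetric real $d\times d$ matrices, $\boldsymbol{\varepsilon}(\mathbf{u}):=\frac12(\nabla\mathbf{u}+\nabla\mathbf{u}^\top)$.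 For $q,p\in\mathcal{P}^\infty(\Omega)$ let $X^{q(\cdot),p(\cdot)}_{\varepsilon}(\Omega)$ be the closure of $C_0^\infty(\Omega)^d$ in $\{\mathbf{f}\in L^{q(\cdot)}(\Omega)^d:\boldsymbol{\varepsilon}(\mathbf{f})\in L^{p(\cdot)}(\Omega,\mathbb{M}^{d\times d}_{\mathrm{sym}})\}$ with respect to the norm $\|\cdot\|_{L^{q(\cdot)}(\Omega)^d}+\|\boldsymbol{\varepsilon}(\cdot)\|_{L^{p(\cdot)}(\Omega)^{d\times d}}$. For $q,p\in\mathcal{P}^\infty(Q_T)$ and a.e. $t\in I$ set $X^{q,p}_{\varepsilon}(t):=X^{q(t,\cdot),p(t,\cdot)}_{\varepsilon}(\Omega)$, and $X^{q,p}_+:=X^{q^+,p^+}_{\varepsilon}(\Omega)$. Further $$\mathcal{X}^{q,p}_{\varepsilon}(Q_T):=\{\boldsymbol{u}\in L^{q(\cdot,\cdot)}(Q_T)^d:\ \boldsymbol{\varepsilon}(\boldsymbol{u})\in L^{p(\cdot,\cdot)}(Q_T,\mathbb{M}^{d\times d}_{\mathrm{sym}}),\ \boldsymbol{u}(t)\in X^{q,p}_{\varepsilon}(t)\text{ for a.e. }t\in I\}$$ with norm $\|\cdot\|_{L^{q(\cdot,\cdot)}(Q_T)^d}+\|\boldsymbol{\varepsilon}(\cdot)\|_{L^{p(\cdot,\cdot)}(Q_T)^{d\times d}}$. $Y:=L^2(\Omega)^d$, $\mathcal{Y}^\infty(Q_T):=L^\infty(I,Y)$; the intersection carries the sum of the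 norms. **Conventions.** Demi-continuous: strong convergence $\mathbf{u}_n\to\mathbf{u}$ implies $A(t)\mathbf{u}_n\rightharpoonup A(t)\mathbf{u}$ weakly. Bounded operator: maps bounded sets to bounded sets. *)

theory Defs
  imports "HOL-Analysis.Analysis" "HOL-Probability.Essential_Supremum"
begin

text \<open>
  Elements of function spaces are represented by total functions, of which only the restriction to
  the underlying set \<open>G\<close>, up to Lebesgue-a.e. equality, is relevant. The "norms" below are therefore
  seminorms on representatives, and maps on such spaces are required to respect a.e. equality.
\<close>

section \<open>Lipschitz domains\<close>

text \<open>
  Near every boundary point, \<open>G\<close> is the strict epigraph of a Lipschitz function over a
  hyperplane \<open>{y. y \<bullet> \<nu> = 0}\<close>, in direction \<open>\<nu>\<close>.
\<close>

definition lipschitz_domain :: "'a::euclidean_space set \<Rightarrow> bool" where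
  "lipschitz_domain G \<longleftrightarrow>
     open G \<and> connected G \<and> G \<noteq> {} \<and>
     (\<forall>z\<in>frontier G. \<exists>U \<nu> L (g::'a \<Rightarrow> real).
        open U \<and> z \<in> U \<and> norm \<nu> = 1 \<and> L-lipschitz_on {y. y \<bullet> \<nu> = 0} g \<and>
        G \<inter> U = {x \<in> U. g (x - (x \<bullet> \<nu>) *\<^sub>R \<nu>) < x \<bullet> \<nu>})"

section \<open>Variable exponents and Lebesgue spaces\<close>

definition exp_sup :: "'a::euclidean_space set \<Rightarrow> ('a \<Rightarrow> real) \<Rightarrow> ereal" where
  "exp_sup G p = esssup (lebesgue_on G) (\<lambda>x. ereal (p x))"

definition exp_inf :: "'a::euclidean_space set \<Rightarrow> ('a \<Rightarrow> real) \<Rightarrow> ereal" where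
  "exp_inf G p = - esssup (lebesgue_on G) (\<lambda>x. - ereal (p x))"

definition var_exponents :: "'a::euclidean_space set \<Rightarrow> ('a \<Rightarrow> real) set" where
  "var_exponents G =
     {p. p \<in> borel_measurable (lebesgue_on G) \<and> (\<forall>x\<in>G. 1 \<le> p x) \<and> exp_sup G p < \<infinity>}"

definition log_exponents :: "'a::euclidean_space set \<Rightarrow> ('a \<Rightarrow> real) set" where
  "log_exponents G =
     {p \<in> var_exponents G. \<exists>c>0. \<forall>x\<in>G. \<forall>y\<in>G. x \<noteq> y \<longrightarrow>
        \<bar>p x - p y\<bar> \<le> c / ln (exp 1 + 1 / norm (x - y))}"

definition modular ::
  "'a::euclidean_space set \<Rightarrow> ('a \<Rightarrow> real) \<Rightarrow> ('a \<Rightarrow> 'b::euclidean_space) \<Rightarrow> ennreal" where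
  "modular G p f = (\<integral>\<^sup>+ x. ennreal (norm (f x) powr p x) \<partial>lebesgue_on G)"

definition Lvar ::
  "'a::euclidean_space set \<Rightarrow> ('a \<Rightarrow> real) \<Rightarrow> ('a \<Rightarrow> 'b::euclidean_space) set" where
  "Lvar G p = {f \<in> borel_measurable (lebesgue_on G). modular G p f < \<infinity>}"

definition luxemburg_norm ::
  "'a::euclidean_space set \<Rightarrow> ('a \<Rightarrow> real) \<Rightarrow> ('a \<Rightarrow> 'b::euclidean_space) \<Rightarrow> real" where
  "luxemburg_norm G p f = Inf {c. 0 < c \<and> modular G p (\<lambda>x. f x /\<^sub>R c) \<le> 1}"

definition L2 :: "'a::euclidean_space set \<Rightarrow> ('a \<Rightarrow> 'b::euclidean_space) set" where
  "L2 G = {f \<in> borel_measurable (lebesgue_on G). integrable (lebesgue_on G) (\<lambda>x. (norm (f x))\<^sup>2)}"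

definition L2_norm :: "'a::euclidean_space set \<Rightarrow> ('a \<Rightarrow> 'b::euclidean_space) \<Rightarrow> real" where
  "L2_norm G f = sqrt (LINT x|lebesgue_on G. (norm (f x))\<^sup>2)"

section \<open>Test functions and the weak symmetric gradient\<close>

fun iter_partial ::
  "'a::euclidean_space list \<Rightarrow> ('a \<Rightarrow> 'b::euclidean_space) \<Rightarrow> 'a \<Rightarrow> 'b" where
  "iter_partial [] f = f"
| "iter_partial (b # bs) f = (\<lambda>x. frechet_derivative (iter_partial bs f) (at x) b)"

definition smooth :: "('a::euclidean_space \<Rightarrow> 'b::euclidean_space) \<Rightarrow> bool" where
  "smooth f \<longleftrightarrow> (\<forall>bs\<in>lists Basis. \<forall>x. iter_partial bs f differentiable (at x))"

text \<open>Compactly supported smooth functions in \<open>G\<close>, extended by zero to the whole space.\<close>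

definition test_functions :: "'a::euclidean_space set \<Rightarrow> ('a \<Rightarrow> 'b::euclidean_space) set" where
  "test_functions G =
     {f. smooth f \<and> compact (closure {x. f x \<noteq> 0}) \<and> closure {x. f x \<noteq> 0} \<subseteq> G}"

definition locally_integrable ::
  "'a::euclidean_space set \<Rightarrow> ('a \<Rightarrow> 'b::euclidean_space) \<Rightarrow> bool" where
  "locally_integrable G f \<longleftrightarrow> (\<forall>K\<subseteq>G. compact K \<longrightarrow> integrable (lebesgue_on K) f)"

text \<open>
  \<open>E\<close> is the distributional symmetric gradient of \<open>u\<close> on the open set \<open>G\<close>. The vectors \<open>e j\<close> are the
  directions in which the derivatives are taken, so that the same notion covers functions on
  \<open>\<Omega>\<close> and the purely spatial symmetric gradient of functions on \<open>I \<times> \<Omega>\<close>.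
\<close>

definition weak_symgrad ::
  "('d \<Rightarrow> 'a::euclidean_space) \<Rightarrow> 'a set \<Rightarrow> ('a \<Rightarrow> real^'d) \<Rightarrow> ('a \<Rightarrow> real^'d^'d) \<Rightarrow> bool" where
  "weak_symgrad e G u E \<longleftrightarrow>
     locally_integrable G u \<and> locally_integrable G E \<and> (\<forall>x\<in>G. transpose (E x) = E x) \<and>
     (\<forall>\<phi>\<in>test_functions G. \<forall>i j.
        (LINT x|lebesgue_on G. E x $ i $ j * \<phi> x) =
        - (LINT x|lebesgue_on G. 1/2 *
            (u x $ i * frechet_derivative \<phi> (at x) (e j) + u x $ j * frechet_derivative \<phi> (at x) (e i))))"

definition symgrad ::
  "('d \<Rightarrow> 'a::euclidean_space) \<Rightarrow> 'a set \<Rightarrow> ('a \<Rightarrow> real^'d) \<Rightarrow> ('a \<Rightarrow> real^'d^'d)" where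
  "symgrad e G u = (SOME E. weak_symgrad e G u E)"

abbreviation space_dir :: "'d::finite \<Rightarrow> real^'d" where
  "space_dir j \<equiv> axis j 1"

abbreviation spacetime_dir :: "'d::finite \<Rightarrow> real \<times> (real^'d)" where
  "spacetime_dir j \<equiv> (0, axis j 1)"

section \<open>The spaces on \<open>\<Omega>\<close>\<close>

definition X_norm ::
  "(real^'d) set \<Rightarrow> (real^'d \<Rightarrow> real) \<Rightarrow> (real^'d \<Rightarrow> real) \<Rightarrow> (real^'d \<Rightarrow> real^'d) \<Rightarrow> real" where
  "X_norm \<Omega> q p f = luxemburg_norm \<Omega> q f + luxemburg_norm \<Omega> p (symgrad space_dir \<Omega> f)"

definition X_ambient ::
  "(real^'d) set \<Rightarrow> (real^'d \<Rightarrow> real) \<Rightarrow> (real^'d \<Rightarrow> real) \<Rightarrow> (real^'d \<Rightarrow> real^'d) set" where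
  "X_ambient \<Omega> q p = {f \<in> Lvar \<Omega> q. \<exists>E\<in>Lvar \<Omega> p. weak_symgrad space_dir \<Omega> f E}"

definition X_space ::
  "(real^'d) set \<Rightarrow> (real^'d \<Rightarrow> real) \<Rightarrow> (real^'d \<Rightarrow> real) \<Rightarrow> (real^'d \<Rightarrow> real^'d) set" where
  "X_space \<Omega> q p =
     {f \<in> X_ambient \<Omega> q p. \<forall>\<epsilon>>0. \<exists>\<phi>\<in>test_functions \<Omega>. X_norm \<Omega> q p (\<lambda>x. f x - \<phi> x) < \<epsilon>}"

definition Xt_space ::
  "(real^'d) set \<Rightarrow> (real \<times> (real^'d) \<Rightarrow> real) \<Rightarrow> (real \<times> (real^'d) \<Rightarrow> real) \<Rightarrow> real
     \<Rightarrow> (real^'d \<Rightarrow> real^'d) set" where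
  "Xt_space \<Omega> q p t = X_space \<Omega> (\<lambda>x. q (t, x)) (\<lambda>x. p (t, x))"

definition Xt_norm ::
  "(real^'d) set \<Rightarrow> (real \<times> (real^'d) \<Rightarrow> real) \<Rightarrow> (real \<times> (real^'d) \<Rightarrow> real) \<Rightarrow> real
     \<Rightarrow> (real^'d \<Rightarrow> real^'d) \<Rightarrow> real" where
  "Xt_norm \<Omega> q p t = X_norm \<Omega> (\<lambda>x. q (t, x)) (\<lambda>x. p (t, x))"

text \<open>The exponents of \<open>X\<^sub>+\<close> are the constants \<open>q\<^sup>+\<close> and \<open>p\<^sup>+\<close> taken over \<open>I \<times> \<Omega>\<close>.\<close>

definition X_plus ::
  "real \<Rightarrow> (real^'d) set \<Rightarrow> (real \<times> (real^'d) \<Rightarrow> real) \<Rightarrow> (real \<times> (real^'d) \<Rightarrow> real)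
     \<Rightarrow> (real^'d \<Rightarrow> real^'d) set" where
  "X_plus T \<Omega> q p =
     X_space \<Omega> (\<lambda>_. real_of_ereal (exp_sup ({0<..<T} \<times> \<Omega>) q))
               (\<lambda>_. real_of_ereal (exp_sup ({0<..<T} \<times> \<Omega>) p))"

section \<open>The spaces on \<open>I \<times> \<Omega>\<close>\<close>

definition XX_space ::
  "real \<Rightarrow> (real^'d) set \<Rightarrow> (real \<times> (real^'d) \<Rightarrow> real) \<Rightarrow> (real \<times> (real^'d) \<Rightarrow> real)
     \<Rightarrow> (real \<times> (real^'d) \<Rightarrow> real^'d) set" where
  "XX_space T \<Omega> q p =
     {u \<in> Lvar ({0<..<T} \<times> \<Omega>) q.
        (\<exists>E\<in>Lvar ({0<..<T} \<times> \<Omega>) p. weak_symgrad spacetime_dir ({0<..<T} \<times> \<Omega>) u E) \<and>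
        (AE t in lebesgue_on {0<..<T}. (\<lambda>x. u (t, x)) \<in> Xt_space \<Omega> q p t)}"

definition XX_norm ::
  "real \<Rightarrow> (real^'d) set \<Rightarrow> (real \<times> (real^'d) \<Rightarrow> real) \<Rightarrow> (real \<times> (real^'d) \<Rightarrow> real)
     \<Rightarrow> (real \<times> (real^'d) \<Rightarrow> real^'d) \<Rightarrow> real" where
  "XX_norm T \<Omega> q p u =
     luxemburg_norm ({0<..<T} \<times> \<Omega>) q u +
     luxemburg_norm ({0<..<T} \<times> \<Omega>) p (symgrad spacetime_dir ({0<..<T} \<times> \<Omega>) u)"

text \<open>Bochner measurability of \<open>w\<close> as a map from \<open>I\<close> into \<open>L\<^sup>2(\<Omega>)\<^sup>d\<close>.\<close>

definition L2_bochner_measurable ::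
  "real set \<Rightarrow> (real^'d) set \<Rightarrow> (real \<Rightarrow> real^'d \<Rightarrow> real^'d) \<Rightarrow> bool" where
  "L2_bochner_measurable I \<Omega> w \<longleftrightarrow>
     (AE t in lebesgue_on I. w t \<in> L2 \<Omega>) \<and>
     (\<exists>s :: nat \<Rightarrow> real \<Rightarrow> real^'d \<Rightarrow> real^'d.
        (\<forall>n. simple_function (lebesgue_on I) (s n) \<and> s n ` I \<subseteq> L2 \<Omega>) \<and>
        (AE t in lebesgue_on I. (\<lambda>n. L2_norm \<Omega> (\<lambda>x. s n t x - w t x)) \<longlonglongrightarrow> 0))"

definition YY_space :: "real \<Rightarrow> (real^'d) set \<Rightarrow> (real \<times> (real^'d) \<Rightarrow> real^'d) set" where
  "YY_space T \<Omega> =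
     {u. L2_bochner_measurable {0<..<T} \<Omega> (\<lambda>t x. u (t, x)) \<and>
         esssup (lebesgue_on {0<..<T}) (\<lambda>t. ereal (L2_norm \<Omega> (\<lambda>x. u (t, x)))) < \<infinity>}"

definition YY_norm :: "real \<Rightarrow> (real^'d) set \<Rightarrow> (real \<times> (real^'d) \<Rightarrow> real^'d) \<Rightarrow> real" where
  "YY_norm T \<Omega> u =
     real_of_ereal (esssup (lebesgue_on {0<..<T}) (\<lambda>t. ereal (L2_norm \<Omega> (\<lambda>x. u (t, x)))))"

section \<open>Dual spaces and operators\<close>

text \<open>
  \<open>V\<close> is a linear space of (representatives of) functions with seminorm \<open>N\<close>. Functionals are total
  functions of which only the values on \<open>V\<close> matter. The definitions also apply to \<open>V\<close> itself being a
  dual space, which yields the bidual.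
\<close>

definition dual_space ::
  "('x \<Rightarrow> 'y::real_vector) set \<Rightarrow> (('x \<Rightarrow> 'y) \<Rightarrow> real) \<Rightarrow> (('x \<Rightarrow> 'y) \<Rightarrow> real) set" where
  "dual_space V N =
     {F. (\<forall>v\<in>V. \<forall>w\<in>V. F (\<lambda>x. v x + w x) = F v + F w) \<and>
         (\<forall>c. \<forall>v\<in>V. F (\<lambda>x. c *\<^sub>R v x) = c * F v) \<and>
         (\<exists>C. \<forall>v\<in>V. \<bar>F v\<bar> \<le> C * N v)}"

definition dual_norm ::
  "('x \<Rightarrow> 'y::real_vector) set \<Rightarrow> (('x \<Rightarrow> 'y) \<Rightarrow> real) \<Rightarrow> (('x \<Rightarrow> 'y) \<Rightarrow> real) \<Rightarrow> real" where
  "dual_norm V N F = Sup {\<bar>F v\<bar> |v. v \<in> V \<and> N v \<le> 1}"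

text \<open>\<open>A\<close> induces a map from the a.e.-classes of elements of \<open>U\<close> into the dual of \<open>V\<close>.\<close>

definition maps_to_dual ::
  "'x measure \<Rightarrow> ('x \<Rightarrow> 'y::real_vector) set \<Rightarrow> ('x \<Rightarrow> 'y) set \<Rightarrow> (('x \<Rightarrow> 'y) \<Rightarrow> real)
     \<Rightarrow> (('x \<Rightarrow> 'y) \<Rightarrow> ('x \<Rightarrow> 'y) \<Rightarrow> real) \<Rightarrow> bool" where
  "maps_to_dual M U V N A \<longleftrightarrow>
     (\<forall>u\<in>U. A u \<in> dual_space V N) \<and>
     (\<forall>u\<in>U. \<forall>u'\<in>U. (AE x in M. u x = u' x) \<longrightarrow> (\<forall>v\<in>V. A u v = A u' v))"

text \<open>Weak convergence in the dual of \<open>V\<close> is tested against the bidual.\<close>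

definition demicontinuous ::
  "('x \<Rightarrow> 'y::real_vector) set \<Rightarrow> (('x \<Rightarrow> 'y) \<Rightarrow> real)
     \<Rightarrow> (('x \<Rightarrow> 'y) \<Rightarrow> ('x \<Rightarrow> 'y) \<Rightarrow> real) \<Rightarrow> bool" where
  "demicontinuous V N A \<longleftrightarrow>
     (\<forall>u us. u \<in> V \<longrightarrow> (\<forall>n::nat. us n \<in> V) \<longrightarrow> (\<lambda>n. N (\<lambda>x. us n x - u x)) \<longlonglongrightarrow> 0 \<longrightarrow>
        (\<forall>\<Phi>\<in>dual_space (dual_space V N) (dual_norm V N). (\<lambda>n. \<Phi> (A (us n))) \<longlonglongrightarrow> \<Phi> (A u)))"

definition bounded_operator ::
  "'u set \<Rightarrow> ('u \<Rightarrow> real) \<Rightarrow> ('w \<Rightarrow> real) \<Rightarrow> ('u \<Rightarrow> 'w) \<Rightarrow> bool" where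
  "bounded_operator U N N' A \<longleftrightarrow>
     (\<forall>S\<subseteq>U. (\<exists>R. \<forall>u\<in>S. N u \<le> R) \<longrightarrow> (\<exists>R'. \<forall>u\<in>S. N' (A u) \<le> R'))"

definition induced_operator ::
  "real \<Rightarrow> (real \<Rightarrow> (real^'d \<Rightarrow> real^'d) \<Rightarrow> (real^'d \<Rightarrow> real^'d) \<Rightarrow> real)
     \<Rightarrow> (real \<times> (real^'d) \<Rightarrow> real^'d) \<Rightarrow> (real \<times> (real^'d) \<Rightarrow> real^'d) \<Rightarrow> real" where
  "induced_operator T A u v = (LINT t|lebesgue_on {0<..<T}. A t (\<lambda>x. u (t, x)) (\<lambda>x. v (t, x)))"

end

theory Submission
  imports Defs
begin

text \<open>The only real issue is the measurability of \<open>t \<mapsto> \<langle>A(t) u(t), v(t)\<rangle>\<close>, because \<open>u(t)\<close> and \<open>v(t)\<close> live in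
spaces that change with \<open>t\<close>; (C.2) gives measurability for fixed elements of \<open>X\<^sub>+\<close>, in particular for
fixed test functions. Test functions on the bounded set \<open>\<Omega>\<close> form a separable space in the \<open>C\<^sup>1\<close> norm, and
a countable set \<open>D\<close> that is dense in this norm approximates every element of every space
\<open>X(t)\<close>, since \<open>X(t)\<close> is by definition the closure of the test functions and bounded exponents make the
\<open>C\<^sup>1\<close> norm stronger than the norm of \<open>X(t)\<close>. Choosing for each \<open>t\<close> the first element of \<open>D\<close> that is
\<open>1/n\<close>-close to \<open>u(t)\<close> gives a function of \<open>t\<close> with countably many values. Closeness is expressed by
modulars (\<open>modular_near\<close>); they are integrals, so by Fubini's theorem the choice is measurable in \<open>t\<close>.
Hence \<open>A(t)\<close> paired with two such approximations is measurable. Demi-continuity (C.1), tested with the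
evaluation functional in the bidual, removes the approximation of \<open>u\<close>, and continuity of the functional
\<open>A(t) u(t)\<close> removes that of \<open>v\<close>; this is \<open>measurable_pairing\<close>.

The step that needs most preparation is that the distributional symmetric gradient of \<open>u\<close> on \<open>I \<times> \<Omega>\<close>
restricts for almost every \<open>t\<close> to that of \<open>u(t)\<close> on \<open>\<Omega>\<close> (\<open>weak_symgrad_slice\<close>). It is tested with products
of test functions in \<open>t\<close> and in \<open>x\<close>; the fundamental lemma of the calculus of variations
(\<open>fundamental_lemma_of_variations\<close>) gives the identity for almost every \<open>t\<close>, with an exceptional null set that
depends on the test function in \<open>x\<close>, and \<open>C\<^sup>1\<close> separability reduces to countably many of these. The
fundamental lemma also gives uniqueness of weak symmetric gradients (\<open>weak_symgrad_unique\<close>), without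
which the chosen representative \<open>symgrad\<close> would carry no information.

Everything else follows from integrating (C.3) over \<open>t\<close>: the modulars of the slices integrate to the
modulars on \<open>I \<times> \<Omega>\<close> (\<open>nn_integral_pairing_le\<close>). Applied to \<open>v/s\<close> with \<open>s\<close> slightly above the norm of \<open>v\<close>, this
bounds the functional by a constant depending on the norms of \<open>u\<close> alone (\<open>induced_operator_le\<close>), which is
continuity of \<open>\<A> u\<close> and boundedness of \<open>\<A>\<close> at once.\<close>


section \<open>Smooth functions and bump functions\<close>

abbreviation partial :: "'a::euclidean_space \<Rightarrow> ('a \<Rightarrow> 'b::euclidean_space) \<Rightarrow> 'a \<Rightarrow> 'b" where
  "partial b f \<equiv> (\<lambda>x. frechet_derivative f (at x) b)"

text \<open>The head of the list of directions in \<open>iter_partial\<close> is the derivative taken last, so a class of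
everywhere differentiable functions that is closed under partial derivatives contains all iterated
partial derivatives of its members. All smoothness proofs below exhibit such a class.\<close>

lemma smooth_coinduct:
  assumes "P f"
    and diff: "\<And>f x. P f \<Longrightarrow> f differentiable at x"
    and part: "\<And>f b. P f \<Longrightarrow> b \<in> Basis \<Longrightarrow> P (partial b f)"
  shows "smooth f"
proof -
  have "P (iter_partial bs f)" if "bs \<in> lists Basis" for bs
    using that by (induction bs) (auto simp: assms)
  then show ?thesis
    unfolding smooth_def using diff by blast
qed

lemma smooth_differentiable: "smooth f \<Longrightarrow> f differentiable at x"
  unfolding smooth_def by (metis iter_partial.simps(1) lists.Nil)

lemma smooth_partial:
  assumes "smooth f" "b \<in> Basis"
  shows "smooth (partial b f)"
proof -
  have "iter_partial bs (partial b f) = iter_partial (bs @ [b]) f" for bs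
    by (induction bs) auto
  then show ?thesis
    using assms unfolding smooth_def by auto
qed

lemma smooth_has_derivative:
  "smooth f \<Longrightarrow> (f has_derivative frechet_derivative f (at x)) (at x)"
  using smooth_differentiable frechet_derivative_works by blast

lemma smooth_continuous: "smooth f \<Longrightarrow> continuous_on S f"
  by (meson continuous_at_imp_continuous_on differentiable_imp_continuous_within smooth_differentiable)

lemma frechet_derivative_apply: "(f has_derivative f') (at x) \<Longrightarrow> frechet_derivative f (at x) b = f' b"
  using frechet_derivative_at by fastforce

text \<open>Smoothness speaks about derivatives along basis vectors; this reduces arbitrary directions to them.\<close>

lemma frechet_derivative_basis_expansion:
  assumes "f differentiable at x"
  shows "frechet_derivative f (at x) v = (\<Sum>b\<in>Basis. (v \<bullet> b) *\<^sub>R frechet_derivative f (at x) b)"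
proof -
  have l: "linear (frechet_derivative f (at x))"
    using assms linear_frechet_derivative by blast
  have "frechet_derivative f (at x) (\<Sum>b\<in>Basis. (v \<bullet> b) *\<^sub>R b)
      = (\<Sum>b\<in>Basis. (v \<bullet> b) *\<^sub>R frechet_derivative f (at x) b)"
    by (simp add: linear_sum[OF l] linear_cmul[OF l])
  then show ?thesis by (simp add: euclidean_representation)
qed

lemma smooth_continuous_derivative:
  assumes "smooth f"
  shows "continuous_on S (partial v f)"
  by (subst frechet_derivative_basis_expansion[OF smooth_differentiable[OF assms]])
    (intro continuous_intros smooth_continuous smooth_partial[OF assms])

lemma smooth_add:
  fixes f g :: "'a::euclidean_space \<Rightarrow> 'b::euclidean_space"
  assumes "smooth f" "smooth g"
  shows "smooth (\<lambda>x. f x + g x)"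
proof (rule smooth_coinduct[where P = "\<lambda>h. \<exists>f g. smooth f \<and> smooth g \<and> h = (\<lambda>x. f x + g x)"])
  fix h :: "'a \<Rightarrow> 'b" and b assume "\<exists>f g. smooth f \<and> smooth g \<and> h = (\<lambda>x. f x + g x)" and b: "b \<in> (Basis :: 'a set)"
  then obtain f g where fg: "smooth f" "smooth g" and h: "h = (\<lambda>x. f x + g x)" by blast
  have "partial b h = (\<lambda>x. partial b f x + partial b g x)"
    unfolding h by (intro ext frechet_derivative_apply has_derivative_add smooth_has_derivative fg)
  then show "\<exists>f g. smooth f \<and> smooth g \<and> partial b h = (\<lambda>x. f x + g x)"
    using fg b smooth_partial[of _ b] by (intro exI[of _ "partial b f"] exI[of _ "partial b g"] conjI) auto
next
  fix h x assume "\<exists>f g. smooth f \<and> smooth g \<and> h = (\<lambda>x. f x + g x)"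
  then show "h differentiable at x"
    by (elim exE conjE) (simp add: smooth_differentiable differentiable_add)
next
  show "\<exists>f' g'. smooth f' \<and> smooth g' \<and> (\<lambda>x. f x + g x) = (\<lambda>x. f' x + g' x)"
    using assms by (intro exI[of _ f] exI[of _ g]) simp
qed

lemma smooth_linear_image:
  fixes f :: "'a::euclidean_space \<Rightarrow> 'b::euclidean_space"
    and L :: "'b \<Rightarrow> 'c::euclidean_space"
  assumes "smooth f" "bounded_linear L"
  shows "smooth (\<lambda>x. L (f x))"
proof (rule smooth_coinduct[where P = "\<lambda>h. \<exists>f. smooth f \<and> h = (\<lambda>x. L (f x))"])
  fix h :: "'a \<Rightarrow> 'c" and b assume "\<exists>f. smooth f \<and> h = (\<lambda>x. L (f x))" and b: "b \<in> (Basis :: 'a set)"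
  then obtain f where f: "smooth f" and h: "h = (\<lambda>x. L (f x))" by blast
  have "partial b h = (\<lambda>x. L (partial b f x))"
    unfolding h
    by (intro ext frechet_derivative_apply bounded_linear.has_derivative[OF assms(2)] smooth_has_derivative f)
  then show "\<exists>f. smooth f \<and> partial b h = (\<lambda>x. L (f x))"
    using smooth_partial[OF f b] by (intro exI[of _ "partial b f"]) simp
next
  fix h x assume "\<exists>f. smooth f \<and> h = (\<lambda>x. L (f x))"
  then show "h differentiable at x"
    by (elim exE conjE, hypsubst)
      (rule differentiableI, rule bounded_linear.has_derivative[OF assms(2) smooth_has_derivative])
next
  show "\<exists>f'. smooth f' \<and> (\<lambda>x. L (f x)) = (\<lambda>x. L (f' x))"
    using assms by (intro exI[of _ f]) simp
qed

inductive_set generated_algebra :: "('a::euclidean_space \<Rightarrow> real) set \<Rightarrow> ('a \<Rightarrow> real) set" for G where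
  gen: "g \<in> G \<Longrightarrow> g \<in> generated_algebra G"
| const: "(\<lambda>x. c) \<in> generated_algebra G"
| add: "f \<in> generated_algebra G \<Longrightarrow> g \<in> generated_algebra G \<Longrightarrow> (\<lambda>x. f x + g x) \<in> generated_algebra G"
| mult: "f \<in> generated_algebra G \<Longrightarrow> g \<in> generated_algebra G \<Longrightarrow> (\<lambda>x. f x * g x) \<in> generated_algebra G"

text \<open>By the sum and product rules the partial derivatives of an expression in the generators are
expressions in the generators and their derivatives, so the generated algebra is closed under partial
derivatives as soon as those of the generators lie in it.\<close>

lemma generated_algebra_smooth:
  assumes diff: "\<And>g x. g \<in> G \<Longrightarrow> g differentiable at x"
    and part: "\<And>g b. g \<in> G \<Longrightarrow> b \<in> Basis \<Longrightarrow> partial b g \<in> generated_algebra G"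
    and f: "f \<in> generated_algebra G"
  shows "smooth f"
proof (rule smooth_coinduct[where P = "\<lambda>f. f \<in> generated_algebra G"])
  have d: "f differentiable at x" if "f \<in> generated_algebra G" for f x
    using that by induction (auto intro: diff differentiable_add differentiable_mult)
  fix f show "f \<in> generated_algebra G \<Longrightarrow> f differentiable at x" for x using d .
  fix b :: 'a assume b: "b \<in> Basis"
  assume "f \<in> generated_algebra G"
  then show "partial b f \<in> generated_algebra G"
  proof induction
    case (gen g)
    then show ?case using part b by blast
  next
    case (const c)
    then show ?case using generated_algebra.const[of 0] by simp
  next
    case (add f g)
    have "partial b (\<lambda>x. f x + g x) = (\<lambda>x. partial b f x + partial b g x)"
      using d[OF add(1)] d[OF add(2)]
      by (intro ext frechet_derivative_apply has_derivative_add) (auto simp: frechet_derivative_works)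
    then show ?case using add generated_algebra.add by simp
  next
    case (mult f g)
    have "partial b (\<lambda>x. f x * g x) = (\<lambda>x. f x * partial b g x + partial b f x * g x)"
      using d[OF mult(1)] d[OF mult(2)]
      by (intro ext frechet_derivative_apply has_derivative_mult) (auto simp: frechet_derivative_works)
    then show ?case
      by (simp only:) (intro generated_algebra.add generated_algebra.mult mult)
  qed
qed (rule f)

lemma generated_algebra_prod: "finite I \<Longrightarrow> (\<And>i. i \<in> I \<Longrightarrow> f i \<in> generated_algebra G) \<Longrightarrow> (\<lambda>x. \<Prod>i\<in>I. f i x) \<in> generated_algebra G"
  by (induction I rule: finite_induct) (auto intro: generated_algebra.intros)

text \<open>The classical flat function \<open>exp (-1/y)\<close>, extended by zero, times \<open>y\<^sup>-\<^sup>j\<close>. With the power as an index the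
family is closed under differentiation, up to linear combinations.\<close>

definition flat_power :: "nat \<Rightarrow> real \<Rightarrow> real" where
  "flat_power j y = (if 0 < y then (1/y)^j * exp (- (1/y)) else 0)"

lemma flat_power_tendsto_0: "((\<lambda>y. flat_power j y) \<longlongrightarrow> 0) (at_right 0)"
proof -
  have "((\<lambda>y. (inverse y)^j / exp (inverse y)) \<longlongrightarrow> (0::real)) (at_right 0)"
    using filterlim_compose[OF tendsto_power_div_exp_0 filterlim_inverse_at_top_right] .
  then show ?thesis
    by (rule Lim_transform_eventually)
      (auto simp: flat_power_def eventually_at_right_field exp_minus field_simps intro!: exI[of _ 1])
qed

text \<open>At zero the difference quotient of the function with index \<open>j\<close> is the function with index \<open>j + 1\<close>,
which tends to zero because the exponential beats every power.\<close>

lemma flat_power_deriv: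
  "(flat_power j has_real_derivative flat_power (j+2) y - real j * flat_power (j+1) y) (at y)"
proof -
  consider "y < 0" | "y = 0" | "y > 0" by linarith
  then show ?thesis
  proof cases
    case 1
    have "((\<lambda>y. 0) has_real_derivative 0) (at y)" by simp
    then have "(flat_power j has_real_derivative 0) (at y)"
      by (rule has_field_derivative_transform_within[where d = "-y"]) (use 1 in \<open>auto simp: flat_power_def dist_real_def\<close>)
    then show ?thesis using 1 by (simp add: flat_power_def)
  next
    case 2
    have "((\<lambda>h. flat_power j h / h) \<longlongrightarrow> 0) (at_left 0)"
      by (rule Lim_transform_eventually[OF tendsto_const])
        (auto simp: eventually_at_left_field flat_power_def intro!: exI[of _ "-1"])
    moreover have "((\<lambda>h. flat_power j h / h) \<longlongrightarrow> 0) (at_right 0)"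
      by (rule Lim_transform_eventually[OF flat_power_tendsto_0[of "Suc j"]])
        (auto simp: eventually_at_right_field flat_power_def intro!: exI[of _ 1])
    ultimately have "((\<lambda>h. flat_power j h / h) \<longlongrightarrow> 0) (at 0)"
      by (simp add: filterlim_split_at)
    then show ?thesis using 2
      by (simp add: DERIV_def flat_power_def)
  next
    case 3
    have "((\<lambda>y. (1/y)^j * exp (- (1/y))) has_real_derivative flat_power (j+2) y - real j * flat_power (j+1) y) (at y)"
      using 3
      by (auto intro!: derivative_eq_intros simp: flat_power_def field_simps power2_eq_square)
        (metis Suc_pred not_gr0 power_Suc)
    then show ?thesis
      by (rule has_field_derivative_transform_within[where d = y]) (use 3 in \<open>auto simp: flat_power_def dist_real_def\<close>)
  qed
qed

text \<open>The factor \<open>n + 1\<close> sharpens the transition: \<open>exp (-1/((n+1) y))\<close> tends to \<open>1\<close> for every \<open>y > 0\<close>. Hence the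
bumps, which are bounded by \<open>1\<close> and live on one fixed box, converge to the indicator of that box.\<close>

definition box_bump :: "'a::euclidean_space \<Rightarrow> 'a \<Rightarrow> nat \<Rightarrow> 'a \<Rightarrow> real" where
  "box_bump a b n x = (\<Prod>i\<in>Basis. flat_power 0 (real (Suc n) * (x \<bullet> i - a \<bullet> i)) * flat_power 0 (real (Suc n) * (b \<bullet> i - x \<bullet> i)))"

lemma smooth_box_bump: "smooth (box_bump a b n)"
proof -
  let ?g = "\<lambda>j (i::'a) k c (x::'a). flat_power j (k * (x \<bullet> i) + c)"
  define G where "G = {?g j i k c | j i k c. True}"
  have der: "(?g j i k c has_derivative
      (\<lambda>h. (k * (h \<bullet> i)) * (flat_power (j+2) (k * (x \<bullet> i) + c) - real j * flat_power (j+1) (k * (x \<bullet> i) + c)))) (at x)" for j i k c x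
  proof -
    have "((\<lambda>x::'a. k * (x \<bullet> i) + c) has_derivative (\<lambda>h. k * (h \<bullet> i))) (at x)"
      by (auto intro!: derivative_eq_intros)
    from has_derivative_compose[OF this flat_power_deriv[unfolded has_field_derivative_def]]
    show ?thesis by (simp add: mult.commute)
  qed
  have GI: "?g j i k c \<in> generated_algebra G" for j i k c
    unfolding G_def by (intro generated_algebra.gen) blast
  have eq: "(\<lambda>x. flat_power 0 (real (Suc n) * (x \<bullet> i - a \<bullet> i)) * flat_power 0 (real (Suc n) * (b \<bullet> i - x \<bullet> i)))
     = (\<lambda>x. ?g 0 i (real (Suc n)) (- real (Suc n) * (a \<bullet> i)) x * ?g 0 i (- real (Suc n)) (real (Suc n) * (b \<bullet> i)) x)" for i
    by (simp add: algebra_simps)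
  show ?thesis
  proof (rule generated_algebra_smooth)
    show "box_bump a b n \<in> generated_algebra G"
      unfolding box_bump_def
      by (intro generated_algebra_prod, simp, unfold eq, intro generated_algebra.mult GI)
    fix g assume "g \<in> G"
    then obtain j i k c where g: "g = ?g j i k c" unfolding G_def by blast
    show "g differentiable at x" for x
      using der unfolding g differentiable_def by blast
    fix e :: 'a
    have "partial e g = (\<lambda>x. (k * (e \<bullet> i)) * (?g (j+2) i k c x + (- real j) * ?g (j+1) i k c x))"
      unfolding g using frechet_derivative_apply[OF der] by fastforce
    also have "\<dots> \<in> generated_algebra G"
      by (intro generated_algebra.mult generated_algebra.add generated_algebra.const GI)
    finally show "partial e g \<in> generated_algebra G" .
  qed
qed

lemma box_bump_bounds: "0 \<le> box_bump a b n x" "box_bump a b n x \<le> 1"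
proof -
  have f: "0 \<le> flat_power 0 y \<and> flat_power 0 y \<le> 1" for y by (auto simp: flat_power_def)
  then show "0 \<le> box_bump a b n x" unfolding box_bump_def by (intro prod_nonneg) auto
  show "box_bump a b n x \<le> 1"
    unfolding box_bump_def using f by (intro prod_le_1) (auto intro: mult_le_one)
qed

lemma box_bump_eq_0: "x \<notin> box a b \<Longrightarrow> box_bump a b n x = 0"
proof -
  assume "x \<notin> box a b"
  then obtain i where "i \<in> Basis" "x \<bullet> i \<le> a \<bullet> i \<or> b \<bullet> i \<le> x \<bullet> i"
    by (force simp: box_def not_less)
  then show ?thesis
    unfolding box_bump_def
    by (intro prod_zero) (auto simp: flat_power_def zero_less_mult_iff intro!: bexI[of _ i])
qed

lemma box_bump_test_function:
  assumes "cbox a b \<subseteq> G"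
  shows "box_bump a b n \<in> test_functions G"
proof -
  have "closure {x. box_bump a b n x \<noteq> 0} \<subseteq> cbox a b"
    using box_bump_eq_0 box_subset_cbox by (intro closure_minimal) (auto, blast)
  then show ?thesis
    unfolding test_functions_def using assms smooth_box_bump
    by (auto simp: compact_eq_bounded_closed bounded_subset[OF bounded_cbox])
qed

lemma box_bump_tendsto: "(\<lambda>n. box_bump a b n x) \<longlonglongrightarrow> indicator (box a b) x"
proof (cases "x \<in> box a b")
  case True
  have f: "(\<lambda>n. flat_power 0 (real (Suc n) * y)) \<longlonglongrightarrow> 1" if "0 < y" for y
  proof -
    have "(\<lambda>n. exp (- (inverse y * inverse (real (Suc n))))) \<longlonglongrightarrow> exp (- (inverse y * 0))"
      by (intro tendsto_intros LIMSEQ_inverse_real_of_nat)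
    moreover have "flat_power 0 (real (Suc n) * y) = exp (- (inverse y * inverse (real (Suc n))))" for n
      using that by (simp add: flat_power_def field_simps zero_less_mult_iff add_pos_nonneg)
    ultimately show ?thesis by simp
  qed
  have "(\<lambda>n. box_bump a b n x) \<longlonglongrightarrow> (\<Prod>i\<in>(Basis::'a set). 1 * 1)"
    unfolding box_bump_def using True by (intro tendsto_prod tendsto_mult f) (auto simp: box_def)
  then show ?thesis using True by simp
qed (simp add: box_bump_eq_0)

section \<open>The fundamental lemma of the calculus of variations\<close>

text \<open>Boxes are an intersection-stable generator of the Borel sets and exhaust the space, so Dynkin's lemma
extends vanishing integrals from boxes to all Borel sets.\<close>

lemma AE_zero_of_box_integrals:
  fixes f :: "'a::euclidean_space \<Rightarrow> real"
  assumes f: "integrable lborel f"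
    and box: "\<And>a b. (LINT x|lborel. indicator (box a b) x * f x) = 0"
  shows "AE x in lborel. f x = 0"
proof (rule sigma_finite_measure.density_zero[OF sigma_finite_lborel f])
  have int: "integrable lborel (\<lambda>x. indicator A x * f x)" if "A \<in> sets lborel" for A
    using integrable_mult_indicator[OF that f] by simp
  have UNIV0: "(LINT x|lborel. f x) = 0"
  proof -
    have "(\<lambda>n. LINT x|lborel. indicator (box (- (real n *\<^sub>R One)) (real n *\<^sub>R One)) x * f x) \<longlonglongrightarrow> (LINT x|lborel. f x)"
    proof (rule integral_dominated_convergence[where w = "\<lambda>x. norm (f x)"])
      show "AE x in lborel. (\<lambda>n. indicator (box (- (real n *\<^sub>R One)) (real n *\<^sub>R One)) x * f x) \<longlonglongrightarrow> f x"
      proof (intro AE_I2)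
        fix x :: 'a
        obtain n :: nat where n: "x \<in> box (- (real n *\<^sub>R One)) (real n *\<^sub>R One)"
          using UN_box_eq_UNIV by blast
        have "x \<in> box (- (real m *\<^sub>R One)) (real m *\<^sub>R One)" if "n \<le> m" for m
          using n that by (fastforce simp: box_def)
        then show "(\<lambda>n. indicator (box (- (real n *\<^sub>R One)) (real n *\<^sub>R One)) x * f x) \<longlonglongrightarrow> f x"
          by (intro tendsto_eventually eventually_sequentiallyI[of n]) auto
      qed
    qed (use f in \<open>auto simp: indicator_def\<close>)
    then show ?thesis
      unfolding box by (simp add: LIMSEQ_const_iff)
  qed
  fix A :: "'a set" assume A: "A \<in> sets lborel"
  have "Int_stable (range (\<lambda>(a, b). box a b :: 'a set))"
    by (auto simp: Int_stable_def box_Int_box)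
  moreover have "range (\<lambda>(a, b). box a b :: 'a set) \<subseteq> Pow UNIV"
    by auto
  moreover have "A \<in> sigma_sets UNIV (range (\<lambda>(a, b). box a b))"
    using A unfolding sets_lborel borel_eq_box by simp
  ultimately have "(LINT x|lborel. indicator A x * f x) = 0"
  proof (induction rule: sigma_sets_induct_disjoint)
    case (basic A)
    then show ?case using box by auto
  next
    case empty
    then show ?case by simp
  next
    case (compl A)
    then have [measurable]: "A \<in> sets lborel" by (simp add: borel_eq_box)
    have "indicator (UNIV - A) x * f x = f x - indicator A x * f x" for x
      by (simp add: indicator_def)
    then show ?case
      using compl.IH UNIV0 Bochner_Integration.integral_diff[OF f int[of A]] \<open>A \<in> sets lborel\<close> by simp
  next
    case (union A)
    have As: "A i \<in> sets lborel" for i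
      using union(2) by (auto simp: borel_eq_box)
    have "(LINT x:(\<Union>i. A i)|lborel. f x) = (\<Sum>i. LINT x:A i|lborel. f x)"
    proof (rule lebesgue_integral_countable_add)
      show "A i \<inter> A j = {}" if "i \<noteq> j" for i j
        using union(1) that by (auto simp: disjoint_family_on_def)
      show "set_integrable lborel (\<Union>i. A i) f"
        using int[OF sets.countable_UN, of A UNIV] As
        by (simp add: set_integrable_def image_subset_iff)
    qed (use As in simp)
    then show ?case
      using union by (simp add: set_lebesgue_integral_def)
  qed
  then show "(LINT x:A|lborel. f x) = 0"
    by (simp add: set_lebesgue_integral_def)
qed

lemma integrable_lebesgue_on_iff:
  fixes f :: "'a::euclidean_space \<Rightarrow> 'b::euclidean_space"
  assumes "S \<in> sets lebesgue"
  shows "integrable (lebesgue_on S) f \<longleftrightarrow> integrable lebesgue (\<lambda>x. indicator S x *\<^sub>R f x)"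
  using assms by (simp add: integrable_restrict_space)

lemma integral_lebesgue_on_eq:
  fixes f :: "'a::euclidean_space \<Rightarrow> 'b::euclidean_space"
  assumes "S \<in> sets lebesgue"
  shows "integral\<^sup>L (lebesgue_on S) f = integral\<^sup>L lebesgue (\<lambda>x. indicator S x *\<^sub>R f x)"
  using assms by (simp add: integral_restrict_space)

lemma AE_lebesgue_on_iff:
  assumes "S \<in> sets lebesgue"
  shows "(AE x in lebesgue_on S. P x) \<longleftrightarrow> (AE x in lborel. x \<in> S \<longrightarrow> P x)"
  using assms by (simp add: AE_restrict_space_iff AE_completion_iff)

text \<open>Testing with \<open>box_bump\<close> and letting \<open>n\<close> tend to infinity gives, by dominated convergence, a vanishing
integral over each box whose closure lies in \<open>G\<close>. So \<open>f\<close> vanishes almost everywhere on each such box,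
and countably many of them cover \<open>G\<close>.\<close>

lemma fundamental_lemma_of_variations:
  fixes f :: "'a::euclidean_space \<Rightarrow> real"
  assumes G: "open G" and f: "locally_integrable G f"
    and zero: "\<And>\<phi>. \<phi> \<in> test_functions G \<Longrightarrow> (LINT x|lebesgue_on G. f x * \<phi> x) = 0"
  shows "AE x in lebesgue_on G. f x = 0"
proof -
  have Gs[simp]: "G \<in> sets lebesgue" using G by auto
  have intK: "integrable lebesgue (\<lambda>x. indicator K x * f x)" if "compact K" "K \<subseteq> G" for K
  proof -
    have "K \<in> sets lebesgue" "integrable (lebesgue_on K) f"
      using f that compact_imp_closed[of K] unfolding locally_integrable_def by auto
    then show ?thesis by (simp add: integrable_lebesgue_on_iff)
  qed
  have Ib: "integrable lebesgue (\<lambda>x. indicator (box a b) x * f x)" if ab: "cbox a b \<subseteq> G" for a b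
  proof -
    have "(\<lambda>x. indicator (box a b) x * f x) = (\<lambda>x. indicator (box a b) x *\<^sub>R (indicator (cbox a b) x * f x))"
      using box_subset_cbox[of a b] by (intro ext) (auto simp: indicator_def)
    then show ?thesis
      using integrable_mult_indicator[OF _ intK[OF compact_cbox ab], of "box a b"] by simp
  qed
  have boxG: "(LINT x|lebesgue. indicator (box a b) x * f x) = 0" if ab: "cbox a b \<subseteq> G" for a b
  proof -
    let ?f = "\<lambda>x. indicator (box a b) x * f x"
    note fm = borel_measurable_integrable[OF Ib[OF ab]]
    have "(\<lambda>n. LINT x|lebesgue. box_bump a b n x * ?f x) \<longlonglongrightarrow> (LINT x|lebesgue. indicator (box a b) x * ?f x)"
    proof (rule integral_dominated_convergence[where w = "\<lambda>x. norm (?f x)"])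
      show "AE x in lebesgue. (\<lambda>n. box_bump a b n x * ?f x) \<longlonglongrightarrow> indicator (box a b) x * ?f x"
        by (intro AE_I2 tendsto_mult_right box_bump_tendsto)
      show "AE x in lebesgue. norm (box_bump a b n x * ?f x) \<le> norm (?f x)" for n
        using box_bump_bounds[of a b n] by (intro AE_I2) (simp add: abs_mult mult_left_le_one_le)
      have [measurable]: "box_bump a b n \<in> borel_measurable borel" for n
        by (intro borel_measurable_continuous_onI smooth_continuous smooth_box_bump)
      show "(\<lambda>x. box_bump a b n x * ?f x) \<in> borel_measurable lebesgue" for n
        by (rule borel_measurable_times[OF measurable_completion fm]) simp
      show "(\<lambda>x. indicator (box a b) x * ?f x) \<in> borel_measurable lebesgue"
        by (rule borel_measurable_times[OF measurable_completion fm]) simp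
    qed (use Ib[OF ab] in simp)
    moreover have "(LINT x|lebesgue. box_bump a b n x * ?f x) = 0" for n
    proof -
      have "(\<lambda>x. box_bump a b n x * ?f x) = (\<lambda>x. indicator G x * (f x * box_bump a b n x))"
        using ab box_subset_cbox[of a b] box_bump_eq_0[of _ a b n] by (fastforce simp: indicator_def)
      then show ?thesis
        using zero[OF box_bump_test_function[OF ab], of n] by (simp add: integral_lebesgue_on_eq)
    qed
    ultimately have "(LINT x|lebesgue. indicator (box a b) x * ?f x) = 0"
      by (simp add: LIMSEQ_const_iff)
    moreover have "indicator (box a b) x * ?f x = ?f x" for x
      by (simp add: indicator_def)
    ultimately show ?thesis by simp
  qed
  have AEbox: "AE x in lborel. x \<in> box a b \<longrightarrow> f x = 0" if ab: "cbox a b \<subseteq> G" for a b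
  proof -
    note Ib = Ib[OF ab]
    obtain g where g: "g \<in> borel_measurable lborel" "AE x in lborel. indicator (box a b) x * f x = g x"
      using completion_ex_borel_measurable_real[OF borel_measurable_integrable[OF Ib]] by blast
    have ae: "AE x in lebesgue. indicator (box a b) x * f x = g x"
      using g(2) by (rule AE_completion)
    have gl: "g \<in> borel_measurable lebesgue"
      using g(1) by (rule measurable_completion)
    have "integrable lebesgue g"
      using integrable_cong_AE[OF borel_measurable_integrable[OF Ib] gl ae] Ib by simp
    then have gi: "integrable lborel g"
      using integrable_completion[OF g(1)] by simp
    have "AE x in lborel. g x = 0"
    proof (rule AE_zero_of_box_integrals[OF gi])
      fix c d :: 'a
      obtain c' d' where cd: "box c d \<inter> box a b = box c' d'"
        using that[OF box_Int_box] .
      have sub: "box c' d' = {} \<or> cbox c' d' \<subseteq> G"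
      proof (cases "box c' d' = {}")
        case False
        then have "cbox c' d' = closure (box c' d')" by (simp add: closure_box)
        also have "\<dots> \<subseteq> cbox a b"
          using cd box_subset_cbox[of a b] by (intro closure_minimal) auto
        finally show ?thesis using ab by auto
      qed simp
      have "(LINT x|lborel. indicator (box c d) x * g x) = (LINT x|lebesgue. indicator (box c d) x * g x)"
        using g(1) by (intro integral_completion[symmetric] borel_measurable_times) auto
      also have "\<dots> = (LINT x|lebesgue. indicator (box c d) x * (indicator (box a b) x * f x))"
      proof (rule integral_cong_AE)
        have im: "(indicator (box c d) :: 'a \<Rightarrow> real) \<in> borel_measurable lebesgue"
          by (rule measurable_completion) simp
        show "(\<lambda>x. indicator (box c d) x * g x) \<in> borel_measurable lebesgue"
          by (rule borel_measurable_times[OF im gl])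
        show "(\<lambda>x. indicator (box c d) x * (indicator (box a b) x * f x)) \<in> borel_measurable lebesgue"
          by (rule borel_measurable_times[OF im borel_measurable_integrable[OF Ib]])
        show "AE x in lebesgue. indicator (box c d) x * g x = indicator (box c d) x * (indicator (box a b) x * f x)"
          using ae by eventually_elim simp
      qed
      also have "\<dots> = (LINT x|lebesgue. indicator (box c' d') x * f x)"
        by (simp add: cd[symmetric] indicator_inter_arith mult.assoc)
      also have "\<dots> = 0" using sub boxG by fastforce
      finally show "(LINT x|lborel. indicator (box c d) x * g x) = 0" .
    qed
    with g(2) show ?thesis
      by eventually_elim (auto simp: indicator_def)
  qed
  define F where "F = {box a b | a b. cbox a b \<subseteq> G}"
  have FG: "\<Union>F = G"
  proof
    show "\<Union>F \<subseteq> G"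
      unfolding F_def using box_subset_cbox by blast
    show "G \<subseteq> \<Union>F"
    proof
      fix x assume "x \<in> G"
      then obtain a b where "cbox a b \<subseteq> G" "x \<in> box a b"
        using open_contains_cbox[OF G] by metis
      then show "x \<in> \<Union>F"
        unfolding F_def by blast
    qed
  qed
  obtain F' where F': "F' \<subseteq> F" "countable F'" "\<Union>F' = \<Union>F"
    by (rule Lindelof[of F]) (auto simp: F_def)
  have "AE x in lborel. \<forall>B\<in>F'. x \<in> B \<longrightarrow> f x = 0"
    using F' AEbox by (subst AE_ball_countable) (auto simp: F_def)
  then have "AE x in lborel. x \<in> G \<longrightarrow> f x = 0"
    by eventually_elim (use F' FG in blast)
  then show ?thesis by (simp add: AE_lebesgue_on_iff)
qed

section \<open>The weak symmetric gradient\<close>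

lemma integrable_lebesgue_compact_support:
  fixes k :: "'a::euclidean_space \<Rightarrow> 'b::euclidean_space"
  assumes k: "continuous_on UNIV k" and K: "compact K" "\<And>x. x \<notin> K \<Longrightarrow> k x = 0"
  shows "integrable lborel k"
proof -
  have "integrable lborel (\<lambda>x. indicator K x *\<^sub>R k x)"
    by (intro borel_integrable_compact K(1) continuous_on_subset[OF k]) auto
  moreover have "(\<lambda>x. indicator K x *\<^sub>R k x) = k"
    using K(2) by (auto simp: indicator_def)
  ultimately show ?thesis by simp
qed

lemma lebesgue_on_integral_supported:
  fixes k :: "'a::euclidean_space \<Rightarrow> 'b::euclidean_space"
  assumes G: "G \<in> sets lebesgue" and k: "integrable lborel k" and z: "\<And>x. x \<notin> G \<Longrightarrow> k x = 0"
  shows "integrable (lebesgue_on G) k" "integral\<^sup>L (lebesgue_on G) k = integral\<^sup>L lborel k"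
proof -
  have eq: "(\<lambda>x. indicator G x *\<^sub>R k x) = k"
    using z by (auto simp: indicator_def)
  have b: "k \<in> borel_measurable lborel" using k by auto
  show "integrable (lebesgue_on G) k" "integral\<^sup>L (lebesgue_on G) k = integral\<^sup>L lborel k"
    using G k b by (simp_all add: integrable_lebesgue_on_iff integral_lebesgue_on_eq eq
        integrable_completion integral_completion)
qed

lemma integrable_mult_bounded:
  fixes f g :: "'a \<Rightarrow> real"
  assumes f: "integrable M f" and g: "g \<in> borel_measurable M" and B: "\<And>x. \<bar>g x\<bar> \<le> B"
  shows "integrable M (\<lambda>x. f x * g x)"
proof (rule Bochner_Integration.integrable_bound)
  show "integrable M (\<lambda>x. B *\<^sub>R f x)" using f by simp
  show "AE x in M. norm (f x * g x) \<le> norm (B *\<^sub>R f x)"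
  proof (intro AE_I2)
    fix x
    have "\<bar>g x\<bar> * \<bar>f x\<bar> \<le> \<bar>B\<bar> * \<bar>f x\<bar>"
      using B[of x] by (intro mult_right_mono) auto
    then show "norm (f x * g x) \<le> norm (B *\<^sub>R f x)" by (simp add: abs_mult mult_ac)
  qed
qed (use f g in simp)

lemma bounded_of_compact_support:
  fixes k :: "'a::euclidean_space \<Rightarrow> 'b::euclidean_space"
  assumes k: "continuous_on UNIV k" and K: "compact K" "\<And>x. x \<notin> K \<Longrightarrow> k x = 0"
  shows "\<exists>B. \<forall>x. norm (k x) \<le> B"
proof -
  have "bounded (k ` K)"
    by (intro compact_imp_bounded compact_continuous_image K(1) continuous_on_subset[OF k]) auto
  then obtain B where "0 < B" "\<And>x. x \<in> K \<Longrightarrow> norm (k x) \<le> B"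
    by (auto simp: bounded_pos)
  then have "norm (k x) \<le> B" for x
    using K(2)[of x] by (cases "x \<in> K") auto
  then show ?thesis by blast
qed

text \<open>The weak formulation only makes sense because a locally integrable function becomes integrable on all
of \<open>G\<close> after multiplication with a continuous function of compact support in \<open>G\<close>.\<close>

lemma locally_integrable_mult:
  fixes f k :: "'a::euclidean_space \<Rightarrow> real"
  assumes f: "locally_integrable G f" and G: "G \<in> sets lebesgue" and k: "continuous_on UNIV k"
    and K: "compact K" "K \<subseteq> G" "\<And>x. x \<notin> K \<Longrightarrow> k x = 0"
  shows "integrable (lebesgue_on G) (\<lambda>x. f x * k x)"
proof -
  have Ks: "K \<in> sets lebesgue" using compact_imp_closed[OF K(1)] by simp
  have "integrable (lebesgue_on K) f"
    using f K(1,2) unfolding locally_integrable_def by blast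
  then have fK: "integrable lebesgue (\<lambda>x. indicator K x * f x)"
    by (simp add: integrable_lebesgue_on_iff[OF Ks])
  obtain M where M: "\<And>x. norm (k x) \<le> M"
    using bounded_of_compact_support[OF k K(1,3)] by blast
  have km: "k \<in> borel_measurable lebesgue"
    using k by (intro measurable_completion) (auto intro: borel_measurable_continuous_onI)
  have "integrable lebesgue (\<lambda>x. indicator K x * f x * k x)"
    using M by (intro integrable_mult_bounded[OF fK km, of M]) simp
  moreover have "(\<lambda>x. indicator K x * f x * k x) = (\<lambda>x. indicator G x *\<^sub>R (f x * k x))"
    using K(2,3) by (intro ext) (auto simp: indicator_def)
  ultimately show ?thesis using G by (simp add: integrable_lebesgue_on_iff)
qed

lemma test_functionsD:
  assumes "f \<in> test_functions G"
  shows "smooth f" "compact (closure {x. f x \<noteq> 0})" "closure {x. f x \<noteq> 0} \<subseteq> G"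
  using assms unfolding test_functions_def by auto

lemma zero_outside_support: "x \<notin> closure {x. f x \<noteq> 0} \<Longrightarrow> f x = 0"
  using closure_subset[of "{x. f x \<noteq> 0}"] by auto

lemma derivative_zero_outside_support:
  fixes f :: "'a::euclidean_space \<Rightarrow> 'b::euclidean_space"
  assumes "x \<notin> closure {x. f x \<noteq> 0}"
  shows "frechet_derivative f (at x) v = 0"
proof -
  have "((\<lambda>x. 0::'b) has_derivative (\<lambda>h. 0)) (at x)" by simp
  moreover have "open (- closure {x. f x \<noteq> 0})" "x \<in> - closure {x. f x \<noteq> 0}"
    using assms by auto
  moreover have "0 = f y" if "y \<in> - closure {x. f x \<noteq> 0}" for y
    using zero_outside_support[of y f] that by simp
  ultimately have "(f has_derivative (\<lambda>h. 0)) (at x)"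
    by (rule has_derivative_transform_within_open)
  then show ?thesis by (rule frechet_derivative_apply)
qed

text \<open>By translation invariance the difference quotients of \<open>g\<close> in direction \<open>v\<close> have integral zero. The mean
value theorem bounds them on a fixed compact set, so the integral of their limit is zero as well.\<close>

lemma integral_partial_eq_0:
  fixes g :: "'a::euclidean_space \<Rightarrow> real"
  assumes diff: "\<And>x. g differentiable at x"
    and cont: "continuous_on UNIV (partial v g)"
    and K: "compact (closure {x. g x \<noteq> 0})"
  shows "(LINT x|lborel. partial v g x) = 0"
proof -
  let ?K = "closure {x. g x \<noteq> 0}"
  define h where "h n = inverse (real (Suc n))" for n
  have h: "0 < h n" "h n \<le> 1" for n unfolding h_def by (auto simp: inverse_le_1_iff)
  have gz: "g x = 0" if "x \<notin> ?K" for x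
    using zero_outside_support that .
  have gc: "continuous_on UNIV g"
    using diff by (simp add: continuous_at_imp_continuous_on differentiable_imp_continuous_within)
  have gi: "integrable lborel g"
    using integrable_lebesgue_compact_support[OF gc K gz] .
  have gd: "(g has_derivative frechet_derivative g (at x)) (at x)" for x
    using diff frechet_derivative_works by blast
  have lin: "linear (frechet_derivative g (at x))" for x
    using diff linear_frechet_derivative by blast
  obtain M where "\<And>x. norm (partial v g x) \<le> M"
    using bounded_of_compact_support[OF cont K derivative_zero_outside_support] by blast
  then have M: "\<bar>partial v g x\<bar> \<le> M" for x by simp
  (* L contains every x for which g x or some g (x + h n *\<^sub>R v) is nonzero *)
  define L where "L = (\<lambda>(x,y). x - y) ` (?K \<times> cball 0 (norm v))"
  have L: "compact L"
    unfolding L_def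
    by (intro compact_continuous_image compact_Times K compact_cball)
      (auto simp: case_prod_beta intro!: continuous_intros)
  let ?D = "\<lambda>n x. (g (x + h n *\<^sub>R v) - g x) / h n"
  have Dbound: "\<bar>?D n x\<bar> \<le> M * indicator L x" for n x
  proof (cases "x \<in> L")
    case True
    have der: "((\<lambda>s. g (x + s *\<^sub>R v)) has_real_derivative partial v g (x + s *\<^sub>R v)) (at s)" for s
    proof -
      have "((\<lambda>s. x + s *\<^sub>R v) has_derivative (\<lambda>t. t *\<^sub>R v)) (at s)"
        by (auto intro!: derivative_eq_intros)
      from has_derivative_compose[OF this gd]
      show ?thesis
        unfolding has_field_derivative_def by (simp add: linear_cmul[OF lin] mult_commute_abs)
    qed
    obtain s where "g (x + h n *\<^sub>R v) - g (x + 0 *\<^sub>R v) = (h n - 0) * partial v g (x + s *\<^sub>R v)"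
      using MVT2[OF h(1) der] by blast
    then have "?D n x = partial v g (x + s *\<^sub>R v)"
      using h(1)[of n] by simp
    then show ?thesis using True M by simp
  next
    case False
    have "y - w \<in> L" if "y \<in> ?K" "w \<in> cball 0 (norm v)" for y w
      using that unfolding L_def by (intro image_eqI[where x = "(y, w)"]) auto
    note L1 = this
    have "norm (h n *\<^sub>R v) \<le> norm v"
      using h[of n] by (simp add: mult_left_le_one_le)
    then have I: "x + h n *\<^sub>R v \<in> ?K \<Longrightarrow> x \<in> L" "x \<in> ?K \<Longrightarrow> x \<in> L"
      using L1[of "x + h n *\<^sub>R v" "h n *\<^sub>R v"] L1[of x 0] unfolding mem_cball dist_0_norm by simp_all
    have "g (x + h n *\<^sub>R v) = 0"
      using False I(1) by (intro gz) (rule contrapos_nn)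
    moreover have "g x = 0"
      using False I(2) by (intro gz) (rule contrapos_nn)
    ultimately show ?thesis using False by simp
  qed
  have D0: "(LINT x|lborel. ?D n x) = 0" for n
  proof -
    have gm: "g \<in> borel_measurable borel" using gc by (rule borel_measurable_continuous_onI)
    have "(LINT x|lborel. g x) = (LINT x|distr lborel borel ((+) (h n *\<^sub>R v)). g x)"
      by (simp add: lborel_distr_plus)
    also have "\<dots> = (LINT x|lborel. g (x + h n *\<^sub>R v))"
      using gm by (subst integral_distr) (auto simp: add.commute)
    finally have e: "(LINT x|lborel. g (x + h n *\<^sub>R v)) = (LINT x|lborel. g x)" by simp
    have "integrable (distr lborel borel ((+) (h n *\<^sub>R v))) g"
      using gi by (simp add: lborel_distr_plus)
    then have "integrable lborel (\<lambda>x. g (x + h n *\<^sub>R v))"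
      using gm by (subst (asm) integrable_distr_eq) (auto simp: add.commute)
    then show ?thesis using gi e by simp
  qed
  have "(\<lambda>n. LINT x|lborel. ?D n x) \<longlonglongrightarrow> (LINT x|lborel. partial v g x)"
  proof (rule integral_dominated_convergence[where w = "\<lambda>x. M * indicator L x"])
    show "integrable lborel (\<lambda>x. M * indicator L x)"
      using L emeasure_compact_finite[OF L] by (intro integrable_mult_right integrable_real_indicator)
        (auto simp: compact_imp_closed)
    show "AE x in lborel. (\<lambda>n. ?D n x) \<longlonglongrightarrow> partial v g x"
    proof (intro AE_I2)
      fix x
      have "((\<lambda>s. x + s *\<^sub>R v) has_derivative (\<lambda>t. t *\<^sub>R v)) (at (0::real))"
        by (auto intro!: derivative_eq_intros)
      from has_derivative_compose[OF this, of g "frechet_derivative g (at x)"] gd[of x]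
      have "((\<lambda>s. g (x + s *\<^sub>R v)) has_real_derivative partial v g x) (at 0)"
        unfolding has_field_derivative_def by (simp add: linear_cmul[OF lin] mult_commute_abs)
      then have "((\<lambda>s. (g (x + s *\<^sub>R v) - g x) / s) \<longlongrightarrow> partial v g x) (at 0)"
        by (simp add: DERIV_def)
      moreover have "filterlim h (at 0) sequentially"
        unfolding filterlim_at h_def using LIMSEQ_inverse_real_of_nat by auto
      ultimately show "(\<lambda>n. ?D n x) \<longlonglongrightarrow> partial v g x"
        by (rule filterlim_compose)
    qed
    have "continuous_on UNIV (\<lambda>x. g (x + h n *\<^sub>R v))" for n
      by (rule continuous_on_compose2[OF gc]) (auto intro!: continuous_intros)
    then show "partial v g \<in> borel_measurable lborel" "?D n \<in> borel_measurable lborel" for n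
      using cont gc h(1)[of n]
      by (auto intro!: borel_measurable_continuous_onI continuous_on_divide continuous_on_diff
          continuous_on_add continuous_on_id continuous_on_const)
    show "AE x in lborel. norm (?D n x) \<le> M * indicator L x" for n
      using Dbound by (intro AE_I2) (simp del: abs_divide)
  qed
  then show ?thesis
    unfolding D0 by (simp add: LIMSEQ_const_iff)
qed

definition classical_symgrad ::
  "('d::finite \<Rightarrow> 'a::euclidean_space) \<Rightarrow> ('a \<Rightarrow> real^'d) \<Rightarrow> 'a \<Rightarrow> real^'d^'d" where
  "classical_symgrad e \<phi> x = (\<chi> i j. 1/2 * (partial (e j) \<phi> x $ i + partial (e i) \<phi> x $ j))"

lemma locally_integrable_continuous:
  fixes f :: "'a::euclidean_space \<Rightarrow> 'b::euclidean_space"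
  assumes "continuous_on UNIV f"
  shows "locally_integrable G f"
  unfolding locally_integrable_def
proof (intro allI impI)
  fix K assume K: "K \<subseteq> G" "compact K"
  have "integrable lborel (\<lambda>x. indicator K x *\<^sub>R f x)"
    by (intro borel_integrable_compact K continuous_on_subset[OF assms]) auto
  then have "integrable lebesgue (\<lambda>x. indicator K x *\<^sub>R f x)"
    by (intro integrable_completion[THEN iffD2]) auto
  then show "integrable (lebesgue_on K) f"
    using compact_imp_closed[OF K(2)] by (simp add: integrable_lebesgue_on_iff)
qed

lemma locally_integrable_bounded_linear:
  assumes "locally_integrable G f" "bounded_linear L"
  shows "locally_integrable G (\<lambda>x. L (f x))"
  using assms unfolding locally_integrable_def by (auto intro: integrable_bounded_linear)

lemma locally_integrable_component:
  "locally_integrable G u \<Longrightarrow> locally_integrable G (\<lambda>x. u x $ i)"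
  using locally_integrable_bounded_linear[OF _ bounded_linear_vec_nth] .

lemma locally_integrable_component2:
  "locally_integrable G E \<Longrightarrow> locally_integrable G (\<lambda>x. E x $ i $ j)"
  by (intro locally_integrable_component[of _ "\<lambda>x. E x $ i"] locally_integrable_component)

lemma integrable_mult_test:
  fixes f \<phi> :: "'a::euclidean_space \<Rightarrow> real"
  assumes f: "locally_integrable G f" and G: "open G" and \<phi>: "\<phi> \<in> test_functions G"
  shows "integrable (lebesgue_on G) (\<lambda>x. f x * \<phi> x)"
    "integrable (lebesgue_on G) (\<lambda>x. f x * partial v \<phi> x)"
proof -
  note t = test_functionsD[OF \<phi>]
  have Gs: "G \<in> sets lebesgue" using G by simp
  have "\<phi> x = 0" if "x \<notin> closure {x. \<phi> x \<noteq> 0}" for x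
    using zero_outside_support that .
  then show "integrable (lebesgue_on G) (\<lambda>x. f x * \<phi> x)"
    by (rule locally_integrable_mult[OF f Gs smooth_continuous[OF t(1)] t(2,3)])
  show "integrable (lebesgue_on G) (\<lambda>x. f x * partial v \<phi> x)"
    by (rule locally_integrable_mult[OF f Gs smooth_continuous_derivative[OF t(1)] t(2,3)
          derivative_zero_outside_support])
qed

text \<open>Integration by parts: \<open>\<phi>\<^sub>i \<eta>\<close> has compact support, so the integral of each of its derivatives is zero.\<close>

lemma weak_symgrad_test_function:
  fixes \<phi> :: "'a::euclidean_space \<Rightarrow> real^'d"
  assumes \<phi>: "\<phi> \<in> test_functions G" and G: "open G"
  shows "weak_symgrad e G \<phi> (classical_symgrad e \<phi>)"
  unfolding weak_symgrad_def
proof (intro conjI ballI allI)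
  note s = test_functionsD(1)[OF \<phi>]
  show "locally_integrable G \<phi>"
    by (intro locally_integrable_continuous smooth_continuous s)
  show "locally_integrable G (classical_symgrad e \<phi>)"
    unfolding classical_symgrad_def
    by (intro locally_integrable_continuous continuous_intros continuous_on_vec_lambda smooth_continuous_derivative[OF s])
  show "transpose (classical_symgrad e \<phi> x) = classical_symgrad e \<phi> x" for x
    by (simp add: transpose_def classical_symgrad_def vec_eq_iff)
  fix \<eta> :: "'a \<Rightarrow> real" and i j assume \<eta>: "\<eta> \<in> test_functions G"
  note t = test_functionsD[OF \<eta>]
  let ?K = "closure {x. \<eta> x \<noteq> 0}"
  have z: "\<eta> x = 0" if "x \<notin> ?K" for x
    using zero_outside_support that .
  have sc: "smooth (\<lambda>x. \<phi> x $ i)" for i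
    using smooth_linear_image[OF s bounded_linear_vec_nth] .
  have pc: "partial v (\<lambda>x. \<phi> x $ i) x = partial v \<phi> x $ i" for v i x
    by (intro frechet_derivative_apply bounded_linear.has_derivative[OF bounded_linear_vec_nth] smooth_has_derivative[OF s])
  have pp: "partial v (\<lambda>x. \<phi> x $ i * \<eta> x) = (\<lambda>x. \<phi> x $ i * partial v \<eta> x + partial v \<phi> x $ i * \<eta> x)" for v i
    by (intro ext, rule frechet_derivative_apply[THEN trans], rule has_derivative_mult, rule smooth_has_derivative[OF sc],
        rule smooth_has_derivative[OF t(1)]) (simp add: pc)
  have cont: "continuous_on UNIV (\<lambda>x. \<phi> x $ i * partial v \<eta> x + partial v \<phi> x $ i * \<eta> x)" for v i
    by (intro continuous_intros smooth_continuous smooth_continuous_derivative s t(1))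
  have supp: "compact (closure {x. \<phi> x $ i * \<eta> x \<noteq> 0})" for i
  proof -
    have "closure {x. \<phi> x $ i * \<eta> x \<noteq> 0} \<subseteq> ?K"
      by (intro closure_mono) auto
    then show ?thesis
      using t(2) by (meson bounded_subset closed_closure compact_eq_bounded_closed)
  qed
  have zero: "(LINT x|lebesgue_on G. \<phi> x $ i * partial v \<eta> x + partial v \<phi> x $ i * \<eta> x) = 0" for v i
  proof -
    have out: "\<phi> x $ i * partial v \<eta> x + partial v \<phi> x $ i * \<eta> x = 0" if "x \<notin> ?K" for x
      using z[OF that] derivative_zero_outside_support[OF that, of v] by simp
    have "(LINT x|lborel. partial v (\<lambda>x. \<phi> x $ i * \<eta> x) x) = 0"
      by (rule integral_partial_eq_0[OF differentiable_mult[OF smooth_differentiable[OF sc] smooth_differentiable[OF t(1)]] _ supp])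
        (subst pp, rule cont)
    moreover have "(LINT x|lebesgue_on G. \<phi> x $ i * partial v \<eta> x + partial v \<phi> x $ i * \<eta> x)
       = (LINT x|lborel. \<phi> x $ i * partial v \<eta> x + partial v \<phi> x $ i * \<eta> x)"
      using t(3) out G
      by (intro lebesgue_on_integral_supported(2) integrable_lebesgue_compact_support[OF cont t(2) out]) auto
    ultimately show ?thesis unfolding pp by simp
  qed
  have li: "locally_integrable G (\<lambda>x. \<phi> x $ i)" "locally_integrable G (\<lambda>x. partial v \<phi> x $ i)" for i v
    by (intro locally_integrable_continuous continuous_intros smooth_continuous smooth_continuous_derivative s)+
  note int = integrable_mult_test[OF li(1) G \<eta>] integrable_mult_test[OF li(2) G \<eta>]
  have int2: "(LINT x|lebesgue_on G. partial v \<phi> x $ i * \<eta> x) = - (LINT x|lebesgue_on G. \<phi> x $ i * partial v \<eta> x)" for v i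
    using zero[of i v] int by simp
  show "(LINT x|lebesgue_on G. classical_symgrad e \<phi> x $ i $ j * \<eta> x) =
      - (LINT x|lebesgue_on G. 1/2 * (\<phi> x $ i * partial (e j) \<eta> x + \<phi> x $ j * partial (e i) \<eta> x))"
    using int int2 by (simp add: classical_symgrad_def distrib_right mult.assoc) (simp add: field_simps)
qed

text \<open>\<open>symgrad\<close> selects an arbitrary weak symmetric gradient. Uniqueness up to null sets makes norms and
modulars independent of that selection.\<close>

lemma weak_symgrad_unique:
  fixes u :: "'a::euclidean_space \<Rightarrow> real^'d"
  assumes E: "weak_symgrad e G u E" and F: "weak_symgrad e G u F" and G: "open G"
  shows "AE x in lebesgue_on G. E x = F x"
proof -
  have "AE x in lebesgue_on G. E x $ i $ j - F x $ i $ j = 0" for i j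
  proof (rule fundamental_lemma_of_variations[OF G])
    have lE: "locally_integrable G (\<lambda>x. E x $ i $ j)" and lF: "locally_integrable G (\<lambda>x. F x $ i $ j)"
      using E F unfolding weak_symgrad_def by (auto intro: locally_integrable_component2)
    then show "locally_integrable G (\<lambda>x. E x $ i $ j - F x $ i $ j)"
      unfolding locally_integrable_def by auto
    fix \<phi> :: "'a \<Rightarrow> real" assume \<phi>: "\<phi> \<in> test_functions G"
    have "(LINT x|lebesgue_on G. E x $ i $ j * \<phi> x) = (LINT x|lebesgue_on G. F x $ i $ j * \<phi> x)"
      using E F \<phi> unfolding weak_symgrad_def by simp
    then show "(LINT x|lebesgue_on G. (E x $ i $ j - F x $ i $ j) * \<phi> x) = 0"
      using integrable_mult_test(1)[OF lE G \<phi>] integrable_mult_test(1)[OF lF G \<phi>]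
      by (simp add: left_diff_distrib)
  qed
  then have "AE x in lebesgue_on G. \<forall>i j. E x $ i $ j - F x $ i $ j = 0"
    by (simp add: AE_all_countable)
  then show ?thesis
    by eventually_elim (simp add: vec_eq_iff)
qed

lemma symgrad_AE_eq:
  assumes "weak_symgrad e G u E" "open G"
  shows "AE x in lebesgue_on G. symgrad e G u x = E x"
  using weak_symgrad_unique[OF _ assms] assms(1) unfolding symgrad_def by (metis someI)

lemma weak_symgrad_lincomb:
  fixes u v :: "'a::euclidean_space \<Rightarrow> real^'d"
  assumes u: "weak_symgrad e G u E" and v: "weak_symgrad e G v F" and G: "open G"
  shows "weak_symgrad e G (\<lambda>x. a *\<^sub>R u x + b *\<^sub>R v x) (\<lambda>x. a *\<^sub>R E x + b *\<^sub>R F x)"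
  unfolding weak_symgrad_def
proof (intro conjI ballI allI)
  have l: "locally_integrable G u" "locally_integrable G E" "locally_integrable G v" "locally_integrable G F"
    using u v unfolding weak_symgrad_def by auto
  then show "locally_integrable G (\<lambda>x. a *\<^sub>R u x + b *\<^sub>R v x)" "locally_integrable G (\<lambda>x. a *\<^sub>R E x + b *\<^sub>R F x)"
    unfolding locally_integrable_def by auto
  fix x assume "x \<in> G"
  then have "transpose (E x) = E x" "transpose (F x) = F x"
    using u v unfolding weak_symgrad_def by auto
  then show "transpose (a *\<^sub>R E x + b *\<^sub>R F x) = a *\<^sub>R E x + b *\<^sub>R F x"
    by (simp add: transpose_def vec_eq_iff)
next
  fix \<phi> :: "'a \<Rightarrow> real" and i j assume \<phi>: "\<phi> \<in> test_functions G"
  have l: "locally_integrable G u" "locally_integrable G E" "locally_integrable G v" "locally_integrable G F"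
    using u v unfolding weak_symgrad_def by auto
  note int = integrable_mult_test[OF locally_integrable_component[OF l(1)] G \<phi>]
    integrable_mult_test[OF locally_integrable_component[OF l(3)] G \<phi>]
    integrable_mult_test(1)[OF locally_integrable_component2[OF l(2)] G \<phi>]
    integrable_mult_test(1)[OF locally_integrable_component2[OF l(4)] G \<phi>]
  have eu: "(LINT x|lebesgue_on G. E x $ i $ j * \<phi> x) =
      - (LINT x|lebesgue_on G. 1/2 * (u x $ i * partial (e j) \<phi> x + u x $ j * partial (e i) \<phi> x))"
   and ev: "(LINT x|lebesgue_on G. F x $ i $ j * \<phi> x) =
      - (LINT x|lebesgue_on G. 1/2 * (v x $ i * partial (e j) \<phi> x + v x $ j * partial (e i) \<phi> x))"
    using u v \<phi> unfolding weak_symgrad_def by blast+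
  have "(LINT x|lebesgue_on G. (a *\<^sub>R E x + b *\<^sub>R F x) $ i $ j * \<phi> x)
     = a * (LINT x|lebesgue_on G. E x $ i $ j * \<phi> x) + b * (LINT x|lebesgue_on G. F x $ i $ j * \<phi> x)"
    using int by (simp add: distrib_right mult.assoc)
  also have "\<dots> = - (LINT x|lebesgue_on G. 1/2 * ((a *\<^sub>R u x + b *\<^sub>R v x) $ i * partial (e j) \<phi> x
       + (a *\<^sub>R u x + b *\<^sub>R v x) $ j * partial (e i) \<phi> x))"
    unfolding eu ev using int by (simp add: distrib_right distrib_left mult.assoc right_diff_distrib)
  finally show "(LINT x|lebesgue_on G. (a *\<^sub>R E x + b *\<^sub>R F x) $ i $ j * \<phi> x)
     = - (LINT x|lebesgue_on G. 1/2 * ((a *\<^sub>R u x + b *\<^sub>R v x) $ i * partial (e j) \<phi> x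
       + (a *\<^sub>R u x + b *\<^sub>R v x) $ j * partial (e i) \<phi> x))" .
qed

section \<open>Separability of the space of test functions\<close>

text \<open>Functions are sorted by a modulus of continuity (a pair \<open>n\<close>, \<open>m\<close>) and by their values on a finite
net, rounded to a countable dense set. Two functions of one class are uniformly close, and there are
only countably many classes, so one representative of each nonempty class suffices.\<close>

lemma uniformly_separable:
  fixes \<Phi> :: "'c \<Rightarrow> 'a::metric_space \<Rightarrow> 'b::{second_countable_topology, metric_space}"
  assumes K: "compact K" and cont: "\<And>f. f \<in> F \<Longrightarrow> continuous_on K (\<Phi> f)"
  obtains D where "countable D" "D \<subseteq> F"
    "\<And>f \<epsilon>. f \<in> F \<Longrightarrow> 0 < \<epsilon> \<Longrightarrow> \<exists>g\<in>D. \<forall>x\<in>K. dist (\<Phi> f x) (\<Phi> g x) < \<epsilon>"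
proof -
  obtain Q :: "'b set" where Q: "countable Q" "\<And>X. open X \<Longrightarrow> X \<noteq> {} \<Longrightarrow> \<exists>d\<in>Q. d \<in> X"
    using countable_dense_exists by (metis IntE all_not_in_conv)
  define r where "r n = inverse (real (Suc n))" for n
  have r: "0 < r n" for n by (simp add: r_def)
  have "\<exists>C. finite C \<and> C \<subseteq> K \<and> K \<subseteq> (\<Union>c\<in>C. ball c (r m))" for m
    using compactE_image[OF K, of K "\<lambda>c. ball c (r m)"] r[of m] by (metis UN_I centre_in_ball open_ball subsetI)
  then obtain C where C: "\<And>m. finite (C m)" "\<And>m. C m \<subseteq> K" "\<And>m. K \<subseteq> (\<Union>c\<in>C m. ball c (r m))"
    by metis
  (* N n m \<sigma>: functions with modulus of continuity r m for accuracy r n and rounded net values \<sigma> *)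
  define N where "N n m \<sigma> = {f \<in> F. (\<forall>x\<in>K. \<forall>y\<in>K. dist x y < r m \<longrightarrow> dist (\<Phi> f x) (\<Phi> f y) < r n) \<and>
       (\<forall>c\<in>C m. dist (\<Phi> f c) (\<sigma> c) < r n)}" for n m and \<sigma> :: "'a \<Rightarrow> 'b"
  define D where "D = (\<Union>n. \<Union>m. \<Union>\<sigma>\<in>{\<sigma> \<in> C m \<rightarrow>\<^sub>E Q. N n m \<sigma> \<noteq> {}}. {SOME f. f \<in> N n m \<sigma>})"
  show ?thesis
  proof
    have "countable {\<sigma> \<in> C m \<rightarrow>\<^sub>E Q. N n m \<sigma> \<noteq> {}}" for n m
      by (rule countable_subset[OF _ countable_PiE[OF C(1)[of m], of "\<lambda>_. Q"]]) (use Q(1) in auto)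
    then show "countable D"
      unfolding D_def by (intro countable_UN) auto
    have pick: "(SOME f. f \<in> N n m \<sigma>) \<in> N n m \<sigma>" if "N n m \<sigma> \<noteq> {}" for n m \<sigma>
      using that by (simp add: some_in_eq)
    then show "D \<subseteq> F"
      unfolding D_def N_def by blast
    fix f and \<epsilon> :: real assume f: "f \<in> F" and e: "0 < \<epsilon>"
    obtain n where n: "r n < \<epsilon> / 4"
      using reals_Archimedean[of "\<epsilon>/4"] e unfolding r_def by auto
    have "uniformly_continuous_on K (\<Phi> f)"
      using compact_uniformly_continuous[OF cont[OF f] K] .
    then obtain d where d: "0 < d" "\<And>x y. x \<in> K \<Longrightarrow> y \<in> K \<Longrightarrow> dist x y < d \<Longrightarrow> dist (\<Phi> f x) (\<Phi> f y) < r n"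
      unfolding uniformly_continuous_on_def using r[of n] by (metis dist_commute)
    obtain m where m: "r m < d"
      using reals_Archimedean[OF d(1)] unfolding r_def by auto
    have "\<exists>q\<in>Q. dist (\<Phi> f c) q < r n" for c
      using Q(2)[of "ball (\<Phi> f c) (r n)"] r[of n] by auto
    then obtain s where s: "\<And>c. s c \<in> Q" "\<And>c. dist (\<Phi> f c) (s c) < r n"
      by metis
    define \<sigma> where "\<sigma> = restrict s (C m)"
    have \<sigma>: "\<sigma> \<in> C m \<rightarrow>\<^sub>E Q"
      using s unfolding \<sigma>_def by auto
    have fN: "f \<in> N n m \<sigma>"
      unfolding N_def using f d(2) m s(2) by (auto simp: \<sigma>_def)
    define g where "g = (SOME f. f \<in> N n m \<sigma>)"
    have gN: "g \<in> N n m \<sigma>" and gD: "g \<in> D"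
      using pick[of n m \<sigma>] fN \<sigma> unfolding g_def D_def by blast+
    have "dist (\<Phi> f x) (\<Phi> g x) < \<epsilon>" if x: "x \<in> K" for x
    proof -
      obtain c where c: "c \<in> C m" "dist x c < r m"
        using C(3)[of m] x by (auto simp: dist_commute)
      then have cK: "c \<in> K" using C(2) by blast
      have "dist (\<Phi> f x) (\<Phi> f c) < r n" "dist (\<Phi> f c) (\<sigma> c) < r n"
           "dist (\<Phi> g x) (\<Phi> g c) < r n" "dist (\<Phi> g c) (\<sigma> c) < r n"
        using fN gN c cK x unfolding N_def by auto
      moreover have "dist (\<Phi> f x) (\<Phi> g x) \<le> dist (\<Phi> f x) (\<Phi> f c) + dist (\<Phi> f c) (\<sigma> c)
          + dist (\<Phi> g c) (\<sigma> c) + dist (\<Phi> g x) (\<Phi> g c)"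
        by (smt (verit) dist_commute dist_triangle)
      ultimately show ?thesis using n by linarith
    qed
    then show "\<exists>g\<in>D. \<forall>x\<in>K. dist (\<Phi> f x) (\<Phi> g x) < \<epsilon>"
      using gD by blast
  qed
qed

text \<open>A function and its partial derivatives are encoded as one continuous function on the compact set
\<open>closure G \<times> Basis\<close>, which reduces the \<open>C\<^sup>1\<close> distance to a uniform distance.\<close>

lemma test_functions_C1_separable:
  fixes G :: "'a::euclidean_space set"
  assumes "bounded G"
  obtains D :: "('a \<Rightarrow> 'b::euclidean_space) set" where "countable D" "D \<subseteq> test_functions G"
    "\<And>\<phi> \<epsilon>. \<phi> \<in> test_functions G \<Longrightarrow> 0 < \<epsilon> \<Longrightarrow>
       \<exists>\<psi>\<in>D. \<forall>x\<in>G. dist (\<phi> x) (\<psi> x) < \<epsilon> \<and> (\<forall>b\<in>Basis. dist (partial b \<phi> x) (partial b \<psi> x) < \<epsilon>)"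
proof -
  let ?K = "closure G \<times> (Basis :: 'a set)"
  let ?\<Phi> = "\<lambda>(f :: 'a \<Rightarrow> 'b) (x, b). (f x, frechet_derivative f (at x) b)"
  have K: "compact ?K"
    using assms finite_imp_compact[OF finite_Basis] by (intro compact_Times) (auto simp: compact_closure)
  have cont: "continuous_on ?K (?\<Phi> f)" if "f \<in> test_functions G" for f
  proof -
    note s = test_functionsD(1)[OF that]
    have eq: "?\<Phi> f = (\<lambda>z. (f (fst z), \<Sum>e\<in>Basis. (snd z \<bullet> e) *\<^sub>R partial e f (fst z)))"
      by (intro ext) (auto simp: frechet_derivative_basis_expansion[OF smooth_differentiable[OF s], symmetric] split: prod.split)
    show ?thesis
      unfolding eq
      by (intro continuous_intros continuous_on_compose2[OF smooth_continuous[OF s, of UNIV]]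
          continuous_on_compose2[OF smooth_continuous_derivative[OF s, of UNIV]]) auto
  qed
  obtain D where D: "countable D" "D \<subseteq> test_functions G"
    "\<And>f \<epsilon>. f \<in> test_functions G \<Longrightarrow> 0 < \<epsilon> \<Longrightarrow> \<exists>g\<in>D. \<forall>x\<in>?K. dist (?\<Phi> f x) (?\<Phi> g x) < \<epsilon>"
    using uniformly_separable[OF K, of "test_functions G" ?\<Phi>] cont by blast
  show ?thesis
  proof
    show "countable D" "D \<subseteq> test_functions G" by fact+
    fix \<phi> :: "'a \<Rightarrow> 'b" and \<epsilon> :: real assume "\<phi> \<in> test_functions G" "0 < \<epsilon>"
    from D(3)[OF this] obtain \<psi> where \<psi>: "\<psi> \<in> D" "\<forall>x\<in>?K. dist (?\<Phi> \<phi> x) (?\<Phi> \<psi> x) < \<epsilon>" by blast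
    have "dist (\<phi> x) (\<psi> x) < \<epsilon> \<and> dist (partial b \<phi> x) (partial b \<psi> x) < \<epsilon>" if "x \<in> G" "b \<in> Basis" for x b
    proof -
      have "(x, b) \<in> ?K" using that closure_subset by blast
      from bspec[OF \<psi>(2) this] have "dist (\<phi> x, partial b \<phi> x) (\<psi> x, partial b \<psi> x) < \<epsilon>" by simp
      then show ?thesis
        using dist_fst_le[of "(\<phi> x, partial b \<phi> x)" "(\<psi> x, partial b \<psi> x)"]
          dist_snd_le[of "(\<phi> x, partial b \<phi> x)" "(\<psi> x, partial b \<psi> x)"] by simp
    qed
    moreover obtain b :: 'a where "b \<in> Basis" using nonempty_Basis by blast
    ultimately show "\<exists>\<psi>\<in>D. \<forall>x\<in>G. dist (\<phi> x) (\<psi> x) < \<epsilon> \<and> (\<forall>b\<in>Basis. dist (partial b \<phi> x) (partial b \<psi> x) < \<epsilon>)"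
      using \<psi>(1) by blast
  qed
qed

section \<open>Fubini's theorem for Lebesgue measurable functions\<close>

lemma complete_lebesgue_on:
  assumes "S \<in> sets lebesgue"
  shows "complete_measure (lebesgue_on S)"
proof
  fix A B assume "B \<subseteq> A" "A \<in> null_sets (lebesgue_on S)"
  then show "B \<in> sets (lebesgue_on S)"
    using assms completion.complete2[of B A lborel]
    by (auto simp: null_sets_restrict_space sets_restrict_space)
qed

text \<open>Slices and limits are controlled only almost everywhere; completeness of the Lebesgue measure turns
this into measurability.\<close>

lemma measurable_lebesgue_on_AE_cong:
  assumes S: "S \<in> sets lebesgue" and g: "g \<in> measurable (lebesgue_on S) N"
    and eq: "AE x in lebesgue_on S. f x = g x" and f: "\<And>x. x \<in> S \<Longrightarrow> f x \<in> space N"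
  shows "f \<in> measurable (lebesgue_on S) N"
proof (rule measurableI)
  fix A assume A: "A \<in> sets N"
  interpret complete_measure "lebesgue_on S" by (rule complete_lebesgue_on[OF S])
  show "f -` A \<inter> space (lebesgue_on S) \<in> sets (lebesgue_on S)"
  proof (rule in_sets_AE)
    show "g -` A \<inter> space (lebesgue_on S) \<in> sets (lebesgue_on S)"
      using g A by (rule measurable_sets)
    show "AE x in lebesgue_on S. x \<in> g -` A \<inter> space (lebesgue_on S) \<longleftrightarrow> x \<in> f -` A \<inter> space (lebesgue_on S)"
      using eq by eventually_elim auto
  qed auto
qed (use f in auto)

abbreviation slice :: "('a \<times> 'b \<Rightarrow> 'c) \<Rightarrow> 'a \<Rightarrow> 'b \<Rightarrow> 'c" where
  "slice f t \<equiv> \<lambda>x. f (t, x)"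

text \<open>Lebesgue measure on a product is the completion of the product of the Lebesgue measures, so Fubini's
theorem is applied to Borel measure, where both sides agree, and to Borel representatives.\<close>

lemma AE_slice:
  fixes I :: "'a::euclidean_space set" and J :: "'b::euclidean_space set"
  assumes I: "I \<in> sets borel" and J: "J \<in> sets borel"
    and P: "AE z in lebesgue_on (I \<times> J). P z"
  shows "AE t in lebesgue_on I. AE x in lebesgue_on J. P (t, x)"
proof -
  have IJ: "I \<times> J \<in> sets lebesgue"
    using borel_Times[OF I J] by simp
  have "AE z in (lborel :: 'a measure) \<Otimes>\<^sub>M (lborel :: 'b measure). z \<in> I \<times> J \<longrightarrow> P z"
    using P unfolding AE_lebesgue_on_iff[OF IJ] lborel_prod .
  then have "AE t in lborel. AE x in lborel. (t, x) \<in> I \<times> J \<longrightarrow> P (t, x)"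
    by (rule lborel_pair.AE_pair)
  then have "AE t in lborel. t \<in> I \<longrightarrow> (AE x in lborel. x \<in> J \<longrightarrow> P (t, x))"
    by eventually_elim auto
  then show ?thesis
    using I J by (simp add: AE_lebesgue_on_iff)
qed

lemma nn_integral_lebesgue_on:
  assumes "S \<in> sets lebesgue"
  shows "(\<integral>\<^sup>+x. f x \<partial>lebesgue_on S) = (\<integral>\<^sup>+x. f x * indicator S x \<partial>lborel)"
  using assms by (simp add: nn_integral_restrict_space nn_integral_completion)

lemma
  fixes I :: "'a::euclidean_space set" and J :: "'b::euclidean_space set" and g :: "'a \<times> 'b \<Rightarrow> ennreal"
  assumes I: "I \<in> sets borel" and J: "J \<in> sets borel"
    and g: "g \<in> borel_measurable (lebesgue_on (I \<times> J))"
  shows measurable_nn_integral_slice: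
      "(\<lambda>t. \<integral>\<^sup>+x. g (t, x) \<partial>lebesgue_on J) \<in> borel_measurable (lebesgue_on I)"
    and nn_integral_slice:
      "(\<integral>\<^sup>+t. \<integral>\<^sup>+x. g (t, x) \<partial>lebesgue_on J \<partial>lebesgue_on I) = (\<integral>\<^sup>+z. g z \<partial>lebesgue_on (I \<times> J))"
proof -
  have IJ: "I \<times> J \<in> sets lebesgue" and Il: "I \<in> sets lebesgue" and Jl: "J \<in> sets lebesgue"
    using borel_Times[OF I J] I J by simp_all
  have "(\<lambda>z. g z * indicator (I \<times> J) z) \<in> borel_measurable lebesgue"
    using g IJ by (simp add: borel_measurable_restrict_space_iff_ennreal)
  then obtain g' where g': "g' \<in> borel_measurable lborel" "AE z in lborel. g z * indicator (I \<times> J) z = g' z"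
    using completion_ex_borel_measurable by blast
  have gp[measurable]: "g' \<in> borel_measurable (lborel \<Otimes>\<^sub>M lborel)"
    using g'(1) by (simp add: lborel_prod)
  have "AE z in lborel \<Otimes>\<^sub>M lborel. g z * indicator (I \<times> J) z = g' z"
    using g'(2) unfolding lborel_prod .
  from lborel_pair.AE_pair[OF this]
  have sl: "AE t in lborel. (\<integral>\<^sup>+x. g (t, x) \<partial>lebesgue_on J) * indicator I t = (\<integral>\<^sup>+x. g' (t, x) \<partial>lborel)"
  proof eventually_elim
    case (elim t)
    have "(\<integral>\<^sup>+x. g' (t, x) \<partial>lborel) = (\<integral>\<^sup>+x. g (t, x) * indicator (I \<times> J) (t, x) \<partial>lborel)"
      using elim by (intro nn_integral_cong_AE) auto
    also have "\<dots> = (\<integral>\<^sup>+x. g (t, x) \<partial>lebesgue_on J) * indicator I t"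
      unfolding nn_integral_lebesgue_on[OF Jl]
      by (cases "t \<in> I") (auto intro!: nn_integral_cong simp: indicator_def)
    finally show ?case by simp
  qed
  show "(\<lambda>t. \<integral>\<^sup>+x. g (t, x) \<partial>lebesgue_on J) \<in> borel_measurable (lebesgue_on I)"
  proof (rule measurable_lebesgue_on_AE_cong[OF Il])
    show "(\<lambda>t. \<integral>\<^sup>+x. g' (t, x) \<partial>lborel) \<in> borel_measurable (lebesgue_on I)"
      by (intro measurable_restrict_space1 measurable_completion) measurable
    show "AE t in lebesgue_on I. (\<integral>\<^sup>+x. g (t, x) \<partial>lebesgue_on J) = (\<integral>\<^sup>+x. g' (t, x) \<partial>lborel)"
      unfolding AE_lebesgue_on_iff[OF Il] using sl by eventually_elim auto
  qed simp
  have "(\<integral>\<^sup>+t. \<integral>\<^sup>+x. g (t, x) \<partial>lebesgue_on J \<partial>lebesgue_on I)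
      = (\<integral>\<^sup>+t. \<integral>\<^sup>+x. g' (t, x) \<partial>lborel \<partial>lborel)"
    unfolding nn_integral_lebesgue_on[OF Il] using sl by (rule nn_integral_cong_AE)
  also have "\<dots> = (\<integral>\<^sup>+z. g' z \<partial>(lborel \<Otimes>\<^sub>M lborel))"
    by (rule lborel.nn_integral_fst) (rule gp)
  also have "\<dots> = (\<integral>\<^sup>+z. g z \<partial>lebesgue_on (I \<times> J))"
    unfolding lborel_prod nn_integral_lebesgue_on[OF IJ] using g'(2)
    by (intro nn_integral_cong_AE) (auto elim: eventually_mono)
  finally show "(\<integral>\<^sup>+t. \<integral>\<^sup>+x. g (t, x) \<partial>lebesgue_on J \<partial>lebesgue_on I) = (\<integral>\<^sup>+z. g z \<partial>lebesgue_on (I \<times> J))" .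
qed

lemma AE_measurable_slice_real:
  fixes I :: "'a::euclidean_space set" and J :: "'b::euclidean_space set" and f :: "'a \<times> 'b \<Rightarrow> real"
  assumes I: "I \<in> sets borel" and J: "J \<in> sets borel"
    and f: "f \<in> borel_measurable (lebesgue_on (I \<times> J))"
  shows "AE t in lebesgue_on I. slice f t \<in> borel_measurable (lebesgue_on J)"
proof -
  have IJ: "I \<times> J \<in> sets lebesgue" and Il: "I \<in> sets lebesgue" and Jl: "J \<in> sets lebesgue"
    using borel_Times[OF I J] I J by simp_all
  have "(\<lambda>z. if z \<in> I \<times> J then f z else 0) \<in> borel_measurable lebesgue"
    using f borel_measurable_if[OF IJ] by blast
  then obtain f' where f': "f' \<in> borel_measurable lborel" "AE z in lborel. (if z \<in> I \<times> J then f z else 0) = f' z"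
    using completion_ex_borel_measurable_real by blast
  have "AE z in lebesgue_on (I \<times> J). f z = f' z"
    unfolding AE_lebesgue_on_iff[OF IJ] using f'(2) by eventually_elim auto
  from AE_slice[OF I J this] show ?thesis
  proof eventually_elim
    case (elim t)
    have "(\<lambda>x. f' (t, x)) \<in> borel_measurable lborel"
      using f'(1) by simp
    then have "(\<lambda>x. f' (t, x)) \<in> borel_measurable (lebesgue_on J)"
      by (intro measurable_restrict_space1 measurable_completion)
    then show ?case
      by (rule measurable_lebesgue_on_AE_cong[OF Jl]) (use elim in auto)
  qed
qed

lemma AE_measurable_slice:
  fixes I :: "'a::euclidean_space set" and J :: "'b::euclidean_space set"
    and f :: "'a \<times> 'b \<Rightarrow> 'c::euclidean_space"
  assumes I: "I \<in> sets borel" and J: "J \<in> sets borel"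
    and f: "f \<in> borel_measurable (lebesgue_on (I \<times> J))"
  shows "AE t in lebesgue_on I. slice f t \<in> borel_measurable (lebesgue_on J)"
proof -
  have "AE t in lebesgue_on I. \<forall>b\<in>Basis. (\<lambda>x. f (t, x) \<bullet> b) \<in> borel_measurable (lebesgue_on J)"
  proof (rule AE_ball_countable[THEN iffD2], simp add: countable_finite, intro ballI)
    fix b :: 'c
    have "(\<lambda>z. f z \<bullet> b) \<in> borel_measurable (lebesgue_on (I \<times> J))"
      using f by simp
    from AE_measurable_slice_real[OF I J this]
    show "AE t in lebesgue_on I. (\<lambda>x. f (t, x) \<bullet> b) \<in> borel_measurable (lebesgue_on J)" .
  qed
  then show ?thesis
    by eventually_elim (subst borel_measurable_euclidean_space, auto)
qed

lemma AE_integrable_slice: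
  fixes I :: "'a::euclidean_space set" and J :: "'b::euclidean_space set"
    and f :: "'a \<times> 'b \<Rightarrow> 'c::euclidean_space"
  assumes I: "I \<in> sets borel" and J: "J \<in> sets borel"
    and f: "integrable (lebesgue_on (I \<times> J)) f"
  shows "AE t in lebesgue_on I. integrable (lebesgue_on J) (slice f t)"
proof -
  have fm: "f \<in> borel_measurable (lebesgue_on (I \<times> J))" using f by simp
  have "(\<integral>\<^sup>+t. \<integral>\<^sup>+x. ennreal (norm (f (t, x))) \<partial>lebesgue_on J \<partial>lebesgue_on I) < \<infinity>"
    using nn_integral_slice[OF I J, of "\<lambda>z. ennreal (norm (f z))"] fm f
    by (simp add: integrable_iff_bounded)
  then have "AE t in lebesgue_on I. (\<integral>\<^sup>+x. ennreal (norm (f (t, x))) \<partial>lebesgue_on J) \<noteq> \<infinity>"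
    using fm by (intro nn_integral_PInf_AE measurable_nn_integral_slice[OF I J]) auto
  then show ?thesis
    using AE_measurable_slice[OF I J fm]
    by eventually_elim (simp add: integrable_iff_bounded top.not_eq_extremum)
qed

lemma
  fixes I :: "'a::euclidean_space set" and J :: "'b::euclidean_space set" and f :: "'a \<times> 'b \<Rightarrow> real"
  assumes I: "I \<in> sets borel" and J: "J \<in> sets borel"
    and f: "integrable (lebesgue_on (I \<times> J)) f"
  shows integrable_integral_slice: "integrable (lebesgue_on I) (\<lambda>t. LINT x|lebesgue_on J. f (t, x))"
    and integral_integral_slice: "(LINT t|lebesgue_on I. LINT x|lebesgue_on J. f (t, x)) = (LINT z|lebesgue_on (I \<times> J). f z)"
proof -
  have IJ: "I \<times> J \<in> sets lebesgue" and Il: "I \<in> sets lebesgue" and Jl: "J \<in> sets lebesgue"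
    using borel_Times[OF I J] I J by simp_all
  let ?f = "\<lambda>z. indicator (I \<times> J) z * f z"
  have fi: "integrable lebesgue ?f"
    using f IJ by (simp add: integrable_lebesgue_on_iff)
  obtain f' where f': "f' \<in> borel_measurable lborel" "AE z in lborel. ?f z = f' z"
    using completion_ex_borel_measurable_real[OF borel_measurable_integrable[OF fi]] by blast
  have ae: "AE z in lebesgue. ?f z = f' z"
    using f'(2) by (rule AE_completion)
  have f'l: "f' \<in> borel_measurable lebesgue"
    using f'(1) by (rule measurable_completion)
  have "integrable lebesgue f'"
    using integrable_cong_AE[OF borel_measurable_integrable[OF fi] f'l ae] fi by simp
  then have f'i: "integrable (lborel \<Otimes>\<^sub>M lborel) f'"
    using integrable_completion[OF f'(1)] by (simp add: lborel_prod)
  have "AE z in lborel \<Otimes>\<^sub>M lborel. ?f z = f' z"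
    using f'(2) unfolding lborel_prod .
  from lborel_pair.AE_pair[OF this]
  have sl: "AE t in lborel. indicator I t * (LINT x|lebesgue_on J. f (t, x)) = (LINT x|lborel. f' (t, x))"
    using lborel_pair.AE_integrable_fst'[OF f'i]
  proof eventually_elim
    case (elim t)
    have m: "(\<lambda>x. f' (t, x)) \<in> borel_measurable lborel" using f'(1) by simp
    have ml: "(\<lambda>x. f' (t, x)) \<in> borel_measurable lebesgue" using m by (rule measurable_completion)
    have ae: "AE x in lebesgue. ?f (t, x) = f' (t, x)"
      using elim(1) by (rule AE_completion)
    have "(\<lambda>x. ?f (t, x)) \<in> borel_measurable lebesgue"
      by (rule borel_measurable_AE[OF ml]) (use ae in eventually_elim, simp)
    then have "(LINT x|lebesgue. ?f (t, x)) = (LINT x|lebesgue. f' (t, x))"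
      using ml ae by (rule integral_cong_AE)
    also have "\<dots> = (LINT x|lborel. f' (t, x))"
      using m by (rule integral_completion)
    also have "(LINT x|lebesgue. ?f (t, x)) = indicator I t * (LINT x|lebesgue_on J. f (t, x))"
      by (cases "t \<in> I") (auto simp: integral_lebesgue_on_eq[OF Jl] indicator_def intro!: Bochner_Integration.integral_cong)
    finally show ?case .
  qed
  have F'i: "integrable lborel (\<lambda>t. LINT x|lborel. f' (t, x))"
    by (rule lborel_pair.integrable_fst'[OF f'i])
  then have F'l: "integrable lebesgue (\<lambda>t. LINT x|lborel. f' (t, x))"
    by (intro integrable_completion[THEN iffD2]) auto
  have sll: "AE t in lebesgue. indicator I t * (LINT x|lebesgue_on J. f (t, x)) = (LINT x|lborel. f' (t, x))"
    using sl by (rule AE_completion)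
  have Fm: "(\<lambda>t. indicator I t * (LINT x|lebesgue_on J. f (t, x))) \<in> borel_measurable lebesgue"
    by (rule borel_measurable_AE[OF borel_measurable_integrable[OF F'l]]) (use sll in eventually_elim, simp)
  have "integrable lebesgue (\<lambda>t. indicator I t * (LINT x|lebesgue_on J. f (t, x)))"
    using integrable_cong_AE[OF Fm _ sll] F'l by auto
  then show "integrable (lebesgue_on I) (\<lambda>t. LINT x|lebesgue_on J. f (t, x))"
    by (simp add: integrable_lebesgue_on_iff[OF Il])
  have "(LINT t|lebesgue_on I. LINT x|lebesgue_on J. f (t, x))
     = (LINT t|lebesgue. indicator I t * (LINT x|lebesgue_on J. f (t, x)))"
    by (simp add: integral_lebesgue_on_eq[OF Il])
  also have "\<dots> = (LINT t|lebesgue. LINT x|lborel. f' (t, x))"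
    using Fm F'l sll by (intro integral_cong_AE) auto
  also have "\<dots> = (LINT t|lborel. LINT x|lborel. f' (t, x))"
    using F'i by (intro integral_completion) auto
  also have "\<dots> = (LINT z|lborel. f' z)"
    using lborel_pair.integral_fst'[OF f'i] by (simp add: lborel_prod)
  also have "\<dots> = (LINT z|lebesgue. f' z)"
    using f'(1) by (rule integral_completion[symmetric])
  also have "\<dots> = (LINT z|lebesgue. ?f z)"
    using ae f'l fi by (intro integral_cong_AE) (auto elim: eventually_mono)
  also have "\<dots> = (LINT z|lebesgue_on (I \<times> J). f z)"
    by (simp add: integral_lebesgue_on_eq[OF IJ])
  finally show "(LINT t|lebesgue_on I. LINT x|lebesgue_on J. f (t, x)) = (LINT z|lebesgue_on (I \<times> J). f z)" .
qed

section \<open>Modulars and Luxemburg norms for bounded exponents\<close>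

lemma modular_cong_AE:
  "AE x in lebesgue_on G. f x = g x \<Longrightarrow> modular G p f = modular G p g"
  unfolding modular_def by (rule nn_integral_cong_AE) (auto elim: eventually_mono)

text \<open>The bound \<open>P\<close> is required at every point of \<open>G\<close>, so that the restrictions of an exponent on \<open>I \<times> \<Omega>\<close> to
time slices satisfy it as well.\<close>

locale bounded_exponent =
  fixes G :: "'a::euclidean_space set" and p :: "'a \<Rightarrow> real" and P :: real
  assumes open_G: "open G" and bounded_G: "bounded G"
    and measurable_p: "p \<in> borel_measurable (lebesgue_on G)"
    and p_ge_1: "\<And>x. x \<in> G \<Longrightarrow> 1 \<le> p x" and p_le: "\<And>x. x \<in> G \<Longrightarrow> p x \<le> P"
begin

lemma G_lebesgue: "G \<in> sets lebesgue"
  using open_G by simp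

lemma emeasure_G: "emeasure (lebesgue_on G) G = ennreal (measure lebesgue G)"
proof -
  have "G \<in> lmeasurable"
    using bounded_G open_G by (simp add: lmeasurable_open)
  then show ?thesis
    by (simp add: emeasure_restrict_space emeasure_eq_measure2 G_lebesgue)
qed

lemma measurable_integrand:
  fixes f :: "'a \<Rightarrow> 'b::euclidean_space"
  assumes f: "f \<in> borel_measurable (lebesgue_on G)"
  shows "(\<lambda>x. ennreal (norm (f x) powr p x)) \<in> borel_measurable (lebesgue_on G)"
  using f measurable_p by measurable

lemma modular_scale:
  fixes f :: "'a \<Rightarrow> 'b::euclidean_space"
  assumes f: "f \<in> borel_measurable (lebesgue_on G)" and s: "\<And>x. x \<in> G \<Longrightarrow> \<bar>s\<bar> powr p x \<le> c" and c: "0 \<le> c"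
  shows "modular G p (\<lambda>x. s *\<^sub>R f x) \<le> ennreal c * modular G p f"
proof -
  have "modular G p (\<lambda>x. s *\<^sub>R f x) \<le> (\<integral>\<^sup>+x. ennreal c * ennreal (norm (f x) powr p x) \<partial>lebesgue_on G)"
    unfolding modular_def
  proof (rule nn_integral_mono)
    fix x assume "x \<in> space (lebesgue_on G)"
    then have "norm (s *\<^sub>R f x) powr p x \<le> c * norm (f x) powr p x"
      using s[of x] by (simp add: powr_mult mult_right_mono)
    then show "ennreal (norm (s *\<^sub>R f x) powr p x) \<le> ennreal c * ennreal (norm (f x) powr p x)"
      using c by (simp add: ennreal_mult[symmetric] ennreal_leI)
  qed
  also have "\<dots> = ennreal c * modular G p f"
    unfolding modular_def by (rule nn_integral_cmult[OF measurable_integrand[OF f]])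
  finally show ?thesis .
qed

text \<open>Exponents at least one make the modular sublinear under contractions. This is the
substitute for homogeneity.\<close>

lemma modular_scale_le:
  fixes f :: "'a \<Rightarrow> 'b::euclidean_space"
  assumes f: "f \<in> borel_measurable (lebesgue_on G)" and s: "\<bar>s\<bar> \<le> 1"
  shows "modular G p (\<lambda>x. s *\<^sub>R f x) \<le> ennreal \<bar>s\<bar> * modular G p f"
  using powr_mono'[OF p_ge_1, of _ "\<bar>s\<bar>"] s by (intro modular_scale f) auto

lemma modular_scale_ge:
  fixes f :: "'a \<Rightarrow> 'b::euclidean_space"
  assumes f: "f \<in> borel_measurable (lebesgue_on G)" and s: "1 \<le> s"
  shows "modular G p (\<lambda>x. s *\<^sub>R f x) \<le> ennreal (s powr P) * modular G p f"
  using powr_mono[OF p_le s] s by (intro modular_scale f) auto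

text \<open>A substitute for the triangle inequality: the norm of a sum is at most the larger of the two doubled
norms, hence its power is at most the sum of the two powers.\<close>

lemma modular_add_le:
  fixes f g :: "'a \<Rightarrow> 'b::euclidean_space"
  assumes f: "f \<in> borel_measurable (lebesgue_on G)" and g: "g \<in> borel_measurable (lebesgue_on G)"
  shows "modular G p (\<lambda>x. f x + g x) \<le> modular G p (\<lambda>x. 2 *\<^sub>R f x) + modular G p (\<lambda>x. 2 *\<^sub>R g x)"
proof -
  have "modular G p (\<lambda>x. f x + g x) \<le> (\<integral>\<^sup>+x. ennreal (norm (2 *\<^sub>R f x) powr p x) + ennreal (norm (2 *\<^sub>R g x) powr p x) \<partial>lebesgue_on G)"
    unfolding modular_def
  proof (rule nn_integral_mono)
    fix x assume "x \<in> space (lebesgue_on G)"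
    then have p: "0 \<le> p x" using p_ge_1[of x] by simp
    have "norm (f x + g x) \<le> max (norm (2 *\<^sub>R f x)) (norm (2 *\<^sub>R g x))"
      using norm_triangle_ineq[of "f x" "g x"] by simp
    then have "norm (f x + g x) powr p x \<le> max (norm (2 *\<^sub>R f x)) (norm (2 *\<^sub>R g x)) powr p x"
      by (rule powr_mono2[OF p norm_ge_zero])
    also have "\<dots> \<le> norm (2 *\<^sub>R f x) powr p x + norm (2 *\<^sub>R g x) powr p x"
      by (simp only: max_def) (auto simp del: norm_scaleR)
    finally show "ennreal (norm (f x + g x) powr p x)
        \<le> ennreal (norm (2 *\<^sub>R f x) powr p x) + ennreal (norm (2 *\<^sub>R g x) powr p x)"
      by (subst ennreal_plus[symmetric]) (auto intro: ennreal_leI simp del: ennreal_plus)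
  qed
  also have "\<dots> = modular G p (\<lambda>x. 2 *\<^sub>R f x) + modular G p (\<lambda>x. 2 *\<^sub>R g x)"
    unfolding modular_def using f g by (intro nn_integral_add measurable_integrand borel_measurable_scaleR) auto
  finally show ?thesis .
qed

lemma modular_le_small:
  fixes f :: "'a \<Rightarrow> 'b::euclidean_space"
  assumes "\<And>x. x \<in> G \<Longrightarrow> norm (f x) \<le> \<eta>" "0 \<le> \<eta>" "\<eta> \<le> 1"
  shows "modular G p f \<le> ennreal (\<eta> * measure lebesgue G)"
proof -
  have "modular G p f \<le> (\<integral>\<^sup>+x. ennreal \<eta> \<partial>lebesgue_on G)"
    unfolding modular_def
  proof (rule nn_integral_mono)
    fix x assume "x \<in> space (lebesgue_on G)"
    then have x: "x \<in> G" by simp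
    have "norm (f x) powr p x \<le> \<eta> powr p x"
      using assms(1)[OF x] p_ge_1[OF x] by (intro powr_mono2) auto
    also have "\<dots> \<le> \<eta>"
      using powr_mono'[OF p_ge_1[OF x], of \<eta>] assms(2,3) by simp
    finally show "ennreal (norm (f x) powr p x) \<le> ennreal \<eta>"
      by (rule ennreal_leI)
  qed
  then show ?thesis
    using assms(2) by (simp add: emeasure_G ennreal_mult)
qed

lemma modular_zero: "modular G p (\<lambda>x. 0 :: 'b::euclidean_space) = 0"
  unfolding modular_def by simp

lemma Lvar_bounded:
  fixes f :: "'a \<Rightarrow> 'b::euclidean_space"
  assumes f: "f \<in> borel_measurable (lebesgue_on G)" and B: "\<And>x. x \<in> G \<Longrightarrow> norm (f x) \<le> B"
  shows "f \<in> Lvar G p"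
proof -
  define c where "c = max B 1"
  have c: "1 \<le> c" and Bc: "B \<le> c" by (auto simp: c_def)
  have "modular G p (\<lambda>x. f x /\<^sub>R c) \<le> ennreal (1 * measure lebesgue G)"
  proof (rule modular_le_small)
    fix x assume "x \<in> G"
    then have "norm (f x) \<le> c" using B Bc by fastforce
    then show "norm (f x /\<^sub>R c) \<le> 1" using c by (simp add: field_simps)
  qed auto
  then have "modular G p (\<lambda>x. f x /\<^sub>R c) < \<infinity>"
    by (auto intro: le_less_trans)
  moreover have "modular G p (\<lambda>x. c *\<^sub>R (f x /\<^sub>R c)) \<le> ennreal (c powr P) * modular G p (\<lambda>x. f x /\<^sub>R c)"
    using f c by (intro modular_scale_ge) auto
  moreover have "(\<lambda>x. c *\<^sub>R (f x /\<^sub>R c)) = f" using c by simp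
  ultimately have "modular G p f < \<infinity>"
    by (auto simp: ennreal_mult_less_top intro: le_less_trans)
  then show ?thesis unfolding Lvar_def using f by simp
qed

lemma Lvar_scale:
  fixes f :: "'a \<Rightarrow> 'b::euclidean_space"
  assumes f: "f \<in> Lvar G p"
  shows "(\<lambda>x. a *\<^sub>R f x) \<in> Lvar G p"
proof -
  have fm: "f \<in> borel_measurable (lebesgue_on G)" and fin: "modular G p f < \<infinity>"
    using f unfolding Lvar_def by auto
  define c where "c = max \<bar>a\<bar> 1"
  have c: "1 \<le> c" "\<bar>a / c\<bar> \<le> 1" by (auto simp: c_def)
  have "modular G p (\<lambda>x. (a / c) *\<^sub>R (c *\<^sub>R f x)) \<le> ennreal \<bar>a / c\<bar> * modular G p (\<lambda>x. c *\<^sub>R f x)"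
    using c fm by (intro modular_scale_le) auto
  also have "\<dots> \<le> ennreal \<bar>a / c\<bar> * (ennreal (c powr P) * modular G p f)"
    using c fm by (intro mult_left_mono modular_scale_ge) auto
  also have "\<dots> < \<infinity>"
    using fin by (simp add: ennreal_mult_less_top)
  finally show ?thesis
    using fm c by (simp add: Lvar_def)
qed

lemma Lvar_add:
  fixes f g :: "'a \<Rightarrow> 'b::euclidean_space"
  assumes f: "f \<in> Lvar G p" and g: "g \<in> Lvar G p"
  shows "(\<lambda>x. f x + g x) \<in> Lvar G p"
proof -
  have m: "f \<in> borel_measurable (lebesgue_on G)" "g \<in> borel_measurable (lebesgue_on G)"
    using f g unfolding Lvar_def by auto
  have "modular G p (\<lambda>x. f x + g x) < \<infinity>"
    using modular_add_le[OF m] Lvar_scale[OF f, of 2] Lvar_scale[OF g, of 2]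
    unfolding Lvar_def by (auto intro: le_less_trans)
  then show ?thesis using m by (simp add: Lvar_def)
qed

lemma Lvar_diff:
  fixes f g :: "'a \<Rightarrow> 'b::euclidean_space"
  assumes f: "f \<in> Lvar G p" and g: "g \<in> Lvar G p"
  shows "(\<lambda>x. f x - g x) \<in> Lvar G p"
  using Lvar_add[OF f Lvar_scale[OF g, of "-1"]] by simp

lemma Lvar_integrable:
  fixes f :: "'a \<Rightarrow> 'b::euclidean_space"
  assumes f: "f \<in> Lvar G p"
  shows "integrable (lebesgue_on G) f"
proof -
  have fm: "f \<in> borel_measurable (lebesgue_on G)" and fin: "modular G p f < \<infinity>"
    using f unfolding Lvar_def by auto
  have "(\<integral>\<^sup>+x. ennreal (norm (f x)) \<partial>lebesgue_on G) \<le> (\<integral>\<^sup>+x. 1 + ennreal (norm (f x) powr p x) \<partial>lebesgue_on G)"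
  proof (rule nn_integral_mono)
    fix x assume "x \<in> space (lebesgue_on G)"
    then have p: "1 \<le> p x" using p_ge_1 by simp
    have "norm (f x) \<le> 1 + norm (f x) powr p x"
    proof (cases "norm (f x) \<le> 1")
      case False
      then have "norm (f x) powr 1 \<le> norm (f x) powr p x" by (intro powr_mono p) simp
      then show ?thesis using False by simp
    qed (use powr_ge_zero[of "norm (f x)" "p x"] in linarith)
    then have "ennreal (norm (f x)) \<le> ennreal (1 + norm (f x) powr p x)" by (rule ennreal_leI)
    then show "ennreal (norm (f x)) \<le> 1 + ennreal (norm (f x) powr p x)" by simp
  qed
  also have "\<dots> = emeasure (lebesgue_on G) G + modular G p f"
    unfolding modular_def using measurable_integrand[OF fm] by (subst nn_integral_add) auto
  also have "\<dots> < \<infinity>"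
    using fin by (simp add: emeasure_G)
  finally show ?thesis using fm by (simp add: integrable_iff_bounded)
qed

lemma luxemburg_set_nonempty:
  fixes f :: "'a \<Rightarrow> 'b::euclidean_space"
  assumes f: "f \<in> Lvar G p"
  shows "{c. 0 < c \<and> modular G p (\<lambda>x. f x /\<^sub>R c) \<le> 1} \<noteq> {}"
proof -
  have fm: "f \<in> borel_measurable (lebesgue_on G)" and fin: "modular G p f < \<infinity>"
    using f unfolding Lvar_def by auto
  define c where "c = max 1 (enn2real (modular G p f))"
  have c: "1 \<le> c" "enn2real (modular G p f) \<le> c" by (auto simp: c_def)
  have "modular G p (\<lambda>x. inverse c *\<^sub>R f x) \<le> ennreal \<bar>inverse c\<bar> * modular G p f"
    using c fm by (intro modular_scale_le) (auto simp: inverse_le_1_iff)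
  also have "\<dots> = ennreal (inverse c * enn2real (modular G p f))"
    using c fin by (simp add: ennreal_mult)
  also have "\<dots> \<le> 1"
    using c by (simp add: ennreal_le_1 field_simps)
  finally show ?thesis using c by (auto intro!: exI[of _ c])
qed

lemma luxemburg_nonneg: "f \<in> Lvar G p \<Longrightarrow> 0 \<le> luxemburg_norm G p f"
  unfolding luxemburg_norm_def
  by (rule cInf_greatest[OF luxemburg_set_nonempty]) auto

lemma luxemburg_le:
  assumes "0 < c" "modular G p (\<lambda>x. f x /\<^sub>R c) \<le> 1"
  shows "luxemburg_norm G p f \<le> c"
  unfolding luxemburg_norm_def using assms
  by (intro cInf_lower bdd_belowI[of _ 0]) auto

text \<open>Some admissible constant lies below \<open>c\<close>, and admissibility is inherited by larger constants.\<close>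

lemma luxemburg_less:
  fixes f :: "'a \<Rightarrow> 'b::euclidean_space"
  assumes f: "f \<in> Lvar G p" and c: "luxemburg_norm G p f < c"
  shows "modular G p (\<lambda>x. f x /\<^sub>R c) \<le> 1"
proof -
  have fm: "f \<in> borel_measurable (lebesgue_on G)"
    using f unfolding Lvar_def by auto
  obtain b where b: "b < c" "0 < b" "modular G p (\<lambda>x. f x /\<^sub>R b) \<le> 1"
    using cInf_lessD[OF luxemburg_set_nonempty[OF f], of c] c unfolding luxemburg_norm_def by auto
  have "modular G p (\<lambda>x. (b/c) *\<^sub>R (f x /\<^sub>R b)) \<le> ennreal \<bar>b/c\<bar> * modular G p (\<lambda>x. f x /\<^sub>R b)"
    using b fm by (intro modular_scale_le) auto
  also have "\<dots> \<le> 1 * 1"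
    using b by (intro mult_mono) (auto simp: ennreal_le_1)
  finally show ?thesis using b by (simp add: field_simps)
qed

lemma modular_scaled_mono:
  fixes f :: "'a \<Rightarrow> 'b::euclidean_space"
  assumes f: "f \<in> borel_measurable (lebesgue_on G)" and m: "modular G p (\<lambda>x. N *\<^sub>R f x) \<le> 1"
    and N: "2 * \<bar>a\<bar> \<le> N" "0 < N"
  shows "modular G p (\<lambda>x. a *\<^sub>R f x) \<le> ennreal (1/2)"
proof -
  have "modular G p (\<lambda>x. (a/N) *\<^sub>R (N *\<^sub>R f x)) \<le> ennreal \<bar>a/N\<bar> * modular G p (\<lambda>x. N *\<^sub>R f x)"
    using N f by (intro modular_scale_le) auto
  also have "\<dots> \<le> ennreal (1/2) * 1"
    using N m by (intro mult_mono ennreal_leI) (auto simp: field_simps)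
  finally show ?thesis using N by simp
qed

lemma modular_add_le_1:
  fixes f g :: "'a \<Rightarrow> 'b::euclidean_space"
  assumes "f \<in> borel_measurable (lebesgue_on G)" "g \<in> borel_measurable (lebesgue_on G)"
    and half: "modular G p (\<lambda>x. 2 *\<^sub>R f x) \<le> ennreal (1/2)" "modular G p (\<lambda>x. 2 *\<^sub>R g x) \<le> ennreal (1/2)"
  shows "modular G p (\<lambda>x. f x + g x) \<le> 1"
proof -
  have "ennreal (1/2) + ennreal (1/2) = 1"
    by (subst ennreal_plus[symmetric]) auto
  then show ?thesis
    using order_trans[OF modular_add_le[OF assms(1,2)] add_mono[OF half]] by simp
qed

lemma modular_lincomb_le_1:
  fixes f g :: "'a \<Rightarrow> 'b::euclidean_space"
  assumes m: "f \<in> borel_measurable (lebesgue_on G)" "g \<in> borel_measurable (lebesgue_on G)"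
    and le: "modular G p (\<lambda>x. N *\<^sub>R f x) \<le> 1" "modular G p (\<lambda>x. N *\<^sub>R g x) \<le> 1"
    and N: "0 < N" "2 * \<bar>2 * a\<bar> \<le> N" "2 * \<bar>2 * b\<bar> \<le> N"
  shows "modular G p (\<lambda>x. a *\<^sub>R f x + b *\<^sub>R g x) \<le> 1"
  using modular_scaled_mono[OF m(1) le(1) N(2,1)] modular_scaled_mono[OF m(2) le(2) N(3,1)] m
  by (intro modular_add_le_1) (auto simp: mult_ac)

lemma modular_perturb_le_1:
  fixes f g h :: "'a \<Rightarrow> 'b::euclidean_space"
  assumes m: "(\<lambda>x. f x - g x) \<in> borel_measurable (lebesgue_on G)" "(\<lambda>x. g x - h x) \<in> borel_measurable (lebesgue_on G)"
    and n: "0 < n" and le: "modular G p (\<lambda>x. (4 * n) *\<^sub>R (f x - g x)) \<le> 1"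
    and close: "\<And>x. x \<in> G \<Longrightarrow> norm (g x - h x) \<le> \<eta>" "0 \<le> \<eta>" "2 * n * \<eta> \<le> 1" "2 * n * \<eta> * measure lebesgue G \<le> 1/2"
  shows "modular G p (\<lambda>x. n *\<^sub>R (f x - h x)) \<le> 1"
proof -
  have "modular G p (\<lambda>x. (2 * n) *\<^sub>R (g x - h x)) \<le> ennreal (2 * n * \<eta> * measure lebesgue G)"
    using close n by (intro modular_le_small) auto
  also have "\<dots> \<le> ennreal (1/2)" by (intro ennreal_leI close)
  finally have "modular G p (\<lambda>x. n *\<^sub>R (f x - g x) + n *\<^sub>R (g x - h x)) \<le> 1"
    using modular_scaled_mono[OF m(1) le, of "2 * n"] m n by (intro modular_add_le_1) auto
  then show ?thesis by (simp add: algebra_simps)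
qed

end

lemma luxemburg_cong_AE:
  assumes "AE x in lebesgue_on G. f x = g x"
  shows "luxemburg_norm G p f = luxemburg_norm G p g"
proof -
  have "modular G p (\<lambda>x. f x /\<^sub>R c) = modular G p (\<lambda>x. g x /\<^sub>R c)" for c
    using assms by (intro modular_cong_AE) (auto elim: eventually_mono)
  then show ?thesis by (simp add: luxemburg_norm_def)
qed

lemma test_function_bounded:
  fixes \<phi> :: "'a::euclidean_space \<Rightarrow> 'b::euclidean_space"
  assumes \<phi>: "\<phi> \<in> test_functions G"
  shows "\<exists>B. \<forall>x. norm (\<phi> x) \<le> B" "\<exists>B. \<forall>x. norm (partial v \<phi> x) \<le> B"
proof -
  note t = test_functionsD[OF \<phi>]
  show "\<exists>B. \<forall>x. norm (\<phi> x) \<le> B"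
    by (rule bounded_of_compact_support[OF smooth_continuous[OF t(1)] t(2)]) (rule zero_outside_support)
  show "\<exists>B. \<forall>x. norm (partial v \<phi> x) \<le> B"
    by (rule bounded_of_compact_support[OF smooth_continuous_derivative[OF t(1)] t(2)])
      (rule derivative_zero_outside_support)
qed

lemma norm_matrix_le: "norm (A :: real^'n^'m) \<le> (\<Sum>i\<in>UNIV. \<Sum>j\<in>UNIV. \<bar>A $ i $ j\<bar>)"
proof -
  have "norm A \<le> (\<Sum>i\<in>UNIV. norm (A $ i))"
    unfolding norm_vec_def by (rule L2_set_le_sum) simp
  also have "\<dots> \<le> (\<Sum>i\<in>UNIV. \<Sum>j\<in>UNIV. \<bar>A $ i $ j\<bar>)"
    by (intro sum_mono norm_le_l1_cart)
  finally show ?thesis .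
qed

lemma norm_matrix_le_const:
  assumes "\<And>i j. \<bar>(A :: real^'n^'m) $ i $ j\<bar> \<le> B"
  shows "norm A \<le> real (CARD('m) * CARD('n)) * B"
proof -
  have "norm A \<le> (\<Sum>i\<in>(UNIV::'m set). \<Sum>j\<in>(UNIV::'n set). B)"
    by (rule order_trans[OF norm_matrix_le]) (intro sum_mono assms)
  then show ?thesis by simp
qed

lemma continuous_measurable_lebesgue_on:
  fixes f :: "'a::euclidean_space \<Rightarrow> 'b::euclidean_space"
  assumes "continuous_on UNIV f"
  shows "f \<in> borel_measurable (lebesgue_on G)"
  using assms by (intro measurable_restrict_space1 measurable_completion) (auto intro: borel_measurable_continuous_onI)

lemma (in bounded_exponent) test_function_Lvar:
  fixes \<phi> :: "'a \<Rightarrow> 'b::euclidean_space"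
  assumes \<phi>: "\<phi> \<in> test_functions G"
  shows "\<phi> \<in> Lvar G p"
proof -
  obtain B where "\<And>x. norm (\<phi> x) \<le> B" using test_function_bounded(1)[OF \<phi>] by blast
  then show ?thesis
    by (intro Lvar_bounded continuous_measurable_lebesgue_on smooth_continuous test_functionsD(1)[OF \<phi>])
qed

lemma (in bounded_exponent) classical_symgrad_Lvar:
  fixes \<phi> :: "'a \<Rightarrow> real^'d" and e :: "'d \<Rightarrow> 'a"
  assumes \<phi>: "\<phi> \<in> test_functions G"
  shows "classical_symgrad e \<phi> \<in> Lvar G p"
proof -
  have "\<exists>B. \<forall>x. norm (partial (e j) \<phi> x) \<le> B" for j
    using test_function_bounded(2)[OF \<phi>] .
  then obtain B where B: "\<And>j x. norm (partial (e j) \<phi> x) \<le> B j" by metis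
  define C where "C = Max (range B)"
  have C: "norm (partial (e j) \<phi> x) \<le> C" for j x
    using B[where j = j and x = x] by (rule order_trans) (simp add: C_def)
  show ?thesis
  proof (rule Lvar_bounded)
    show "classical_symgrad e \<phi> \<in> borel_measurable (lebesgue_on G)"
      unfolding classical_symgrad_def
      by (intro continuous_measurable_lebesgue_on continuous_on_vec_lambda continuous_intros
          smooth_continuous_derivative test_functionsD(1)[OF \<phi>])
    fix x
    have "\<bar>classical_symgrad e \<phi> x $ i $ j\<bar> \<le> C" for i j
      using component_le_norm_cart[of "partial (e j) \<phi> x" i] C[where j = j and x = x]
        component_le_norm_cart[of "partial (e i) \<phi> x" j] C[where j = i and x = x]
      unfolding classical_symgrad_def by (simp add: abs_le_iff field_simps)
    then show "norm (classical_symgrad e \<phi> x) \<le> real (CARD('d) * CARD('d)) * C"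
      by (rule norm_matrix_le_const)
  qed
qed

section \<open>Approximation in the spaces on a domain\<close>

lemma test_functions_lincomb:
  fixes \<phi> \<psi> :: "'a::euclidean_space \<Rightarrow> 'b::euclidean_space"
  assumes \<phi>: "\<phi> \<in> test_functions G" and \<psi>: "\<psi> \<in> test_functions G"
  shows "(\<lambda>x. a *\<^sub>R \<phi> x + b *\<^sub>R \<psi> x) \<in> test_functions G"
proof -
  note s = test_functionsD[OF \<phi>] and t = test_functionsD[OF \<psi>]
  let ?K = "closure {x. \<phi> x \<noteq> 0} \<union> closure {x. \<psi> x \<noteq> 0}"
  have K: "compact ?K" using s t by auto
  have sub: "closure {x. a *\<^sub>R \<phi> x + b *\<^sub>R \<psi> x \<noteq> 0} \<subseteq> ?K"
  proof (rule closure_minimal)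
    show "{x. a *\<^sub>R \<phi> x + b *\<^sub>R \<psi> x \<noteq> 0} \<subseteq> ?K"
    proof
      fix x assume "x \<in> {x. a *\<^sub>R \<phi> x + b *\<^sub>R \<psi> x \<noteq> 0}"
      then have "x \<in> {x. \<phi> x \<noteq> 0} \<or> x \<in> {x. \<psi> x \<noteq> 0}" by auto
      then show "x \<in> ?K"
        using closure_subset[of "{x. \<phi> x \<noteq> 0}"] closure_subset[of "{x. \<psi> x \<noteq> 0}"] by blast
    qed
  qed (rule compact_imp_closed[OF K])
  have "compact (closure {x. a *\<^sub>R \<phi> x + b *\<^sub>R \<psi> x \<noteq> 0})"
    using compact_Int_closed[OF K closed_closure[of "{x. a *\<^sub>R \<phi> x + b *\<^sub>R \<psi> x \<noteq> 0}"]]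
    unfolding inf_absorb2[OF sub] .
  moreover have "smooth (\<lambda>x. a *\<^sub>R \<phi> x + b *\<^sub>R \<psi> x)"
    by (rule smooth_add[OF smooth_linear_image[OF s(1) bounded_linear_scaleR_right]
          smooth_linear_image[OF t(1) bounded_linear_scaleR_right]])
  ultimately show ?thesis
    using sub s(3) t(3) unfolding test_functions_def by blast
qed

lemma classical_symgrad_lincomb:
  assumes \<phi>: "smooth \<phi>" and \<psi>: "smooth \<psi>"
  shows "classical_symgrad e (\<lambda>x. a *\<^sub>R \<phi> x + b *\<^sub>R \<psi> x) x = a *\<^sub>R classical_symgrad e \<phi> x + b *\<^sub>R classical_symgrad e \<psi> x"
proof -
  have "partial v (\<lambda>x. a *\<^sub>R \<phi> x + b *\<^sub>R \<psi> x) x = a *\<^sub>R partial v \<phi> x + b *\<^sub>R partial v \<psi> x" for v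
    by (intro frechet_derivative_apply has_derivative_add bounded_linear.has_derivative[OF bounded_linear_scaleR_right]
        smooth_has_derivative \<phi> \<psi>)
  then show ?thesis
    by (simp add: classical_symgrad_def vec_eq_iff algebra_simps)
qed

text \<open>Both Luxemburg distances are at most \<open>1/n\<close>, expressed through modulars: these are integrals and
therefore depend measurably on a parameter, by Fubini's theorem.\<close>

definition modular_near ::
  "(real^'d) set \<Rightarrow> (real^'d \<Rightarrow> real) \<Rightarrow> (real^'d \<Rightarrow> real) \<Rightarrow> real
     \<Rightarrow> (real^'d \<Rightarrow> real^'d) \<Rightarrow> (real^'d \<Rightarrow> real^'d^'d) \<Rightarrow> (real^'d \<Rightarrow> real^'d) \<Rightarrow> bool" where
  "modular_near G q p n f E \<phi> \<longleftrightarrow> modular G q (\<lambda>x. n *\<^sub>R (f x - \<phi> x)) \<le> 1 \<and>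
     modular G p (\<lambda>x. n *\<^sub>R (E x - classical_symgrad space_dir \<phi> x)) \<le> 1"

locale exponent_pair =
  q: bounded_exponent G q Q + p: bounded_exponent G p P
  for G :: "(real^'d) set" and q Q p P
begin

lemma X_norm_eq:
  assumes "weak_symgrad space_dir G f E"
  shows "X_norm G q p f = luxemburg_norm G q f + luxemburg_norm G p E"
  unfolding X_norm_def
  using luxemburg_cong_AE[OF symgrad_AE_eq[OF assms q.open_G]] by simp

lemma diff_test_function:
  assumes f: "f \<in> Lvar G q" and E: "E \<in> Lvar G p" and w: "weak_symgrad space_dir G f E"
    and \<phi>: "\<phi> \<in> test_functions G"
  shows "(\<lambda>x. f x - \<phi> x) \<in> Lvar G q" "(\<lambda>x. E x - classical_symgrad space_dir \<phi> x) \<in> Lvar G p"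
    "weak_symgrad space_dir G (\<lambda>x. f x - \<phi> x) (\<lambda>x. E x - classical_symgrad space_dir \<phi> x)"
proof -
  show "(\<lambda>x. f x - \<phi> x) \<in> Lvar G q"
    by (intro q.Lvar_diff f q.test_function_Lvar \<phi>)
  show "(\<lambda>x. E x - classical_symgrad space_dir \<phi> x) \<in> Lvar G p"
    by (intro p.Lvar_diff E p.classical_symgrad_Lvar \<phi>)
  show "weak_symgrad space_dir G (\<lambda>x. f x - \<phi> x) (\<lambda>x. E x - classical_symgrad space_dir \<phi> x)"
    using weak_symgrad_lincomb[OF w weak_symgrad_test_function[OF \<phi> q.open_G] q.open_G, of 1 "-1"] by simp
qed

lemma X_norm_le_if_modular_near:
  assumes n: "0 < n" and close: "modular_near G q p n f E \<phi>" and w: "weak_symgrad space_dir G (\<lambda>x. f x - \<phi> x) (\<lambda>x. E x - classical_symgrad space_dir \<phi> x)"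
  shows "X_norm G q p (\<lambda>x. f x - \<phi> x) \<le> 2 / n"
proof -
  have "luxemburg_norm G q (\<lambda>x. f x - \<phi> x) \<le> inverse n"
    using close n unfolding modular_near_def by (intro q.luxemburg_le) auto
  moreover have "luxemburg_norm G p (\<lambda>x. E x - classical_symgrad space_dir \<phi> x) \<le> inverse n"
    using close n unfolding modular_near_def by (intro p.luxemburg_le) auto
  ultimately show ?thesis
    unfolding X_norm_eq[OF w] by (simp add: field_simps)
qed

lemma modular_near_if_X_norm_less:
  assumes n: "0 < n" and f: "(\<lambda>x. f x - \<phi> x) \<in> Lvar G q"
    and E: "(\<lambda>x. E x - classical_symgrad space_dir \<phi> x) \<in> Lvar G p"
    and w: "weak_symgrad space_dir G (\<lambda>x. f x - \<phi> x) (\<lambda>x. E x - classical_symgrad space_dir \<phi> x)"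
    and less: "X_norm G q p (\<lambda>x. f x - \<phi> x) < inverse n"
  shows "modular_near G q p n f E \<phi>"
proof -
  have "luxemburg_norm G q (\<lambda>x. f x - \<phi> x) < inverse n"
    "luxemburg_norm G p (\<lambda>x. E x - classical_symgrad space_dir \<phi> x) < inverse n"
    using less q.luxemburg_nonneg[OF f] p.luxemburg_nonneg[OF E] unfolding X_norm_eq[OF w] by auto
  then show ?thesis
    using q.luxemburg_less[OF f, of "inverse n"] p.luxemburg_less[OF E, of "inverse n"]
    by (simp add: modular_near_def)
qed

text \<open>The closure in the definition of \<open>X_space\<close> is rewritten in terms of a fixed weak symmetric gradient \<open>E\<close>,
instead of the one selected for each difference \<open>f - \<phi>\<close>.\<close>

lemma X_space_iff_modular_near:
  assumes f: "f \<in> Lvar G q" and E: "E \<in> Lvar G p" and w: "weak_symgrad space_dir G f E"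
  shows "f \<in> X_space G q p \<longleftrightarrow> (\<forall>n>0. \<exists>\<phi>\<in>test_functions G. modular_near G q p n f E \<phi>)"
proof
  note d = diff_test_function[OF f E w]
  assume "f \<in> X_space G q p"
  then have "\<forall>\<epsilon>>0. \<exists>\<phi>\<in>test_functions G. X_norm G q p (\<lambda>x. f x - \<phi> x) < \<epsilon>"
    unfolding X_space_def by blast
  then show "\<forall>n>0. \<exists>\<phi>\<in>test_functions G. modular_near G q p n f E \<phi>"
    using modular_near_if_X_norm_less d by (meson positive_imp_inverse_positive)
next
  note d = diff_test_function[OF f E w]
  assume *: "\<forall>n>0. \<exists>\<phi>\<in>test_functions G. modular_near G q p n f E \<phi>"
  have "\<exists>\<phi>\<in>test_functions G. X_norm G q p (\<lambda>x. f x - \<phi> x) < \<epsilon>" if e: "0 < \<epsilon>" for \<epsilon>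
  proof -
    obtain \<phi> where \<phi>: "\<phi> \<in> test_functions G" "modular_near G q p (4/\<epsilon>) f E \<phi>"
      using *[rule_format, of "4/\<epsilon>"] e by auto
    have "X_norm G q p (\<lambda>x. f x - \<phi> x) \<le> 2 / (4/\<epsilon>)"
      using e by (intro X_norm_le_if_modular_near[OF _ \<phi>(2) d(3)[OF \<phi>(1)]]) simp
    also have "\<dots> < \<epsilon>" using e by simp
    finally show ?thesis using \<phi>(1) by blast
  qed
  moreover have "f \<in> X_ambient G q p"
    unfolding X_ambient_def using f E w by blast
  ultimately show "f \<in> X_space G q p"
    unfolding X_space_def by blast
qed

lemma X_spaceE:
  assumes "f \<in> X_space G q p"
  obtains E where "f \<in> Lvar G q" "E \<in> Lvar G p" "weak_symgrad space_dir G f E"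
  using assms unfolding X_space_def X_ambient_def by blast

lemma X_norm_nonneg:
  assumes "f \<in> X_space G q p"
  shows "0 \<le> X_norm G q p f"
proof -
  obtain E where E: "f \<in> Lvar G q" "E \<in> Lvar G p" "weak_symgrad space_dir G f E"
    using X_spaceE[OF assms] .
  then show ?thesis
    unfolding X_norm_eq[OF E(3)] using q.luxemburg_nonneg[OF E(1)] p.luxemburg_nonneg[OF E(2)] by simp
qed

lemma test_function_X_space:
  assumes \<phi>: "\<phi> \<in> test_functions G"
  shows "\<phi> \<in> X_space G q p"
proof -
  have "modular_near G q p n \<phi> (classical_symgrad space_dir \<phi>) \<phi>" for n
    unfolding modular_near_def by (simp add: q.modular_zero p.modular_zero)
  then show ?thesis
    using \<phi> X_space_iff_modular_near[OF q.test_function_Lvar[OF \<phi>] p.classical_symgrad_Lvar[OF \<phi>]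
        weak_symgrad_test_function[OF \<phi> q.open_G]] by blast
qed

lemma X_space_lincomb:
  assumes f: "f \<in> X_space G q p" and g: "g \<in> X_space G q p"
  shows "(\<lambda>x. a *\<^sub>R f x + b *\<^sub>R g x) \<in> X_space G q p"
proof -
  obtain E where E: "f \<in> Lvar G q" "E \<in> Lvar G p" "weak_symgrad space_dir G f E"
    using X_spaceE[OF f] .
  obtain F where F: "g \<in> Lvar G q" "F \<in> Lvar G p" "weak_symgrad space_dir G g F"
    using X_spaceE[OF g] .
  have "\<exists>\<omega>\<in>test_functions G. modular_near G q p n (\<lambda>x. a *\<^sub>R f x + b *\<^sub>R g x) (\<lambda>x. a *\<^sub>R E x + b *\<^sub>R F x) \<omega>" if n: "0 < n" for n
  proof -
    (* large enough that rescaling from N to 2 * n * a and to 2 * n * b at least halves each modular *)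
    define N where "N = 4 * n * (\<bar>a\<bar> + \<bar>b\<bar> + 1)"
    have N: "0 < N" "2 * \<bar>2 * (n * a)\<bar> \<le> N" "2 * \<bar>2 * (n * b)\<bar> \<le> N"
      using n by (auto simp: N_def abs_mult algebra_simps add_pos_nonneg)
    obtain \<phi> where \<phi>: "\<phi> \<in> test_functions G" "modular_near G q p N f E \<phi>"
      using f X_space_iff_modular_near[OF E] N(1) by blast
    obtain \<psi> where \<psi>: "\<psi> \<in> test_functions G" "modular_near G q p N g F \<psi>"
      using g X_space_iff_modular_near[OF F] N(1) by blast
    let ?\<omega> = "\<lambda>x. a *\<^sub>R \<phi> x + b *\<^sub>R \<psi> x"
    let ?S = "classical_symgrad space_dir"
    note df = diff_test_function[OF E \<phi>(1)] and dg = diff_test_function[OF F \<psi>(1)]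
    have m: "(\<lambda>x. f x - \<phi> x) \<in> borel_measurable (lebesgue_on G)" "(\<lambda>x. g x - \<psi> x) \<in> borel_measurable (lebesgue_on G)"
      "(\<lambda>x. E x - ?S \<phi> x) \<in> borel_measurable (lebesgue_on G)" "(\<lambda>x. F x - ?S \<psi> x) \<in> borel_measurable (lebesgue_on G)"
      using df dg unfolding Lvar_def by auto
    have "modular G q (\<lambda>x. (n * a) *\<^sub>R (f x - \<phi> x) + (n * b) *\<^sub>R (g x - \<psi> x)) \<le> 1"
      using \<phi>(2) \<psi>(2) unfolding modular_near_def by (intro q.modular_lincomb_le_1[OF m(1,2) _ _ N]) auto
    moreover have "modular G p (\<lambda>x. (n * a) *\<^sub>R (E x - ?S \<phi> x) + (n * b) *\<^sub>R (F x - ?S \<psi> x)) \<le> 1"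
      using \<phi>(2) \<psi>(2) unfolding modular_near_def by (intro p.modular_lincomb_le_1[OF m(3,4) _ _ N]) auto
    ultimately have "modular_near G q p n (\<lambda>x. a *\<^sub>R f x + b *\<^sub>R g x) (\<lambda>x. a *\<^sub>R E x + b *\<^sub>R F x) ?\<omega>"
      unfolding modular_near_def
      by (simp add: classical_symgrad_lincomb[OF test_functionsD(1)[OF \<phi>(1)] test_functionsD(1)[OF \<psi>(1)]] algebra_simps)
    then show ?thesis
      using test_functions_lincomb[OF \<phi>(1) \<psi>(1)] by blast
  qed
  moreover have "(\<lambda>x. a *\<^sub>R f x + b *\<^sub>R g x) \<in> Lvar G q"
    by (intro q.Lvar_add q.Lvar_scale E F)
  moreover have "(\<lambda>x. a *\<^sub>R E x + b *\<^sub>R F x) \<in> Lvar G p"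
    by (intro p.Lvar_add p.Lvar_scale E F)
  ultimately show ?thesis
    using X_space_iff_modular_near[OF _ _ weak_symgrad_lincomb[OF E(3) F(3) q.open_G]] by blast
qed

lemma X_space_scale: "f \<in> X_space G q p \<Longrightarrow> (\<lambda>x. a *\<^sub>R f x) \<in> X_space G q p"
  using X_space_lincomb[of f f a 0] by simp

lemma X_space_diff: "f \<in> X_space G q p \<Longrightarrow> g \<in> X_space G q p \<Longrightarrow> (\<lambda>x. f x - g x) \<in> X_space G q p"
  using X_space_lincomb[of f g 1 "-1"] by simp

text \<open>The \<open>C\<^sup>1\<close> norm dominates both modulars on a bounded set, so an approximating test function may be
exchanged for a member of a \<open>C\<^sup>1\<close>-dense set.\<close>

lemma modular_near_C1_dense:
  assumes E: "f \<in> Lvar G q" "E \<in> Lvar G p" "weak_symgrad space_dir G f E" and f: "f \<in> X_space G q p"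
    and n: "0 < n" and D: "D \<subseteq> test_functions G"
    and dense: "\<And>\<phi> \<epsilon>. \<phi> \<in> test_functions G \<Longrightarrow> 0 < \<epsilon> \<Longrightarrow>
       \<exists>\<psi>\<in>D. \<forall>x\<in>G. dist (\<phi> x) (\<psi> x) < \<epsilon> \<and> (\<forall>b\<in>Basis. dist (partial b \<phi> x) (partial b \<psi> x) < \<epsilon>)"
  shows "\<exists>\<psi>\<in>D. modular_near G q p n f E \<psi>"
proof -
  let ?S = "classical_symgrad space_dir"
  let ?\<mu> = "measure lebesgue G"
  define K where "K = real (CARD('d) * CARD('d))"
  have K: "1 \<le> K"
  proof -
    have "0 < CARD('d) * CARD('d)" by simp
    then show ?thesis unfolding K_def by linarith
  qed
  (* K bounds matrix norms by entries; \<delta> makes the modular of the C1 error at most 1/2 *)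
  define \<delta> where "\<delta> = inverse (4 * n * K * (1 + ?\<mu>))"
  have pos: "0 < 4 * n * K * (1 + ?\<mu>)" using n K by (intro mult_pos_pos) (auto simp: add_pos_nonneg)
  have \<delta>: "0 < \<delta>" unfolding \<delta>_def using pos by (rule positive_imp_inverse_positive)
  have eq: "2 * n * (K * \<delta>) = inverse (2 * (1 + ?\<mu>))"
  proof -
    have "\<delta> * (4 * n * K * (1 + ?\<mu>)) = 1"
      unfolding \<delta>_def using pos by (intro left_inverse) linarith
    then show ?thesis
      by (intro inverse_unique[symmetric]) (simp add: algebra_simps)
  qed
  have \<eta>: "2 * n * (K * \<delta>) \<le> 1" "2 * n * (K * \<delta>) * ?\<mu> \<le> 1/2"
  proof -
    have "inverse (2 * (1 + m)) \<le> 1 \<and> inverse (2 * (1 + m)) * m \<le> 1/2" if "0 \<le> m" for m :: real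
      using that by (simp add: divide_simps)
    from this[of ?\<mu>] show "2 * n * (K * \<delta>) \<le> 1" "2 * n * (K * \<delta>) * ?\<mu> \<le> 1/2"
      unfolding eq by simp_all
  qed
  obtain \<phi> where \<phi>: "\<phi> \<in> test_functions G" "modular_near G q p (4 * n) f E \<phi>"
    using f X_space_iff_modular_near[OF E] n by (metis mult_pos_pos zero_less_numeral)
  obtain \<psi> where \<psi>: "\<psi> \<in> D" and
    close: "\<And>x. x \<in> G \<Longrightarrow> dist (\<phi> x) (\<psi> x) < \<delta>"
      "\<And>x b. x \<in> G \<Longrightarrow> b \<in> Basis \<Longrightarrow> dist (partial b \<phi> x) (partial b \<psi> x) < \<delta>"
    using dense[OF \<phi>(1) \<delta>] by blast
  have \<psi>t: "\<psi> \<in> test_functions G" using \<psi> D by blast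
  have closeS: "norm (?S \<phi> x - ?S \<psi> x) \<le> K * \<delta>" if x: "x \<in> G" for x
    unfolding K_def
  proof (rule norm_matrix_le_const)
    fix i j
    have "\<bar>(partial (space_dir k) \<phi> x - partial (space_dir k) \<psi> x) $ l\<bar> \<le> \<delta>" for k l
      using component_le_norm_cart[of "partial (space_dir k) \<phi> x - partial (space_dir k) \<psi> x" l]
        close(2)[OF x, of "space_dir k"] by (simp add: dist_norm axis_in_Basis_iff)
    from this[of j i] this[of i j]
    show "\<bar>(?S \<phi> x - ?S \<psi> x) $ i $ j\<bar> \<le> \<delta>"
      unfolding abs_le_iff by (simp add: classical_symgrad_def field_simps)
  qed
  note df = diff_test_function[OF E \<phi>(1)]
  have m: "(\<lambda>x. f x - \<phi> x) \<in> borel_measurable (lebesgue_on G)"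
      "(\<lambda>x. E x - ?S \<phi> x) \<in> borel_measurable (lebesgue_on G)"
    using df unfolding Lvar_def by auto
  have m2: "(\<lambda>x. \<phi> x - \<psi> x) \<in> borel_measurable (lebesgue_on G)"
      "(\<lambda>x. ?S \<phi> x - ?S \<psi> x) \<in> borel_measurable (lebesgue_on G)"
    using q.test_function_Lvar[OF \<phi>(1)] q.test_function_Lvar[OF \<psi>t]
      p.classical_symgrad_Lvar[OF \<phi>(1), of space_dir] p.classical_symgrad_Lvar[OF \<psi>t, of space_dir]
    unfolding Lvar_def by auto
  have "norm (\<phi> x - \<psi> x) \<le> K * \<delta>" if "x \<in> G" for x
  proof -
    have "norm (\<phi> x - \<psi> x) \<le> \<delta>" using close(1)[OF that] by (simp add: dist_norm)
    also have "\<dots> \<le> K * \<delta>" using K \<delta> by simp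
    finally show ?thesis .
  qed
  then have "modular G q (\<lambda>x. n *\<^sub>R (f x - \<psi> x)) \<le> 1"
    using \<phi>(2) n K \<delta> \<eta> unfolding modular_near_def by (intro q.modular_perturb_le_1[OF m(1) m2(1), where \<eta> = "K * \<delta>"]) auto
  moreover have "modular G p (\<lambda>x. n *\<^sub>R (E x - ?S \<psi> x)) \<le> 1"
    using \<phi>(2) n K \<delta> \<eta> closeS unfolding modular_near_def by (intro p.modular_perturb_le_1[OF m(2) m2(2), where \<eta> = "K * \<delta>"]) auto
  ultimately have "modular_near G q p n f E \<psi>"
    unfolding modular_near_def by blast
  then show ?thesis using \<psi> by blast
qed

lemma modular_near_tendsto:
  assumes E: "f \<in> Lvar G q" "E \<in> Lvar G p" "weak_symgrad space_dir G f E"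
    and \<phi>: "\<And>n. \<phi> n \<in> test_functions G" and close: "\<And>n. modular_near G q p (real (Suc n)) f E (\<phi> n)"
  shows "(\<lambda>n. X_norm G q p (\<lambda>x. \<phi> n x - f x)) \<longlonglongrightarrow> 0"
proof (rule tendsto_sandwich[of "\<lambda>_. 0" _ _ "\<lambda>n. 2 * inverse (real (Suc n))"])
  have sym: "luxemburg_norm G r (\<lambda>x. b x - a x) = luxemburg_norm G r (\<lambda>x. a x - b x)"
    for r and a b :: "real^'d \<Rightarrow> 'c::euclidean_space"
    unfolding luxemburg_norm_def modular_def by (simp add: norm_minus_commute)
  have w: "weak_symgrad space_dir G (\<lambda>x. \<phi> n x - f x) (\<lambda>x. classical_symgrad space_dir (\<phi> n) x - E x)" for n
    using weak_symgrad_lincomb[OF weak_symgrad_test_function[OF \<phi> q.open_G] E(3) q.open_G, where a = 1 and b = "-1"] by simp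
  have eq: "X_norm G q p (\<lambda>x. \<phi> n x - f x) = X_norm G q p (\<lambda>x. f x - \<phi> n x)" for n
    unfolding X_norm_eq[OF w] X_norm_eq[OF diff_test_function(3)[OF E \<phi>]] by (simp only: sym)
  have "X_norm G q p (\<lambda>x. f x - \<phi> n x) \<le> 2 / real (Suc n)" for n
    by (rule X_norm_le_if_modular_near[OF _ close diff_test_function(3)[OF E \<phi>]]) simp
  then show "\<forall>\<^sub>F n in sequentially. X_norm G q p (\<lambda>x. \<phi> n x - f x) \<le> 2 * inverse (real (Suc n))"
    unfolding eq by (simp add: divide_inverse)
  have "0 \<le> X_norm G q p (\<lambda>x. f x - \<phi> n x)" for n
    using diff_test_function[OF E \<phi>] q.luxemburg_nonneg p.luxemburg_nonneg
    unfolding X_norm_eq[OF diff_test_function(3)[OF E \<phi>]] by (intro add_nonneg_nonneg) blast+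
  then show "\<forall>\<^sub>F n in sequentially. 0 \<le> X_norm G q p (\<lambda>x. \<phi> n x - f x)"
    unfolding eq by simp
  show "(\<lambda>n. 2 * inverse (real (Suc n))) \<longlonglongrightarrow> 0"
    using tendsto_mult[OF tendsto_const[of 2] LIMSEQ_inverse_real_of_nat] by simp
qed simp

lemma scale_into_unit_ball:
  assumes f: "f \<in> X_space G q p"
  obtains s where "0 < s" "X_norm G q p (\<lambda>x. f x /\<^sub>R s) \<le> 1"
proof -
  obtain E where E: "f \<in> Lvar G q" "E \<in> Lvar G p" "weak_symgrad space_dir G f E"
    using X_spaceE[OF f] .
  (* L exceeds both norms, so dividing by 2 * L makes each of them at most 1/2 *)
  define L where "L = luxemburg_norm G q f + luxemburg_norm G p E + 1"
  have L: "luxemburg_norm G q f < L" "luxemburg_norm G p E < L" "0 < L"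
    using q.luxemburg_nonneg[OF E(1)] p.luxemburg_nonneg[OF E(2)] by (auto simp: L_def)
  have w: "weak_symgrad space_dir G (\<lambda>x. f x /\<^sub>R (2 * L)) (\<lambda>x. E x /\<^sub>R (2 * L))"
    using weak_symgrad_lincomb[OF E(3) E(3) q.open_G, of "inverse (2 * L)" 0] by simp
  have "luxemburg_norm G q (\<lambda>x. f x /\<^sub>R (2 * L)) \<le> 1/2"
    using q.luxemburg_less[OF E(1) L(1)] L(3) by (intro q.luxemburg_le) (simp_all add: field_simps)
  moreover have "luxemburg_norm G p (\<lambda>x. E x /\<^sub>R (2 * L)) \<le> 1/2"
    using p.luxemburg_less[OF E(2) L(2)] L(3) by (intro p.luxemburg_le) (simp_all add: field_simps)
  ultimately have "X_norm G q p (\<lambda>x. f x /\<^sub>R (2 * L)) \<le> 1"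
    unfolding X_norm_eq[OF w] by simp
  then show ?thesis using that[of "2 * L"] L(3) by simp
qed

text \<open>Weak convergence in the dual is tested with the whole bidual; evaluation at \<open>v\<close> is the member that
turns demi-continuity into convergence of the pairings with \<open>v\<close>.\<close>

lemma evaluation_in_bidual:
  assumes v: "v \<in> X_space G q p"
  shows "(\<lambda>F. F v) \<in> dual_space (dual_space (X_space G q p) (X_norm G q p)) (dual_norm (X_space G q p) (X_norm G q p))"
proof -
  let ?X = "X_space G q p" and ?N = "X_norm G q p"
  obtain s where s: "0 < s" "?N (\<lambda>x. v x /\<^sub>R s) \<le> 1" using scale_into_unit_ball[OF v] .
  have ws: "(\<lambda>x. v x /\<^sub>R s) \<in> ?X" by (rule X_space_scale[OF v])
  have "\<bar>F v\<bar> \<le> s * dual_norm ?X ?N F" if F: "F \<in> dual_space ?X ?N" for F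
  proof -
    obtain C where C: "\<And>w. w \<in> ?X \<Longrightarrow> \<bar>F w\<bar> \<le> C * ?N w"
      using F unfolding dual_space_def by blast
    have "bdd_above {\<bar>F w\<bar> |w. w \<in> ?X \<and> ?N w \<le> 1}"
    proof (rule bdd_aboveI)
      fix y assume "y \<in> {\<bar>F w\<bar> |w. w \<in> ?X \<and> ?N w \<le> 1}"
      then obtain w where w: "y = \<bar>F w\<bar>" "w \<in> ?X" "?N w \<le> 1" by blast
      have "C * ?N w \<le> \<bar>C\<bar> * 1"
        using X_norm_nonneg[OF w(2)] w(3) by (intro mult_mono) auto
      then show "y \<le> \<bar>C\<bar>" using C[OF w(2)] w(1) by simp
    qed
    then have le: "\<bar>F (\<lambda>x. v x /\<^sub>R s)\<bar> \<le> dual_norm ?X ?N F"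
      unfolding dual_norm_def using ws s(2) by (intro cSup_upper) auto
    have "F (\<lambda>x. v x /\<^sub>R s) = inverse s * F v"
      using F v unfolding dual_space_def by blast
    then have "F v = s * F (\<lambda>x. v x /\<^sub>R s)" using s(1) by simp
    then have "\<bar>F v\<bar> = s * \<bar>F (\<lambda>x. v x /\<^sub>R s)\<bar>" using s(1) by (simp add: abs_mult)
    then show ?thesis using le s(1) by simp
  qed
  then show ?thesis
    by (subst dual_space_def) (auto intro!: exI[of _ s])
qed

lemma demicontinuous_tendsto:
  assumes A: "demicontinuous (X_space G q p) (X_norm G q p) A"
    and us: "\<And>n. us n \<in> X_space G q p" and u: "u \<in> X_space G q p" and v: "v \<in> X_space G q p"
    and lim: "(\<lambda>n. X_norm G q p (\<lambda>x. us n x - u x)) \<longlonglongrightarrow> 0"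
  shows "(\<lambda>n. A (us n) v) \<longlonglongrightarrow> A u v"
  using A[unfolded demicontinuous_def, rule_format, OF u us lim evaluation_in_bidual[OF v]] .

lemma functional_tendsto:
  assumes F: "F \<in> dual_space (X_space G q p) (X_norm G q p)"
    and us: "\<And>n. us n \<in> X_space G q p" and u: "u \<in> X_space G q p"
    and lim: "(\<lambda>n. X_norm G q p (\<lambda>x. us n x - u x)) \<longlonglongrightarrow> 0"
  shows "(\<lambda>n. F (us n)) \<longlonglongrightarrow> F u"
proof -
  obtain C where C: "\<And>w. w \<in> X_space G q p \<Longrightarrow> \<bar>F w\<bar> \<le> C * X_norm G q p w"
    using F unfolding dual_space_def by blast
  have add: "\<And>v w. v \<in> X_space G q p \<Longrightarrow> w \<in> X_space G q p \<Longrightarrow> F (\<lambda>x. v x + w x) = F v + F w"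
    using F unfolding dual_space_def by blast
  have d: "(\<lambda>x. us n x - u x) \<in> X_space G q p" for n
    by (rule X_space_diff[OF us u])
  have eq: "F (us n) - F u = F (\<lambda>x. us n x - u x)" for n
    using add[OF d u, of n] by simp
  have "(\<lambda>n. F (us n) - F u) \<longlonglongrightarrow> 0"
  proof (rule tendsto_rabs_zero_cancel, rule tendsto_sandwich[of "\<lambda>_. 0"])
    show "\<forall>\<^sub>F n in sequentially. \<bar>F (us n) - F u\<bar> \<le> C * X_norm G q p (\<lambda>x. us n x - u x)"
      unfolding eq using C[OF d] by simp
    show "(\<lambda>n. C * X_norm G q p (\<lambda>x. us n x - u x)) \<longlonglongrightarrow> 0"
      using tendsto_mult[OF tendsto_const[of C] lim] by simp
  qed simp_all
  then show ?thesis by (simp add: LIM_zero_iff)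
qed

end

section \<open>Time slices of the weak symmetric gradient\<close>

lemma has_derivative_comp_fst:
  fixes f :: "'a::euclidean_space \<Rightarrow> real"
  assumes "f differentiable at (fst z)"
  shows "((\<lambda>z :: 'a \<times> 'b::euclidean_space. f (fst z)) has_derivative (\<lambda>h. frechet_derivative f (at (fst z)) (fst h))) (at z)"
  by (rule has_derivative_compose[where f = fst])
    (auto intro!: derivative_eq_intros simp: frechet_derivative_works[symmetric] assms)

lemma has_derivative_comp_snd:
  fixes f :: "'b::euclidean_space \<Rightarrow> real"
  assumes "f differentiable at (snd z)"
  shows "((\<lambda>z :: 'a::euclidean_space \<times> 'b. f (snd z)) has_derivative (\<lambda>h. frechet_derivative f (at (snd z)) (snd h))) (at z)"
  by (rule has_derivative_compose[where f = snd])
    (auto intro!: derivative_eq_intros simp: frechet_derivative_works[symmetric] assms)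

text \<open>Functions of \<open>fst z\<close> alone and of \<open>snd z\<close> alone generate a suitable algebra, because their partial
derivatives are again of this form or vanish.\<close>

lemma smooth_tensor:
  fixes \<eta> :: "'a::euclidean_space \<Rightarrow> real" and \<psi> :: "'b::euclidean_space \<Rightarrow> real"
  assumes \<eta>: "smooth \<eta>" and \<psi>: "smooth \<psi>"
  shows "smooth (\<lambda>z. \<eta> (fst z) * \<psi> (snd z))"
proof -
  define F :: "('a \<times> 'b \<Rightarrow> real) set" where "F = {\<lambda>z. f (fst z) | f. smooth f}"
  define S :: "('a \<times> 'b \<Rightarrow> real) set" where "S = {\<lambda>z. g (snd z) | g. smooth g}"
  have F: "(\<lambda>z. f (fst z)) \<in> generated_algebra (F \<union> S)" if "smooth f" for f
    using that unfolding F_def by (intro generated_algebra.gen) blast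
  have S: "(\<lambda>z. g (snd z)) \<in> generated_algebra (F \<union> S)" if "smooth g" for g
    using that unfolding S_def by (intro generated_algebra.gen) blast
  have lin0: "frechet_derivative f (at x) 0 = 0" if "smooth f" for f :: "'c::euclidean_space \<Rightarrow> real" and x
    using linear_0[OF linear_frechet_derivative[OF smooth_differentiable[OF that]]] .
  show ?thesis
  proof (rule generated_algebra_smooth)
    show "(\<lambda>z. \<eta> (fst z) * \<psi> (snd z)) \<in> generated_algebra (F \<union> S)"
      by (intro generated_algebra.mult F S \<eta> \<psi>)
    fix g assume g: "g \<in> F \<union> S"
    then show "g differentiable at z" for z
      using has_derivative_comp_fst[OF smooth_differentiable] has_derivative_comp_snd[OF smooth_differentiable]
      unfolding F_def S_def differentiable_def by blast
    fix b :: "'a \<times> 'b" assume b: "b \<in> Basis"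
    then consider (l) i where "b = (i, 0)" "i \<in> Basis" | (r) j where "b = (0, j)" "j \<in> Basis"
      unfolding Basis_prod_def by auto
    note bcases = this
    from g show "partial b g \<in> generated_algebra (F \<union> S)"
    proof
      assume "g \<in> F"
      then obtain f where f: "g = (\<lambda>z. f (fst z))" "smooth f" unfolding F_def by blast
      have p: "partial b g = (\<lambda>z. frechet_derivative f (at (fst z)) (fst b))"
        unfolding f(1) using frechet_derivative_apply[OF has_derivative_comp_fst[OF smooth_differentiable[OF f(2)]]] by fastforce
      from bcases show ?thesis
      proof cases
        case l
        then show ?thesis unfolding p using F[OF smooth_partial[OF f(2) l(2)]] by simp
      next
        case r
        then show ?thesis unfolding p using lin0[OF f(2)] generated_algebra.const[of 0] by simp
      qed
    next
      assume "g \<in> S"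
      then obtain f where f: "g = (\<lambda>z. f (snd z))" "smooth f" unfolding S_def by blast
      have p: "partial b g = (\<lambda>z. frechet_derivative f (at (snd z)) (snd b))"
        unfolding f(1) using frechet_derivative_apply[OF has_derivative_comp_snd[OF smooth_differentiable[OF f(2)]]] by fastforce
      from bcases show ?thesis
      proof cases
        case r
        then show ?thesis unfolding p using S[OF smooth_partial[OF f(2) r(2)]] by simp
      next
        case l
        then show ?thesis unfolding p using lin0[OF f(2)] generated_algebra.const[of 0] by simp
      qed
    qed
  qed
qed

lemma tensor_test_function:
  fixes \<eta> :: "'a::euclidean_space \<Rightarrow> real" and \<psi> :: "'b::euclidean_space \<Rightarrow> real"
  assumes \<eta>: "\<eta> \<in> test_functions I" and \<psi>: "\<psi> \<in> test_functions J"
  shows "(\<lambda>z. \<eta> (fst z) * \<psi> (snd z)) \<in> test_functions (I \<times> J)"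
    and "frechet_derivative (\<lambda>z. \<eta> (fst z) * \<psi> (snd z)) (at z) (0, v) = \<eta> (fst z) * partial v \<psi> (snd z)"
proof -
  note s = test_functionsD[OF \<eta>] and t = test_functionsD[OF \<psi>]
  let ?K = "closure {x. \<eta> x \<noteq> 0} \<times> closure {x. \<psi> x \<noteq> 0}"
  let ?S = "closure {z. \<eta> (fst z) * \<psi> (snd z) \<noteq> 0}"
  have K: "compact ?K" using s t by (intro compact_Times)
  have sub: "?S \<subseteq> ?K"
  proof (rule closure_minimal)
    show "{z. \<eta> (fst z) * \<psi> (snd z) \<noteq> 0} \<subseteq> ?K"
    proof
      fix z assume "z \<in> {z. \<eta> (fst z) * \<psi> (snd z) \<noteq> 0}"
      then have "fst z \<in> {x. \<eta> x \<noteq> 0}" "snd z \<in> {x. \<psi> x \<noteq> 0}" by auto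
      then show "z \<in> ?K"
        using closure_subset[of "{x. \<eta> x \<noteq> 0}"] closure_subset[of "{x. \<psi> x \<noteq> 0}"]
        by (metis mem_Times_iff subsetD)
    qed
  qed (rule compact_imp_closed[OF K])
  have "compact ?S"
    using compact_Int_closed[OF K closed_closure[of "{z. \<eta> (fst z) * \<psi> (snd z) \<noteq> 0}"]]
    unfolding inf_absorb2[OF sub] .
  moreover have "?K \<subseteq> I \<times> J"
    using s(3) t(3) by (intro Sigma_mono)
  ultimately show "(\<lambda>z. \<eta> (fst z) * \<psi> (snd z)) \<in> test_functions (I \<times> J)"
    using sub smooth_tensor[OF s(1) t(1)] unfolding test_functions_def by blast
  have "linear (frechet_derivative \<eta> (at (fst z)))"
    using linear_frechet_derivative[OF smooth_differentiable[OF s(1)]] .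
  then have "frechet_derivative \<eta> (at (fst z)) 0 = 0" by (rule linear_0)
  then show "frechet_derivative (\<lambda>z. \<eta> (fst z) * \<psi> (snd z)) (at z) (0, v) = \<eta> (fst z) * partial v \<psi> (snd z)"
    using frechet_derivative_apply[OF has_derivative_mult[OF has_derivative_comp_fst[OF smooth_differentiable[OF s(1)]]
        has_derivative_comp_snd[OF smooth_differentiable[OF t(1)]]], of z "(0, v)"] by simp
qed

lemma integrable_locally_integrable:
  fixes f :: "'a::euclidean_space \<Rightarrow> 'b::euclidean_space"
  assumes G: "G \<in> sets lebesgue" and f: "integrable (lebesgue_on G) f"
  shows "locally_integrable G f"
  unfolding locally_integrable_def
proof (intro allI impI)
  fix K assume K: "K \<subseteq> G" "compact K"
  have Ks: "K \<in> sets lebesgue" using compact_imp_closed[OF K(2)] by simp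
  have "integrable lebesgue (\<lambda>x. indicator K x *\<^sub>R (indicator G x *\<^sub>R f x))"
    using f unfolding integrable_lebesgue_on_iff[OF G] by (rule integrable_mult_indicator[OF Ks])
  moreover have "(\<lambda>x. indicator K x *\<^sub>R (indicator G x *\<^sub>R f x)) = (\<lambda>x. indicator K x *\<^sub>R f x)"
    using K(1) by (intro ext) (auto simp: indicator_def)
  ultimately show "integrable (lebesgue_on K) f"
    by (simp add: integrable_lebesgue_on_iff[OF Ks])
qed

lemma integrable_vec_component:
  "integrable M f \<Longrightarrow> integrable M (\<lambda>x. f x $ i :: 'b::euclidean_space)"
  by (rule integrable_bounded_linear[OF bounded_linear_vec_nth])

text \<open>For a test function \<open>\<psi>\<close> on \<open>J\<close>, the defect \<open>h(t)\<close> of the weak identity for the slice at \<open>t\<close> is integrable on \<open>I\<close>,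
and testing on \<open>I \<times> J\<close> with \<open>\<eta>(t) \<psi>(x)\<close> says that \<open>h\<close> is orthogonal to every \<open>\<eta>\<close>. So \<open>h\<close> vanishes almost
everywhere. For countably many \<open>\<psi>\<close> one null set suffices, and outside of it the defect is continuous in
\<open>\<psi>\<close> with respect to the \<open>C\<^sup>1\<close> norm, which gives the identity for all \<open>\<psi>\<close>.\<close>

lemma weak_symgrad_slice:
  fixes I :: "real set" and J :: "(real^'d) set" and u :: "real \<times> (real^'d) \<Rightarrow> real^'d"
  assumes I: "open I" and J: "open J" "bounded J"
    and u: "integrable (lebesgue_on (I \<times> J)) u" and E: "integrable (lebesgue_on (I \<times> J)) E"
    and w: "weak_symgrad spacetime_dir (I \<times> J) u E"
  shows "AE t in lebesgue_on I. weak_symgrad space_dir J (slice u t) (slice E t)"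
proof -
  let ?Q = "lebesgue_on (I \<times> J)"
  have Ib: "I \<in> sets borel" and Jb: "J \<in> sets borel" and Jl: "J \<in> sets lebesgue" and Il: "I \<in> sets lebesgue"
    using I J by auto
  let ?H = "\<lambda>(\<psi>::real^'d \<Rightarrow> real) i j z. E z $ i $ j * \<psi> (snd z)
      + 1/2 * (u z $ i * partial (space_dir j) \<psi> (snd z) + u z $ j * partial (space_dir i) \<psi> (snd z))"
  have ucomp: "integrable ?Q (\<lambda>z. u z $ i)" for i
    by (rule integrable_vec_component[OF u])
  have Ecomp: "integrable ?Q (\<lambda>z. E z $ i $ j)" for i j
    by (rule integrable_vec_component[OF integrable_vec_component[OF E]])
  have step1: "AE t in lebesgue_on I. (LINT x|lebesgue_on J. ?H \<psi> i j (t, x)) = 0"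
    if \<psi>: "\<psi> \<in> test_functions J" for \<psi> i j
  proof -
    note t = test_functionsD[OF \<psi>]
    obtain B where B: "\<And>x. \<bar>\<psi> x\<bar> \<le> B" using test_function_bounded(1)[OF \<psi>] by auto
    have "\<exists>B. \<forall>x. \<bar>partial v \<psi> x\<bar> \<le> B" for v
      using test_function_bounded(2)[OF \<psi>, of v] by simp
    then obtain B' where B': "\<And>v x. \<bar>partial v \<psi> x\<bar> \<le> B' v" by metis
    have m: "(\<lambda>z. \<psi> (snd z)) \<in> borel_measurable ?Q"
      by (intro continuous_measurable_lebesgue_on continuous_on_compose2[OF smooth_continuous[OF t(1), of UNIV]] continuous_intros) auto
    have m': "(\<lambda>z. partial v \<psi> (snd z)) \<in> borel_measurable ?Q" for v
      by (intro continuous_measurable_lebesgue_on continuous_on_compose2[OF smooth_continuous_derivative[OF t(1), of UNIV]] continuous_intros) auto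
    have i1: "integrable ?Q (\<lambda>z. E z $ i $ j * \<psi> (snd z))" for i j
      by (rule integrable_mult_bounded[OF Ecomp m B])
    have i2: "integrable ?Q (\<lambda>z. u z $ i * partial v \<psi> (snd z))" for i v
      by (rule integrable_mult_bounded[OF ucomp m' B'])
    have iH: "integrable ?Q (?H \<psi> i j)"
      by (intro Bochner_Integration.integrable_add integrable_mult_right i1 i2)
    let ?h = "\<lambda>t. LINT x|lebesgue_on J. ?H \<psi> i j (t, x)"
    have ih: "integrable (lebesgue_on I) ?h"
      by (rule integrable_integral_slice[OF Ib Jb iH])
    show ?thesis
    proof (rule fundamental_lemma_of_variations[OF I integrable_locally_integrable[OF Il ih]])
      fix \<eta> :: "real \<Rightarrow> real" assume \<eta>: "\<eta> \<in> test_functions I"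
      note s = test_functionsD[OF \<eta>]
      obtain C where C: "\<And>x. \<bar>\<eta> x\<bar> \<le> C" using test_function_bounded(1)[OF \<eta>] by auto
      have me: "(\<lambda>z. \<eta> (fst z)) \<in> borel_measurable ?Q"
        by (intro continuous_measurable_lebesgue_on continuous_on_compose2[OF smooth_continuous[OF s(1), of UNIV]] continuous_intros) auto
      have iHe: "integrable ?Q (\<lambda>z. ?H \<psi> i j z * \<eta> (fst z))"
        by (rule integrable_mult_bounded[OF iH me C])
      have ie1: "integrable ?Q (\<lambda>z. E z $ i $ j * (\<eta> (fst z) * \<psi> (snd z)))"
        using integrable_mult_bounded[OF i1[of i j] me C] by (simp add: mult_ac)
      have ie2: "integrable ?Q (\<lambda>z. u z $ i * (\<eta> (fst z) * partial v \<psi> (snd z)))" for i v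
        using integrable_mult_bounded[OF i2[of i v] me C] by (simp add: mult_ac)
      have "(LINT t|lebesgue_on I. ?h t * \<eta> t) = (LINT t|lebesgue_on I. LINT x|lebesgue_on J. ?H \<psi> i j (t, x) * \<eta> (fst (t, x)))"
        by simp
      also have "\<dots> = (LINT z|?Q. ?H \<psi> i j z * \<eta> (fst z))"
        by (rule integral_integral_slice[OF Ib Jb iHe])
      also have "\<dots> = (LINT z|?Q. E z $ i $ j * (\<eta> (fst z) * \<psi> (snd z))
           + 1/2 * (u z $ i * (\<eta> (fst z) * partial (space_dir j) \<psi> (snd z)) + u z $ j * (\<eta> (fst z) * partial (space_dir i) \<psi> (snd z))))"
        by (simp add: algebra_simps)
      also have "\<dots> = (LINT z|?Q. E z $ i $ j * (\<eta> (fst z) * \<psi> (snd z)))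
           + (LINT z|?Q. 1/2 * (u z $ i * (\<eta> (fst z) * partial (space_dir j) \<psi> (snd z)) + u z $ j * (\<eta> (fst z) * partial (space_dir i) \<psi> (snd z))))"
        by (intro Bochner_Integration.integral_add Bochner_Integration.integrable_add integrable_mult_right ie1 ie2)
      also have "\<dots> = 0"
      proof -
        have "(LINT z|?Q. E z $ i $ j * (\<eta> (fst z) * \<psi> (snd z)))
          = - (LINT z|?Q. 1/2 * (u z $ i * frechet_derivative (\<lambda>z. \<eta> (fst z) * \<psi> (snd z)) (at z) (spacetime_dir j)
             + u z $ j * frechet_derivative (\<lambda>z. \<eta> (fst z) * \<psi> (snd z)) (at z) (spacetime_dir i)))"
          using w unfolding weak_symgrad_def
          by (elim conjE) (drule bspec[OF _ tensor_test_function(1)[OF \<eta> \<psi>]], erule allE[of _ i], erule allE[of _ j])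
        then show ?thesis unfolding tensor_test_function(2)[OF \<eta> \<psi>] by simp
      qed
      finally show "(LINT t|lebesgue_on I. ?h t * \<eta> t) = 0" .
    qed
  qed
  obtain D :: "(real^'d \<Rightarrow> real) set" where D: "countable D" "D \<subseteq> test_functions J"
    "\<And>\<phi> \<epsilon>. \<phi> \<in> test_functions J \<Longrightarrow> 0 < \<epsilon> \<Longrightarrow>
       \<exists>\<psi>\<in>D. \<forall>x\<in>J. dist (\<phi> x) (\<psi> x) < \<epsilon> \<and> (\<forall>b\<in>Basis. dist (partial b \<phi> x) (partial b \<psi> x) < \<epsilon>)"
    using test_functions_C1_separable[OF J(2)] by blast
  have "AE t in lebesgue_on I. \<forall>\<psi>\<in>D. \<forall>i j. (LINT x|lebesgue_on J. ?H \<psi> i j (t, x)) = 0"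
    using step1 D(2) by (subst AE_ball_countable[OF D(1)]) (auto simp: AE_all_countable subset_iff)
  moreover have "AE t in lebesgue_on I. t \<in> I"
    using AE_space[of "lebesgue_on I"] by simp
  ultimately show ?thesis
    using AE_integrable_slice[OF Ib Jb u] AE_integrable_slice[OF Ib Jb E]
  proof eventually_elim
    case (elim t)
    note zeroD = elim(1) and tI = elim(2) and ut = elim(3) and Et = elim(4)
    have uc: "integrable (lebesgue_on J) (\<lambda>x. u (t, x) $ i)" for i
      by (rule integrable_vec_component[OF ut])
    have Ec: "integrable (lebesgue_on J) (\<lambda>x. E (t, x) $ i $ j)" for i j
      by (rule integrable_vec_component[OF integrable_vec_component[OF Et]])
    have i1: "integrable (lebesgue_on J) (\<lambda>x. E (t, x) $ i $ j * \<psi> x)" if "\<psi> \<in> test_functions J" for i j \<psi>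
      using integrable_mult_test(1)[OF integrable_locally_integrable[OF Jl Ec] J(1) that] .
    have i2: "integrable (lebesgue_on J) (\<lambda>x. u (t, x) $ i * partial v \<psi> x)" if "\<psi> \<in> test_functions J" for i v \<psi>
      using integrable_mult_test(2)[OF integrable_locally_integrable[OF Jl uc] J(1) that] .
    have iH: "integrable (lebesgue_on J) (\<lambda>x. ?H \<psi> i j (t, x))" if "\<psi> \<in> test_functions J" for i j \<psi>
      using i1[OF that] i2[OF that] by simp
    show ?case
      unfolding weak_symgrad_def
    proof (intro conjI ballI allI)
      show "locally_integrable J (slice u t)" "locally_integrable J (slice E t)"
        using integrable_locally_integrable[OF Jl] ut Et by auto
      show "transpose (E (t, x)) = E (t, x)" if "x \<in> J" for x
        using w tI that unfolding weak_symgrad_def by blast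
      fix \<phi> :: "real^'d \<Rightarrow> real" and i j assume \<phi>: "\<phi> \<in> test_functions J"
      let ?h = "\<lambda>\<psi>. LINT x|lebesgue_on J. ?H \<psi> i j (t, x)"
      define M where "M = (LINT x|lebesgue_on J. \<bar>E (t, x) $ i $ j\<bar> + (\<bar>u (t, x) $ i\<bar> + \<bar>u (t, x) $ j\<bar>))"
      have iM: "integrable (lebesgue_on J) (\<lambda>x. \<bar>E (t, x) $ i $ j\<bar> + (\<bar>u (t, x) $ i\<bar> + \<bar>u (t, x) $ j\<bar>))"
        using uc Ec by simp
      have bound: "\<bar>?h \<phi>\<bar> \<le> \<epsilon> * M" if e: "0 < \<epsilon>" for \<epsilon>
      proof -
        obtain \<psi> where \<psi>: "\<psi> \<in> D" and
          close: "\<And>x. x \<in> J \<Longrightarrow> \<bar>\<phi> x - \<psi> x\<bar> < \<epsilon>"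
            "\<And>x k. x \<in> J \<Longrightarrow> \<bar>partial (space_dir k) \<phi> x - partial (space_dir k) \<psi> x\<bar> < \<epsilon>"
          using D(3)[OF \<phi> e] by (fastforce simp: dist_real_def)
        have \<psi>t: "\<psi> \<in> test_functions J" using \<psi> D(2) by blast
        have "?h \<phi> = ?h \<phi> - ?h \<psi>" using zeroD \<psi> by simp
        also have "\<dots> = (LINT x|lebesgue_on J. ?H \<phi> i j (t, x) - ?H \<psi> i j (t, x))"
          by (rule Bochner_Integration.integral_diff[symmetric]) (rule iH[OF \<phi>], rule iH[OF \<psi>t])
        finally have "\<bar>?h \<phi>\<bar> = \<bar>LINT x|lebesgue_on J. ?H \<phi> i j (t, x) - ?H \<psi> i j (t, x)\<bar>" by simp
        also have "\<dots> \<le> (LINT x|lebesgue_on J. \<bar>?H \<phi> i j (t, x) - ?H \<psi> i j (t, x)\<bar>)"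
          by (rule integral_abs_bound)
        also have "\<dots> \<le> (LINT x|lebesgue_on J. \<epsilon> * (\<bar>E (t, x) $ i $ j\<bar> + (\<bar>u (t, x) $ i\<bar> + \<bar>u (t, x) $ j\<bar>)))"
        proof (rule integral_mono)
          show "integrable (lebesgue_on J) (\<lambda>x. \<bar>?H \<phi> i j (t, x) - ?H \<psi> i j (t, x)\<bar>)"
            by (intro integrable_abs Bochner_Integration.integrable_diff iH \<phi> \<psi>t)
          show "integrable (lebesgue_on J) (\<lambda>x. \<epsilon> * (\<bar>E (t, x) $ i $ j\<bar> + (\<bar>u (t, x) $ i\<bar> + \<bar>u (t, x) $ j\<bar>)))"
            by (intro integrable_mult_right iM)
          fix x assume "x \<in> space (lebesgue_on J)"
          then have x: "x \<in> J" by simp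
          define a b c where "a = E (t, x) $ i $ j" and "b = u (t, x) $ i" and "c = u (t, x) $ j"
          define p q r where "p = \<phi> x - \<psi> x" and "q = partial (space_dir j) \<phi> x - partial (space_dir j) \<psi> x"
            and "r = partial (space_dir i) \<phi> x - partial (space_dir i) \<psi> x"
          have pqr: "\<bar>p\<bar> \<le> \<epsilon>" "\<bar>q\<bar> \<le> \<epsilon>" "\<bar>r\<bar> \<le> \<epsilon>"
            using close(1)[OF x] close(2)[OF x, of j] close(2)[OF x, of i] unfolding p_def q_def r_def by linarith+
          have eq: "?H \<phi> i j (t, x) - ?H \<psi> i j (t, x) = a * p + 1/2 * (b * q + c * r)"
            by (simp add: a_def b_def c_def p_def q_def r_def algebra_simps)
          have "\<bar>a * p\<bar> \<le> \<epsilon> * \<bar>a\<bar>" "\<bar>b * q\<bar> \<le> \<epsilon> * \<bar>b\<bar>" "\<bar>c * r\<bar> \<le> \<epsilon> * \<bar>c\<bar>"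
            using pqr by (simp_all add: abs_mult mult.commute[of \<epsilon>] mult_left_mono)
          then have "\<bar>a * p + 1/2 * (b * q + c * r)\<bar> \<le> \<epsilon> * \<bar>a\<bar> + (\<epsilon> * \<bar>b\<bar> + \<epsilon> * \<bar>c\<bar>)"
          proof -
            have "\<bar>X + 1/2 * (Y + Z)\<bar> \<le> A + (B + C)"
              if "\<bar>X\<bar> \<le> A" "\<bar>Y\<bar> \<le> B" "\<bar>Z\<bar> \<le> C" for X Y Z A B C :: real
              using that unfolding abs_le_iff by (elim conjE, intro conjI) (simp_all add: field_simps)
            then show ?thesis
              using \<open>\<bar>a * p\<bar> \<le> \<epsilon> * \<bar>a\<bar>\<close> \<open>\<bar>b * q\<bar> \<le> \<epsilon> * \<bar>b\<bar>\<close> \<open>\<bar>c * r\<bar> \<le> \<epsilon> * \<bar>c\<bar>\<close> by blast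
          qed
          then show "\<bar>?H \<phi> i j (t, x) - ?H \<psi> i j (t, x)\<bar> \<le> \<epsilon> * (\<bar>E (t, x) $ i $ j\<bar> + (\<bar>u (t, x) $ i\<bar> + \<bar>u (t, x) $ j\<bar>))"
            unfolding eq by (simp add: a_def b_def c_def distrib_left)
        qed
        also have "\<dots> = \<epsilon> * M"
          unfolding M_def by simp
        finally show ?thesis .
      qed
      have "((\<lambda>\<epsilon>. \<epsilon> * M) \<longlongrightarrow> 0 * M) (at_right 0)"
        by (intro tendsto_intros)
      moreover have "\<forall>\<^sub>F \<epsilon> in at_right (0::real). \<bar>?h \<phi>\<bar> \<le> \<epsilon> * M"
        by (rule eventually_mono[OF eventually_at_right_less bound])
      ultimately have "\<bar>?h \<phi>\<bar> \<le> 0 * M"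
        by (rule tendsto_lowerbound) simp
      then have h0: "?h \<phi> = 0" by simp
      have "?h \<phi> = (LINT x|lebesgue_on J. E (t, x) $ i $ j * \<phi> x)
         + (LINT x|lebesgue_on J. 1/2 * (u (t, x) $ i * partial (space_dir j) \<phi> x + u (t, x) $ j * partial (space_dir i) \<phi> x))"
        using i1[OF \<phi>] i2[OF \<phi>] by simp
      then show "(LINT x|lebesgue_on J. E (t, x) $ i $ j * \<phi> x) =
        - (LINT x|lebesgue_on J. 1/2 * (u (t, x) $ i * partial (space_dir j) \<phi> x + u (t, x) $ j * partial (space_dir i) \<phi> x))"
        using h0 by simp
    qed
  qed
qed

section \<open>Measurability of the pairing in time\<close>

text \<open>The logarithm in the modulus of continuity is at least \<open>ln (exp 1) = 1\<close>, so the oscillation of the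
exponent is at most the constant \<open>c\<close>.\<close>

lemma log_exponents_bounded:
  assumes "p \<in> log_exponents G"
  shows "\<exists>P. \<forall>x\<in>G. p x \<le> P"
proof (cases "G = {}")
  case False
  then obtain y where y: "y \<in> G" by blast
  obtain c where c: "0 < c" "\<And>x y. x \<in> G \<Longrightarrow> y \<in> G \<Longrightarrow> x \<noteq> y \<Longrightarrow>
      \<bar>p x - p y\<bar> \<le> c / ln (exp 1 + 1 / norm (x - y))"
    using assms unfolding log_exponents_def by blast
  have "p x \<le> p y + c" if x: "x \<in> G" for x
  proof (cases "x = y")
    case False
    have "exp 1 \<le> exp 1 + 1 / norm (x - y)" by simp
    then have "ln (exp 1) \<le> ln (exp 1 + 1 / norm (x - y))"
      by (intro ln_mono) (auto intro: add_pos_nonneg)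
    then have "c / ln (exp 1 + 1 / norm (x - y)) \<le> c / 1"
      using c(1) by (intro divide_left_mono) auto
    then show ?thesis using c(2)[OF x y False] by simp
  qed (use c in simp)
  then show ?thesis by blast
qed simp

lemma log_exponents_bounded_exponent:
  assumes "p \<in> log_exponents G" "open G" "bounded G"
  shows "\<exists>P. bounded_exponent G p P"
proof -
  obtain P where P: "\<forall>x\<in>G. p x \<le> P" using log_exponents_bounded[OF assms(1)] by blast
  have "p \<in> borel_measurable (lebesgue_on G)" "\<forall>x\<in>G. 1 \<le> p x"
    using assms(1) unfolding log_exponents_def var_exponents_def by auto
  then have "bounded_exponent G p P"
    using P assms by unfold_locales auto
  then show ?thesis by blast
qed

text \<open>The constant exponents of \<open>X\<^sub>+\<close> are again exponents: a nonempty open set is not a null set, so the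
essential supremum sees the lower bound.\<close>

lemma exp_sup_ge_1:
  assumes p: "p \<in> var_exponents G" and G: "open G" "G \<noteq> {}"
  shows "1 \<le> real_of_ereal (exp_sup G p)"
proof -
  have Gs: "G \<in> sets lebesgue" using G by simp
  have "\<not> negligible G" using open_not_negligible[OF G] .
  then have "G \<notin> null_sets lebesgue" by (simp add: negligible_iff_null_sets)
  then have "emeasure lebesgue G \<noteq> 0" using Gs by (simp add: null_sets_def)
  then have nz: "emeasure (lebesgue_on G) (space (lebesgue_on G)) \<noteq> 0"
    using Gs by (simp add: emeasure_restrict_space)
  have "AE x in lebesgue_on G. x \<in> G"
    using AE_space[of "lebesgue_on G"] by simp
  then have "AE x in lebesgue_on G. (1::ereal) \<le> ereal (p x)"
    by eventually_elim (use p in \<open>auto simp: var_exponents_def\<close>)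
  then have "esssup (lebesgue_on G) (\<lambda>x. 1 :: ereal) \<le> exp_sup G p"
    unfolding exp_sup_def by (intro esssup_AE_mono) auto
  then have "1 \<le> exp_sup G p" using esssup_const[OF nz, of "1::ereal"] by simp
  moreover have "exp_sup G p < \<infinity>" using p unfolding var_exponents_def by simp
  ultimately show ?thesis by (cases "exp_sup G p") (auto simp: one_ereal_def)
qed

lemma borel_measurable_AE_limit:
  fixes f :: "nat \<Rightarrow> 'a::euclidean_space \<Rightarrow> real"
  assumes S: "S \<in> sets lebesgue" and f: "\<And>n. f n \<in> borel_measurable (lebesgue_on S)"
    and lim: "AE t in lebesgue_on S. (\<lambda>n. f n t) \<longlonglongrightarrow> g t"
  shows "g \<in> borel_measurable (lebesgue_on S)"
proof (rule measurable_lebesgue_on_AE_cong[OF S])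
  show "(\<lambda>t. lim (\<lambda>n. f n t)) \<in> borel_measurable (lebesgue_on S)"
    by (rule borel_measurable_lim_metric[OF f])
  show "AE t in lebesgue_on S. g t = lim (\<lambda>n. f n t)"
    using lim by eventually_elim (simp add: limI)
qed simp

lemma
  fixes I :: "'a::euclidean_space set" and J :: "'b::euclidean_space set" and f :: "'a \<times> 'b \<Rightarrow> 'c::euclidean_space"
  assumes I: "I \<in> sets borel" and J: "J \<in> sets borel" and p: "bounded_exponent (I \<times> J) p P"
    and f: "f \<in> borel_measurable (lebesgue_on (I \<times> J))"
  shows measurable_modular_slice: "(\<lambda>t. modular J (slice p t) (slice f t)) \<in> borel_measurable (lebesgue_on I)"
    and nn_integral_modular_slice: "(\<integral>\<^sup>+t. modular J (slice p t) (slice f t) \<partial>lebesgue_on I) = modular (I \<times> J) p f"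
  unfolding modular_def
  using measurable_nn_integral_slice[OF I J bounded_exponent.measurable_integrand[OF p f]]
    nn_integral_slice[OF I J bounded_exponent.measurable_integrand[OF p f]] .

locale cylinder =
  q: bounded_exponent "{0<..<T} \<times> \<Omega>" q Q + p: bounded_exponent "{0<..<T} \<times> \<Omega>" p P
  for T :: real and \<Omega> :: "(real^'d) set" and q Q p P +
  assumes open_\<Omega>: "open \<Omega>" and bounded_\<Omega>: "bounded \<Omega>" and T: "0 < T"
begin

abbreviation "I \<equiv> {0<..<T}"

lemma I_sets: "I \<in> sets borel" "I \<in> sets lebesgue" "\<Omega> \<in> sets borel" "\<Omega> \<in> sets lebesgue" "open I"
  using open_\<Omega> by auto

lemma AE_in_I: "AE t in lebesgue_on I. t \<in> I"
  using AE_space[of "lebesgue_on I"] by simp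

lemma AE_exponent_pair:
  "AE t in lebesgue_on I. exponent_pair \<Omega> (slice q t) Q (slice p t) P"
  using AE_measurable_slice_real[OF I_sets(1,3) q.measurable_p]
    AE_measurable_slice_real[OF I_sets(1,3) p.measurable_p] AE_in_I
proof eventually_elim
  case (elim t)
  then show ?case
    using open_\<Omega> bounded_\<Omega> q.p_ge_1 q.p_le p.p_ge_1 p.p_le
    by (intro exponent_pair.intro bounded_exponent.intro) auto
qed

abbreviation "XX \<equiv> XX_space T \<Omega> q p"
abbreviation "YY \<equiv> YY_space T \<Omega>"
abbreviation "Xt \<equiv> Xt_space \<Omega> q p"
abbreviation "NX \<equiv> XX_norm T \<Omega> q p"
abbreviation "Nt \<equiv> Xt_norm \<Omega> q p"

abbreviation sg :: "(real \<times> (real^'d) \<Rightarrow> real^'d) \<Rightarrow> real \<times> (real^'d) \<Rightarrow> real^'d^'d" where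
  "sg u \<equiv> symgrad spacetime_dir (I \<times> \<Omega>) u"

lemma XX_symgrad:
  assumes u: "u \<in> XX"
  shows "u \<in> Lvar (I \<times> \<Omega>) q" "sg u \<in> Lvar (I \<times> \<Omega>) p" "weak_symgrad spacetime_dir (I \<times> \<Omega>) u (sg u)"
proof -
  obtain E where E: "u \<in> Lvar (I \<times> \<Omega>) q" "E \<in> Lvar (I \<times> \<Omega>) p" "weak_symgrad spacetime_dir (I \<times> \<Omega>) u E"
    using u unfolding XX_space_def by blast
  have ae: "AE z in lebesgue_on (I \<times> \<Omega>). sg u z = E z"
    using symgrad_AE_eq[OF E(3) q.open_G] .
  have "sg u \<in> borel_measurable (lebesgue_on (I \<times> \<Omega>))"
    by (rule measurable_lebesgue_on_AE_cong[OF q.G_lebesgue _ ae]) (use E(2) in \<open>auto simp: Lvar_def\<close>)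
  then show "sg u \<in> Lvar (I \<times> \<Omega>) p"
    using E(2) modular_cong_AE[OF ae] unfolding Lvar_def by simp
  show "weak_symgrad spacetime_dir (I \<times> \<Omega>) u (sg u)"
    unfolding symgrad_def by (rule someI[of "weak_symgrad spacetime_dir (I \<times> \<Omega>) u", OF E(3)])
qed (use u in \<open>auto simp: XX_space_def\<close>)

abbreviation regular_slice :: "(real \<times> (real^'d) \<Rightarrow> real^'d) \<Rightarrow> real \<Rightarrow> bool" where
  "regular_slice u t \<equiv> slice u t \<in> Xt t \<and> slice u t \<in> Lvar \<Omega> (slice q t) \<and>
     slice (sg u) t \<in> Lvar \<Omega> (slice p t) \<and> weak_symgrad space_dir \<Omega> (slice u t) (slice (sg u) t)"

text \<open>Membership of \<open>u(t)\<close> in \<open>X(t)\<close> provides some weak symmetric gradient in \<open>L\<^sup>p\<close>; by uniqueness it is the slice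
of the gradient on \<open>I \<times> \<Omega>\<close>, which depends measurably on \<open>t\<close>.\<close>

lemma XX_slice:
  assumes u: "u \<in> XX"
  shows "AE t in lebesgue_on I. regular_slice u t"
proof -
  note s = XX_symgrad[OF u]
  have "AE t in lebesgue_on I. slice u t \<in> Xt t"
    using u unfolding XX_space_def by blast
  moreover have "AE t in lebesgue_on I. slice (sg u) t \<in> borel_measurable (lebesgue_on \<Omega>)"
    using s(2) by (intro AE_measurable_slice[OF I_sets(1,3)]) (simp add: Lvar_def)
  moreover have "AE t in lebesgue_on I. weak_symgrad space_dir \<Omega> (slice u t) (slice (sg u) t)"
    by (rule weak_symgrad_slice[OF I_sets(5) open_\<Omega> bounded_\<Omega> q.Lvar_integrable[OF s(1)] p.Lvar_integrable[OF s(2)] s(3)])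
  ultimately show ?thesis
  proof eventually_elim
    case (elim t)
    obtain E where E: "slice u t \<in> Lvar \<Omega> (slice q t)" "E \<in> Lvar \<Omega> (slice p t)"
      "weak_symgrad space_dir \<Omega> (slice u t) E"
      using elim(1) unfolding Xt_space_def X_space_def X_ambient_def by blast
    have "modular \<Omega> (slice p t) (slice (sg u) t) = modular \<Omega> (slice p t) E"
      by (rule modular_cong_AE[OF weak_symgrad_unique[OF elim(3) E(3) open_\<Omega>]])
    then have "slice (sg u) t \<in> Lvar \<Omega> (slice p t)"
      using E(2) elim(2) unfolding Lvar_def by simp
    then show ?case using elim E by blast
  qed
qed

lemma measurable_modular_near:
  assumes u: "u \<in> XX" and \<phi>: "\<phi> \<in> test_functions \<Omega>"
  shows "Measurable.pred (lebesgue_on I)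
    (\<lambda>t. modular_near \<Omega> (slice q t) (slice p t) n (slice u t) (slice (sg u) t) \<phi>)"
proof -
  note s = XX_symgrad[OF u] and t = test_functionsD(1)[OF \<phi>]
  let ?S = "classical_symgrad space_dir \<phi>"
  have "continuous_on UNIV ?S"
    unfolding classical_symgrad_def
    by (intro continuous_on_vec_lambda continuous_intros smooth_continuous_derivative t)
  then have S: "(\<lambda>z. ?S (snd z)) \<in> borel_measurable (lebesgue_on (I \<times> \<Omega>))"
    by (intro continuous_measurable_lebesgue_on continuous_on_compose2[of UNIV ?S UNIV snd] continuous_intros) auto
  have ph: "(\<lambda>z. \<phi> (snd z)) \<in> borel_measurable (lebesgue_on (I \<times> \<Omega>))"
    by (intro continuous_measurable_lebesgue_on continuous_on_compose2[OF smooth_continuous[OF t, of UNIV]] continuous_intros) auto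
  have "(\<lambda>z. n *\<^sub>R (u z - \<phi> (snd z))) \<in> borel_measurable (lebesgue_on (I \<times> \<Omega>))"
    "(\<lambda>z. n *\<^sub>R (sg u z - ?S (snd z))) \<in> borel_measurable (lebesgue_on (I \<times> \<Omega>))"
    using s(1,2) S ph unfolding Lvar_def by auto
  from measurable_modular_slice[OF I_sets(1,3) q.bounded_exponent_axioms this(1)]
    measurable_modular_slice[OF I_sets(1,3) p.bounded_exponent_axioms this(2)]
  show ?thesis
    unfolding modular_near_def by simp
qed

text \<open>\<open>idx w n t\<close> is the first index of an element of the countable \<open>C\<^sup>1\<close>-dense set \<open>D\<close> that is near \<open>w(t)\<close> at scale
\<open>n + 1\<close>. It is measurable in \<open>t\<close>, so the pairing of the approximations \<open>d (idx u n t)\<close> and \<open>d (idx v m t)\<close> is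
obtained from countably many measurable functions. The limit \<open>n \<rightarrow> \<infinity>\<close> is taken first, for fixed \<open>m\<close>,
since demi-continuity controls only the pairing with a fixed element.\<close>

lemma measurable_pairing:
  assumes q: "q \<in> var_exponents (I \<times> \<Omega>)" and p: "p \<in> var_exponents (I \<times> \<Omega>)" and \<Omega>: "\<Omega> \<noteq> {}"
    and A: "\<forall>t\<in>I. maps_to_dual (lebesgue_on \<Omega>) (Xt t) (Xt t) (Nt t) (A t)"
    and C1: "AE t in lebesgue_on I. demicontinuous (Xt t) (Nt t) (A t)"
    and C2: "\<forall>u\<in>X_plus T \<Omega> q p. \<forall>v\<in>X_plus T \<Omega> q p. (\<lambda>t. A t u v) \<in> borel_measurable (lebesgue_on I)"
    and u: "u \<in> XX" and v: "v \<in> XX"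
  shows "(\<lambda>t. A t (slice u t) (slice v t)) \<in> borel_measurable (lebesgue_on I)"
proof -
  obtain D :: "(real^'d \<Rightarrow> real^'d) set" where D: "countable D" "D \<subseteq> test_functions \<Omega>"
    "\<And>\<phi> \<epsilon>. \<phi> \<in> test_functions \<Omega> \<Longrightarrow> 0 < \<epsilon> \<Longrightarrow>
       \<exists>\<psi>\<in>D. \<forall>x\<in>\<Omega>. dist (\<phi> x) (\<psi> x) < \<epsilon> \<and> (\<forall>b\<in>Basis. dist (partial b \<phi> x) (partial b \<psi> x) < \<epsilon>)"
    using test_functions_C1_separable[OF bounded_\<Omega>] by blast
  have "(\<lambda>x. 0) \<in> (test_functions \<Omega> :: (real^'d \<Rightarrow> real^'d) set)"
  proof -
    have "smooth (\<lambda>x::real^'d. 0::real^'d)"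
      by (rule smooth_coinduct[where P = "\<lambda>f. f = (\<lambda>x. 0)"]) auto
    then show ?thesis unfolding test_functions_def by simp
  qed
  then have Dne: "D \<noteq> {}" using D(3)[of "\<lambda>x. 0" 1] by auto
  define d where "d = from_nat_into D"
  have d: "range d = D" unfolding d_def using range_from_nat_into[OF Dne D(1)] .
  have dt: "d k \<in> test_functions \<Omega>" for k using d D(2) by auto
  have plus: "exponent_pair \<Omega> (\<lambda>_. real_of_ereal (exp_sup (I \<times> \<Omega>) q)) (real_of_ereal (exp_sup (I \<times> \<Omega>) q))
      (\<lambda>_. real_of_ereal (exp_sup (I \<times> \<Omega>) p)) (real_of_ereal (exp_sup (I \<times> \<Omega>) p))"
  proof -
    have ne: "I \<times> \<Omega> \<noteq> {}" using \<Omega> T dense[OF T] by auto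
    show ?thesis
      using open_\<Omega> bounded_\<Omega> exp_sup_ge_1[OF q q.open_G ne] exp_sup_ge_1[OF p q.open_G ne]
      by (intro exponent_pair.intro bounded_exponent.intro) auto
  qed
  have dplus: "d k \<in> X_plus T \<Omega> q p" for k
    unfolding X_plus_def by (rule exponent_pair.test_function_X_space[OF plus dt])
  have Ad: "(\<lambda>t. A t (d k) (d l)) \<in> borel_measurable (lebesgue_on I)" for k l
    using C2 dplus by blast
  define idx where "idx w n t = (LEAST k. modular_near \<Omega> (slice q t) (slice p t) (real (Suc n)) (slice w t) (slice (sg w) t) (d k))" for w n t
  have idx_m: "idx w n \<in> measurable (lebesgue_on I) (count_space UNIV)" if "w \<in> XX" for w n
    unfolding idx_def by (intro measurable_Least measurable_modular_near[OF that dt])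
  have idx_near: "modular_near \<Omega> (slice q t) (slice p t) (real (Suc n)) (slice w t) (slice (sg w) t) (d (idx w n t))"
    if t: "exponent_pair \<Omega> (slice q t) Q (slice p t) P" and w: "regular_slice w t" for w n t
  proof -
    have "\<exists>\<psi>\<in>D. modular_near \<Omega> (slice q t) (slice p t) (real (Suc n)) (slice w t) (slice (sg w) t) \<psi>"
      using w by (intro exponent_pair.modular_near_C1_dense[OF t _ _ _ _ _ D(2,3)]) (auto simp: Xt_space_def)
    then obtain k where "modular_near \<Omega> (slice q t) (slice p t) (real (Suc n)) (slice w t) (slice (sg w) t) (d k)"
      using d by blast
    then show ?thesis unfolding idx_def by (rule LeastI)
  qed
  have conv: "(\<lambda>n. Nt t (\<lambda>x. d (idx w n t) x - w (t, x))) \<longlonglongrightarrow> 0"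
    if t: "exponent_pair \<Omega> (slice q t) Q (slice p t) P" and w: "regular_slice w t" for w t
    unfolding Xt_norm_def
    using w idx_near[OF t w] by (intro exponent_pair.modular_near_tendsto[OF t]) (auto simp: dt)
  have dX: "d k \<in> Xt t" if t: "exponent_pair \<Omega> (slice q t) Q (slice p t) P" for k t
    unfolding Xt_space_def by (rule exponent_pair.test_function_X_space[OF t dt])
  have m1: "(\<lambda>t. A t (d (idx u n t)) (d (idx v m t))) \<in> borel_measurable (lebesgue_on I)" for n m
  proof (rule measurable_compose_countable[OF _ idx_m[OF u]])
    fix k
    show "(\<lambda>t. A t (d k) (d (idx v m t))) \<in> borel_measurable (lebesgue_on I)"
      by (rule measurable_compose_countable[OF _ idx_m[OF v]]) (rule Ad)
  qed
  have m2: "(\<lambda>t. A t (slice u t) (d (idx v m t))) \<in> borel_measurable (lebesgue_on I)" for m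
  proof (rule borel_measurable_AE_limit[OF I_sets(2) m1])
    show "AE t in lebesgue_on I. (\<lambda>n. A t (d (idx u n t)) (d (idx v m t))) \<longlonglongrightarrow> A t (slice u t) (d (idx v m t))"
      using AE_exponent_pair C1 XX_slice[OF u]
    proof eventually_elim
      case (elim t)
      show ?case
        using exponent_pair.demicontinuous_tendsto[OF elim(1) elim(2)[unfolded Xt_space_def Xt_norm_def]
          dX[OF elim(1), unfolded Xt_space_def] conjunct1[OF elim(3), unfolded Xt_space_def]
          dX[OF elim(1), unfolded Xt_space_def] conv[OF elim(1,3), unfolded Xt_norm_def]] .
    qed
  qed
  show ?thesis
  proof (rule borel_measurable_AE_limit[OF I_sets(2) m2])
    show "AE t in lebesgue_on I. (\<lambda>m. A t (slice u t) (d (idx v m t))) \<longlonglongrightarrow> A t (slice u t) (slice v t)"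
      using AE_exponent_pair AE_in_I XX_slice[OF u] XX_slice[OF v]
    proof eventually_elim
      case (elim t)
      have "A t (slice u t) \<in> dual_space (Xt t) (Nt t)"
        using A elim(2,3) unfolding maps_to_dual_def by blast
      from exponent_pair.functional_tendsto[OF elim(1) this[unfolded Xt_space_def Xt_norm_def]
          dX[OF elim(1), unfolded Xt_space_def] conjunct1[OF elim(4), unfolded Xt_space_def]
          conv[OF elim(1,4), unfolded Xt_norm_def]]
      show ?case .
    qed
  qed
qed

end

section \<open>The induced operator\<close>

lemma (in bounded_exponent) modular_le_of_luxemburg_le:
  fixes f :: "'a \<Rightarrow> 'b::euclidean_space"
  assumes f: "f \<in> Lvar G p" and R: "luxemburg_norm G p f \<le> R" "0 \<le> R"
  shows "modular G p f \<le> ennreal ((R + 1) powr P)"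
proof -
  have fm: "f \<in> borel_measurable (lebesgue_on G)" using f unfolding Lvar_def by simp
  have "modular G p (\<lambda>x. (R + 1) *\<^sub>R (f x /\<^sub>R (R + 1))) \<le> ennreal ((R + 1) powr P) * modular G p (\<lambda>x. f x /\<^sub>R (R + 1))"
    using fm R by (intro modular_scale_ge) auto
  also have "\<dots> \<le> ennreal ((R + 1) powr P) * 1"
    using R by (intro mult_left_mono luxemburg_less[OF f]) auto
  finally show ?thesis using R by simp
qed

lemma ennreal_enn2real_le: "ennreal (enn2real r) \<le> r"
  by (cases r) auto

lemma AE_const_nonnull:
  assumes "AE x in M. Q" "emeasure M (space M) \<noteq> 0"
  shows Q
proof (rule ccontr)
  assume "\<not> Q"
  then have "AE x in M. False" using assms(1) by simp
  then have "ae_filter M = bot" by (simp add: trivial_limit_def)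
  then show False using assms(2) by (simp add: ae_filter_eq_bot_iff)
qed

context cylinder
begin

lemma XX_scale:
  assumes u: "u \<in> XX"
  shows "(\<lambda>z. c *\<^sub>R u z) \<in> XX"
    and "AE z in lebesgue_on (I \<times> \<Omega>). sg (\<lambda>z. c *\<^sub>R u z) z = c *\<^sub>R sg u z"
proof -
  note s = XX_symgrad[OF u]
  have w: "weak_symgrad spacetime_dir (I \<times> \<Omega>) (\<lambda>z. c *\<^sub>R u z) (\<lambda>z. c *\<^sub>R sg u z)"
    using weak_symgrad_lincomb[OF s(3) s(3) q.open_G, of c 0] by simp
  then show "AE z in lebesgue_on (I \<times> \<Omega>). sg (\<lambda>z. c *\<^sub>R u z) z = c *\<^sub>R sg u z"
    by (rule symgrad_AE_eq[OF _ q.open_G])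
  have "AE t in lebesgue_on I. (\<lambda>x. c *\<^sub>R u (t, x)) \<in> Xt t"
    using XX_slice[OF u] AE_exponent_pair
    by eventually_elim (auto simp: Xt_space_def intro: exponent_pair.X_space_scale)
  then show "(\<lambda>z. c *\<^sub>R u z) \<in> XX"
    using q.Lvar_scale[OF s(1), of c] p.Lvar_scale[OF s(2), of c] w unfolding XX_space_def by blast
qed

lemma XX_norm_parts:
  assumes u: "u \<in> XX"
  shows "0 \<le> luxemburg_norm (I \<times> \<Omega>) q u" "0 \<le> luxemburg_norm (I \<times> \<Omega>) p (sg u)"
    "NX u = luxemburg_norm (I \<times> \<Omega>) q u + luxemburg_norm (I \<times> \<Omega>) p (sg u)"
  using q.luxemburg_nonneg[OF XX_symgrad(1)[OF u]] p.luxemburg_nonneg[OF XX_symgrad(2)[OF u]]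
  by (simp_all add: XX_norm_def)

lemma I_nonnull: "emeasure (lebesgue_on I) (space (lebesgue_on I)) \<noteq> 0"
  using T by (simp add: emeasure_restrict_space)

lemma YY_norm_AE:
  assumes u: "u \<in> YY"
  shows "AE t in lebesgue_on I. slice u t \<in> L2 \<Omega> \<and> L2_norm \<Omega> (slice u t) \<le> YY_norm T \<Omega> u"
    and "0 \<le> YY_norm T \<Omega> u"
proof -
  let ?s = "esssup (lebesgue_on I) (\<lambda>t. ereal (L2_norm \<Omega> (slice u t)))"
  have fin: "?s < \<infinity>" and L2: "AE t in lebesgue_on I. slice u t \<in> L2 \<Omega>"
    using u unfolding YY_space_def L2_bochner_measurable_def by auto
  have le: "L2_norm \<Omega> f \<le> real_of_ereal ?s" if "ereal (L2_norm \<Omega> f) \<le> ?s" for f :: "real^'d \<Rightarrow> real^'d"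
    using that fin by (cases ?s) auto
  have ae: "AE t in lebesgue_on I. ereal (L2_norm \<Omega> (slice u t)) \<le> ?s"
    by (rule esssup_AE)
  show "AE t in lebesgue_on I. slice u t \<in> L2 \<Omega> \<and> L2_norm \<Omega> (slice u t) \<le> YY_norm T \<Omega> u"
    using ae L2 unfolding YY_norm_def by eventually_elim (use le in blast)
  have nn: "0 \<le> L2_norm \<Omega> f" for f :: "real^'d \<Rightarrow> real^'d"
    unfolding L2_norm_def by (intro real_sqrt_ge_zero Bochner_Integration.integral_nonneg) simp
  have "AE t in lebesgue_on I. 0 \<le> YY_norm T \<Omega> u"
    using ae unfolding YY_norm_def by eventually_elim (use le nn in \<open>blast intro: order_trans\<close>)
  then show "0 \<le> YY_norm T \<Omega> u" by (rule AE_const_nonnull[OF _ I_nonnull])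
qed

end

locale operator_family = cylinder T \<Omega> q Q p P
  for T :: real and \<Omega> :: "(real^'d) set" and q Q p P +
  fixes A :: "real \<Rightarrow> (real^'d \<Rightarrow> real^'d) \<Rightarrow> (real^'d \<Rightarrow> real^'d) \<Rightarrow> real"
    and \<alpha> B :: "real \<Rightarrow> real"
  assumes var_q: "q \<in> var_exponents ({0<..<T} \<times> \<Omega>)" and var_p: "p \<in> var_exponents ({0<..<T} \<times> \<Omega>)"
    and \<Omega>_ne: "\<Omega> \<noteq> {}"
    and A_dual: "\<forall>t\<in>{0<..<T}. maps_to_dual (lebesgue_on \<Omega>) (Xt_space \<Omega> q p t) (Xt_space \<Omega> q p t) (Xt_norm \<Omega> q p t) (A t)"
    and C1: "AE t in lebesgue_on {0<..<T}. demicontinuous (Xt_space \<Omega> q p t) (Xt_norm \<Omega> q p t) (A t)"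
    and C2: "\<forall>u\<in>X_plus T \<Omega> q p. \<forall>v\<in>X_plus T \<Omega> q p. (\<lambda>t. A t u v) \<in> borel_measurable (lebesgue_on {0<..<T})"
    and \<alpha>: "integrable (lebesgue_on {0<..<T}) \<alpha>" "\<forall>t\<in>{0<..<T}. 0 \<le> \<alpha> t"
    and B: "mono_on {0..} B" "\<forall>s\<ge>0. 0 \<le> B s"
    and C3: "AE t in lebesgue_on {0<..<T}.
                 \<forall>u\<in>Xt_space \<Omega> q p t \<inter> L2 \<Omega>. \<forall>v\<in>Xt_space \<Omega> q p t.
                   \<bar>A t u v\<bar> \<le> B (L2_norm \<Omega> u) *
                     (\<alpha> t
                      + enn2real (modular \<Omega> (slice q t) u)
                      + enn2real (modular \<Omega> (slice p t) (symgrad space_dir \<Omega> u))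
                      + enn2real (modular \<Omega> (slice q t) v)
                      + enn2real (modular \<Omega> (slice p t) (symgrad space_dir \<Omega> v)))"
begin

abbreviation "\<A> \<equiv> induced_operator T A"

lemma
  assumes t: "t \<in> I" and f: "f \<in> Xt t" and g: "g \<in> Xt t"
  shows A_add: "h \<in> Xt t \<Longrightarrow> A t f (\<lambda>x. g x + h x) = A t f g + A t f h"
    and A_scale: "A t f (\<lambda>x. c *\<^sub>R g x) = c * A t f g"
    and A_cong: "f' \<in> Xt t \<Longrightarrow> AE x in lebesgue_on \<Omega>. f x = f' x \<Longrightarrow> A t f g = A t f' g"
proof -
  note m = bspec[OF A_dual t, unfolded maps_to_dual_def]
  have d: "A t f \<in> dual_space (Xt t) (Nt t)"
    using m f by blast
  show "h \<in> Xt t \<Longrightarrow> A t f (\<lambda>x. g x + h x) = A t f g + A t f h"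
    using d g unfolding dual_space_def by blast
  show "A t f (\<lambda>x. c *\<^sub>R g x) = c * A t f g"
    using d g unfolding dual_space_def by blast
  show "f' \<in> Xt t \<Longrightarrow> AE x in lebesgue_on \<Omega>. f x = f' x \<Longrightarrow> A t f g = A t f' g"
    using m f g by blast
qed

text \<open>(C.3) is integrated over \<open>t\<close>. Since \<open>enn2real\<close> maps infinity to zero, passing to extended nonnegative
reals only enlarges the right-hand side, and Fubini's theorem identifies the integrated modulars.\<close>

lemma nn_integral_pairing_le:
  assumes u: "u \<in> XX" "u \<in> YY" and v: "v \<in> XX"
    and R: "YY_norm T \<Omega> u \<le> R"
  shows "(\<integral>\<^sup>+t. ennreal \<bar>A t (slice u t) (slice v t)\<bar> \<partial>lebesgue_on I)
    \<le> ennreal (B R) * (ennreal (LINT t|lebesgue_on I. \<alpha> t) + modular (I \<times> \<Omega>) q u + modular (I \<times> \<Omega>) p (sg u)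
        + modular (I \<times> \<Omega>) q v + modular (I \<times> \<Omega>) p (sg v))"
proof -
  let ?m = "\<lambda>w t. modular \<Omega> (slice q t) (slice w t)" and ?s = "\<lambda>w t. modular \<Omega> (slice p t) (slice (sg w) t)"
  have meas: "w \<in> borel_measurable (lebesgue_on (I \<times> \<Omega>))" "sg w \<in> borel_measurable (lebesgue_on (I \<times> \<Omega>))"
    if "w \<in> XX" for w
    using XX_symgrad[OF that] unfolding Lvar_def by auto
  note mm = measurable_modular_slice[OF I_sets(1,3) q.bounded_exponent_axioms meas(1)]
    and ms = measurable_modular_slice[OF I_sets(1,3) p.bounded_exponent_axioms meas(2)]
    and im = nn_integral_modular_slice[OF I_sets(1,3) q.bounded_exponent_axioms meas(1)]
    and ims = nn_integral_modular_slice[OF I_sets(1,3) p.bounded_exponent_axioms meas(2)]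
  have "AE t in lebesgue_on I. ennreal \<bar>A t (slice u t) (slice v t)\<bar>
      \<le> ennreal (B R) * (ennreal (\<alpha> t) + ?m u t + ?s u t + ?m v t + ?s v t)"
    using C3 XX_slice[OF u(1)] XX_slice[OF v] YY_norm_AE(1)[OF u(2)] AE_in_I
  proof eventually_elim
    case (elim t)
    let ?u = "\<lambda>x. u (t, x)" and ?v = "\<lambda>x. v (t, x)"
    have su: "modular \<Omega> (slice p t) (symgrad space_dir \<Omega> ?u) = ?s u t"
      using elim(2) by (intro modular_cong_AE symgrad_AE_eq[OF _ open_\<Omega>]) blast
    have sv: "modular \<Omega> (slice p t) (symgrad space_dir \<Omega> ?v) = ?s v t"
      using elim(3) by (intro modular_cong_AE symgrad_AE_eq[OF _ open_\<Omega>]) blast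
    have "\<bar>A t ?u ?v\<bar> \<le> B (L2_norm \<Omega> ?u) * (\<alpha> t + enn2real (?m u t) + enn2real (?s u t) + enn2real (?m v t) + enn2real (?s v t))"
      using elim(1)[rule_format, of ?u ?v] elim(2,3,4) unfolding su sv by blast
    also have "\<dots> \<le> B R * (\<alpha> t + enn2real (?m u t) + enn2real (?s u t) + enn2real (?m v t) + enn2real (?s v t))"
    proof (rule mult_right_mono)
      have "0 \<le> L2_norm \<Omega> ?u"
        unfolding L2_norm_def by (intro real_sqrt_ge_zero Bochner_Integration.integral_nonneg) simp
      then show "B (L2_norm \<Omega> ?u) \<le> B R"
        using elim(4) R by (intro mono_onD[OF B(1)]) auto
      show "0 \<le> \<alpha> t + enn2real (?m u t) + enn2real (?s u t) + enn2real (?m v t) + enn2real (?s v t)"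
        using \<alpha>(2) elim(5) by (intro add_nonneg_nonneg enn2real_nonneg) auto
    qed
    finally have "ennreal \<bar>A t ?u ?v\<bar> \<le> ennreal (B R * (\<alpha> t + enn2real (?m u t) + enn2real (?s u t) + enn2real (?m v t) + enn2real (?s v t)))"
      by (rule ennreal_leI)
    also have "\<dots> = ennreal (B R) * (ennreal (\<alpha> t) + ennreal (enn2real (?m u t)) + ennreal (enn2real (?s u t))
        + ennreal (enn2real (?m v t)) + ennreal (enn2real (?s v t)))"
    proof -
      have "0 \<le> R" using YY_norm_AE(2)[OF u(2)] R by simp
      then have "0 \<le> B R" "0 \<le> \<alpha> t" using B(2) \<alpha>(2) elim(5) by auto
      then show ?thesis by (simp add: ennreal_mult ennreal_plus[symmetric] add_nonneg_nonneg del: ennreal_plus)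
    qed
    also have "\<dots> \<le> ennreal (B R) * (ennreal (\<alpha> t) + ?m u t + ?s u t + ?m v t + ?s v t)"
      by (intro mult_left_mono add_mono ennreal_enn2real_le order_refl) simp
    finally show ?case .
  qed
  then have "(\<integral>\<^sup>+t. ennreal \<bar>A t (slice u t) (slice v t)\<bar> \<partial>lebesgue_on I)
    \<le> (\<integral>\<^sup>+t. ennreal (B R) * (ennreal (\<alpha> t) + ?m u t + ?s u t + ?m v t + ?s v t) \<partial>lebesgue_on I)"
    by (rule nn_integral_mono_AE)
  also have "\<dots> = ennreal (B R) * (\<integral>\<^sup>+t. ennreal (\<alpha> t) + ?m u t + ?s u t + ?m v t + ?s v t \<partial>lebesgue_on I)"
    using \<alpha>(1) mm[OF u(1)] mm[OF v] ms[OF u(1)] ms[OF v] by (intro nn_integral_cmult) simp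
  also have "(\<integral>\<^sup>+t. ennreal (\<alpha> t) + ?m u t + ?s u t + ?m v t + ?s v t \<partial>lebesgue_on I)
    = (\<integral>\<^sup>+t. ennreal (\<alpha> t) \<partial>lebesgue_on I) + (\<integral>\<^sup>+t. ?m u t \<partial>lebesgue_on I) + (\<integral>\<^sup>+t. ?s u t \<partial>lebesgue_on I)
      + (\<integral>\<^sup>+t. ?m v t \<partial>lebesgue_on I) + (\<integral>\<^sup>+t. ?s v t \<partial>lebesgue_on I)"
    using \<alpha>(1) mm[OF u(1)] mm[OF v] ms[OF u(1)] ms[OF v] by (simp add: nn_integral_add)
  also have "\<dots> = ennreal (LINT t|lebesgue_on I. \<alpha> t) + modular (I \<times> \<Omega>) q u + modular (I \<times> \<Omega>) p (sg u)
        + modular (I \<times> \<Omega>) q v + modular (I \<times> \<Omega>) p (sg v)"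
  proof -
    have "(\<integral>\<^sup>+t. ennreal (\<alpha> t) \<partial>lebesgue_on I) = ennreal (LINT t|lebesgue_on I. \<alpha> t)"
      using \<alpha> by (intro nn_integral_eq_integral) (auto intro!: AE_I2)
    then show ?thesis
      using im[OF u(1)] im[OF v] ims[OF u(1)] ims[OF v] by simp
  qed
  finally show ?thesis .
qed

lemma integrable_pairing:
  assumes u: "u \<in> XX" "u \<in> YY" and v: "v \<in> XX"
  shows "integrable (lebesgue_on I) (\<lambda>t. A t (slice u t) (slice v t))"
  unfolding integrable_iff_bounded
proof
  show "(\<lambda>t. A t (slice u t) (slice v t)) \<in> borel_measurable (lebesgue_on I)"
    by (rule measurable_pairing[OF var_q var_p \<Omega>_ne A_dual C1 C2 u(1) v])
  have "ennreal (B (YY_norm T \<Omega> u)) * (ennreal (LINT t|lebesgue_on I. \<alpha> t) + modular (I \<times> \<Omega>) q u + modular (I \<times> \<Omega>) p (sg u)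
        + modular (I \<times> \<Omega>) q v + modular (I \<times> \<Omega>) p (sg v)) < \<infinity>"
    using XX_symgrad(1,2)[OF u(1)] XX_symgrad(1,2)[OF v] unfolding Lvar_def
    by (simp add: ennreal_mult_less_top)
  then show "(\<integral>\<^sup>+t. ennreal (norm (A t (slice u t) (slice v t))) \<partial>lebesgue_on I) < \<infinity>"
    using nn_integral_pairing_le[OF u v order_refl] by (simp add: le_less_trans)
qed

text \<open>Norms at most \<open>R\<close> bound the modulars of \<open>u\<close> by \<open>(R + 1)\<close> to the power of the exponent bounds; the
summand \<open>2\<close> bounds the two modulars of a rescaled argument \<open>v\<close>.\<close>

definition op_bound :: "real \<Rightarrow> real" where
  "op_bound R = B R * ((LINT t|lebesgue_on I. \<alpha> t) + (R + 1) powr Q + (R + 1) powr P + 2)"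

lemma op_bound_nonneg: "0 \<le> R \<Longrightarrow> 0 \<le> op_bound R"
  unfolding op_bound_def using B(2) \<alpha>(2)
  by (intro mult_nonneg_nonneg add_nonneg_nonneg Bochner_Integration.integral_nonneg) auto

lemma induced_operator_scale:
  assumes u: "u \<in> XX" "u \<in> YY" and v: "v \<in> XX"
  shows "\<A> u (\<lambda>z. c *\<^sub>R v z) = c * \<A> u v"
proof -
  have "\<A> u (\<lambda>z. c *\<^sub>R v z) = (LINT t|lebesgue_on I. c * A t (slice u t) (slice v t))"
    unfolding induced_operator_def
  proof (rule integral_cong_AE)
    show "(\<lambda>t. A t (slice u t) (\<lambda>x. c *\<^sub>R v (t, x))) \<in> borel_measurable (lebesgue_on I)"
      using borel_measurable_integrable[OF integrable_pairing[OF u XX_scale(1)[OF v, of c]]] .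
    show "(\<lambda>t. c * A t (slice u t) (slice v t)) \<in> borel_measurable (lebesgue_on I)"
      using borel_measurable_integrable[OF integrable_pairing[OF u v]] by simp
    show "AE t in lebesgue_on I. A t (slice u t) (\<lambda>x. c *\<^sub>R v (t, x)) = c * A t (slice u t) (slice v t)"
      using XX_slice[OF u(1)] XX_slice[OF v] AE_in_I
      by eventually_elim (rule A_scale; blast)
  qed
  then show ?thesis by (simp add: induced_operator_def)
qed

lemma induced_operator_add:
  assumes u: "u \<in> XX" "u \<in> YY" and v: "v \<in> XX" and w: "w \<in> XX"
  shows "\<A> u (\<lambda>z. v z + w z) = \<A> u v + \<A> u w"
proof -
  note iv = integrable_pairing[OF u v] and iw = integrable_pairing[OF u w]
  have ae: "AE t in lebesgue_on I. A t (slice u t) (\<lambda>x. v (t, x) + w (t, x))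
      = A t (slice u t) (slice v t) + A t (slice u t) (slice w t)"
    using XX_slice[OF u(1)] XX_slice[OF v] XX_slice[OF w] AE_in_I
    by eventually_elim (rule A_add; blast)
  have m: "(\<lambda>t. A t (slice u t) (slice v t) + A t (slice u t) (slice w t)) \<in> borel_measurable (lebesgue_on I)"
    using iv iw by simp
  have "(LINT t|lebesgue_on I. A t (slice u t) (\<lambda>x. v (t, x) + w (t, x)))
     = (LINT t|lebesgue_on I. A t (slice u t) (slice v t) + A t (slice u t) (slice w t))"
    by (rule integral_cong_AE[OF measurable_lebesgue_on_AE_cong[OF I_sets(2) m ae] m ae]) simp
  then show ?thesis
    unfolding induced_operator_def using iv iw by simp
qed

text \<open>For every \<open>s\<close> above the norm of \<open>v\<close>, both modulars of \<open>v/s\<close> are at most one, which bounds the functional at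
\<open>v/s\<close>; homogeneity and the limit of \<open>s\<close> to the norm of \<open>v\<close> give the claim, also for \<open>v\<close> of norm zero.\<close>

lemma induced_operator_le:
  assumes u: "u \<in> XX" "u \<in> YY" and v: "v \<in> XX"
    and R: "NX u \<le> R" "YY_norm T \<Omega> u \<le> R"
  shows "\<bar>\<A> u v\<bar> \<le> op_bound R * NX v"
proof -
  note un = XX_norm_parts[OF u(1)] and vn = XX_norm_parts[OF v] and su = XX_symgrad[OF u(1)] and sv = XX_symgrad[OF v]
  have R0: "0 \<le> R" using un R(1) by simp
  have main: "\<bar>\<A> u v\<bar> \<le> op_bound R * s" if s: "NX v < s" for s
  proof -
    have s0: "0 < s" using s vn by simp
    let ?v = "\<lambda>z. v z /\<^sub>R s"
    have vX: "?v \<in> XX" by (rule XX_scale(1)[OF v])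
    have mu: "modular (I \<times> \<Omega>) q u \<le> ennreal ((R + 1) powr Q)"
      using un R R0 by (intro q.modular_le_of_luxemburg_le su) auto
    have msu: "modular (I \<times> \<Omega>) p (sg u) \<le> ennreal ((R + 1) powr P)"
      using un R R0 by (intro p.modular_le_of_luxemburg_le su) auto
    have mv: "modular (I \<times> \<Omega>) q ?v \<le> ennreal 1"
      using vn s by (simp, intro q.luxemburg_less sv) auto
    have "modular (I \<times> \<Omega>) p (sg ?v) = modular (I \<times> \<Omega>) p (\<lambda>z. sg v z /\<^sub>R s)"
      by (rule modular_cong_AE[OF XX_scale(2)[OF v]])
    then have msv: "modular (I \<times> \<Omega>) p (sg ?v) \<le> ennreal 1"
      using vn s by (simp, intro p.luxemburg_less sv) auto
    have "ennreal \<bar>\<A> u ?v\<bar> \<le> (\<integral>\<^sup>+t. ennreal \<bar>A t (slice u t) (slice ?v t)\<bar> \<partial>lebesgue_on I)"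
      unfolding induced_operator_def
      using integral_norm_bound_ennreal[OF integrable_pairing[OF u vX]] by simp
    also have "\<dots> \<le> ennreal (B R) * (ennreal (LINT t|lebesgue_on I. \<alpha> t) + modular (I \<times> \<Omega>) q u + modular (I \<times> \<Omega>) p (sg u)
        + modular (I \<times> \<Omega>) q ?v + modular (I \<times> \<Omega>) p (sg ?v))"
      by (rule nn_integral_pairing_le[OF u vX R(2)])
    also have "\<dots> \<le> ennreal (B R) * (ennreal (LINT t|lebesgue_on I. \<alpha> t) + ennreal ((R + 1) powr Q) + ennreal ((R + 1) powr P) + ennreal 1 + ennreal 1)"
      by (intro mult_left_mono add_mono mu msu mv msv order_refl) simp
    also have "\<dots> = ennreal (op_bound R)"
    proof -
      have "0 \<le> B R" "0 \<le> (LINT t|lebesgue_on I. \<alpha> t)"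
        using B(2) R0 \<alpha>(2) by (auto intro!: Bochner_Integration.integral_nonneg)
      then show ?thesis
        unfolding op_bound_def
        by (simp add: ennreal_mult ennreal_plus[symmetric] add_nonneg_nonneg add.assoc del: ennreal_plus ennreal_1)
    qed
    finally have "\<bar>\<A> u ?v\<bar> \<le> op_bound R"
      using op_bound_nonneg[OF R0] by (simp add: ennreal_le_iff)
    moreover have "\<bar>\<A> u v\<bar> = s * \<bar>\<A> u ?v\<bar>"
      using induced_operator_scale[OF u v, of "inverse s"] s0 by (simp add: abs_mult)
    ultimately show ?thesis
      using s0 by (simp add: mult.commute mult_left_mono)
  qed
  show ?thesis
  proof (rule tendsto_lowerbound)
    show "((\<lambda>s. op_bound R * s) \<longlongrightarrow> op_bound R * NX v) (at_right (NX v))"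
      by (intro tendsto_intros)
    show "\<forall>\<^sub>F s in at_right (NX v). \<bar>\<A> u v\<bar> \<le> op_bound R * s"
      by (rule eventually_mono[OF eventually_at_right_less main])
  qed simp
qed

lemma maps_to_dual_induced_operator:
  "maps_to_dual (lebesgue_on (I \<times> \<Omega>)) (XX \<inter> YY) XX
     NX \<A>"
  unfolding maps_to_dual_def
proof (intro conjI ballI impI)
  fix u assume "u \<in> XX \<inter> YY"
  then have u: "u \<in> XX" "u \<in> YY" by auto
  show "\<A> u \<in> dual_space XX NX"
    unfolding dual_space_def
    using induced_operator_add[OF u] induced_operator_scale[OF u] induced_operator_le[OF u _ max.cobounded1 max.cobounded2]
    by blast
  fix u' v assume "u' \<in> XX \<inter> YY" and eq: "AE z in lebesgue_on (I \<times> \<Omega>). u z = u' z"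
    and v: "v \<in> XX"
  then have u': "u' \<in> XX" "u' \<in> YY" by auto
  have "AE t in lebesgue_on I. A t (slice u t) (slice v t) = A t (slice u' t) (slice v t)"
    using AE_slice[OF I_sets(1,3) eq] XX_slice[OF u(1)] XX_slice[OF u'(1)] XX_slice[OF v] AE_in_I
    by eventually_elim (rule A_cong; blast)
  then show "\<A> u v = \<A> u' v"
    unfolding induced_operator_def
    by (rule integral_cong_AE[OF borel_measurable_integrable[OF integrable_pairing[OF u v]]
          borel_measurable_integrable[OF integrable_pairing[OF u' v]]])
qed

lemma bounded_induced_operator:
  "bounded_operator (XX \<inter> YY) (\<lambda>u. NX u + YY_norm T \<Omega> u)
     (dual_norm XX NX) \<A>"
  unfolding bounded_operator_def
proof (intro allI impI)
  let ?V = "XX" and ?N = "NX"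
  fix S :: "(real \<times> (real^'d) \<Rightarrow> real^'d) set"
  assume S: "S \<subseteq> ?V \<inter> YY" and "\<exists>R. \<forall>u\<in>S. ?N u + YY_norm T \<Omega> u \<le> R"
  then obtain R where R: "\<And>u. u \<in> S \<Longrightarrow> ?N u + YY_norm T \<Omega> u \<le> R" by blast
  (* Z is the value of dual_norm in case no argument had norm at most one *)
  define Z where "Z = Sup ({} :: real set)"
  have "dual_norm ?V ?N (\<A> u) \<le> max (op_bound R) Z" if "u \<in> S" for u
  proof -
    have u: "u \<in> ?V" "u \<in> YY" using S that by auto
    have n: "0 \<le> ?N u" "0 \<le> YY_norm T \<Omega> u" using XX_norm_parts[OF u(1)] YY_norm_AE(2)[OF u(2)] by auto
    then have Ru: "?N u \<le> R" "YY_norm T \<Omega> u \<le> R" "0 \<le> R" using R[OF that] by auto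
    let ?Y = "{\<bar>\<A> u v\<bar> |v. v \<in> ?V \<and> ?N v \<le> 1}"
    have le: "y \<le> op_bound R" if "y \<in> ?Y" for y
    proof -
      obtain v where v: "y = \<bar>\<A> u v\<bar>" "v \<in> ?V" "?N v \<le> 1" using \<open>y \<in> ?Y\<close> by blast
      have "y \<le> op_bound R * ?N v" unfolding v(1) by (rule induced_operator_le[OF u v(2) Ru(1,2)])
      also have "\<dots> \<le> op_bound R * 1" using v(3) op_bound_nonneg[OF Ru(3)] by (intro mult_left_mono)
      finally show ?thesis by simp
    qed
    show ?thesis
    proof (cases "?Y = {}")
      case True
      then show ?thesis unfolding dual_norm_def Z_def by (simp only: max.cobounded2)
    next
      case False
      then have "dual_norm ?V ?N (\<A> u) \<le> op_bound R"
        unfolding dual_norm_def by (rule cSup_least) (rule le)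
      then show ?thesis by simp
    qed
  qed
  then show "\<exists>R'. \<forall>u\<in>S. dual_norm ?V ?N (\<A> u) \<le> R'" by blast
qed

end

theorem proposition7p2:
  fixes \<Omega> :: "(real^'d) set"
    and T :: real
    and q p :: "real \<times> (real^'d) \<Rightarrow> real"
    and A :: "real \<Rightarrow> (real^'d \<Rightarrow> real^'d) \<Rightarrow> (real^'d \<Rightarrow> real^'d) \<Rightarrow> real"
  assumes dim: "CARD('d) \<ge> 2"
    and Omega: "lipschitz_domain \<Omega>" "bounded \<Omega>"
    and T: "0 < T"
    and q: "q \<in> log_exponents ({0<..<T} \<times> \<Omega>)" "exp_inf ({0<..<T} \<times> \<Omega>) q > 1"
    and p: "p \<in> log_exponents ({0<..<T} \<times> \<Omega>)" "exp_inf ({0<..<T} \<times> \<Omega>) p > 1"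
    and A: "\<forall>t\<in>{0<..<T}. maps_to_dual (lebesgue_on \<Omega>)
              (Xt_space \<Omega> q p t) (Xt_space \<Omega> q p t) (Xt_norm \<Omega> q p t) (A t)"
    and C1: "AE t in lebesgue_on {0<..<T}.
              demicontinuous (Xt_space \<Omega> q p t) (Xt_norm \<Omega> q p t) (A t)"
    and C2: "\<forall>u\<in>X_plus T \<Omega> q p. \<forall>v\<in>X_plus T \<Omega> q p.
              (\<lambda>t. A t u v) \<in> borel_measurable (lebesgue_on {0<..<T})"
    and C3: "\<exists>(\<alpha> :: real \<Rightarrow> real) (B :: real \<Rightarrow> real).
              integrable (lebesgue_on {0<..<T}) \<alpha> \<and> (\<forall>t\<in>{0<..<T}. 0 \<le> \<alpha> t) \<and>
              mono_on {0..} B \<and> (\<forall>s\<ge>0. 0 \<le> B s) \<and>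
              (AE t in lebesgue_on {0<..<T}.
                 \<forall>u\<in>Xt_space \<Omega> q p t \<inter> L2 \<Omega>. \<forall>v\<in>Xt_space \<Omega> q p t.
                   \<bar>A t u v\<bar> \<le> B (L2_norm \<Omega> u) *
                     (\<alpha> t
                      + enn2real (modular \<Omega> (\<lambda>x. q (t, x)) u)
                      + enn2real (modular \<Omega> (\<lambda>x. p (t, x)) (symgrad space_dir \<Omega> u))
                      + enn2real (modular \<Omega> (\<lambda>x. q (t, x)) v)
                      + enn2real (modular \<Omega> (\<lambda>x. p (t, x)) (symgrad space_dir \<Omega> v))))"
  shows "(\<forall>u\<in>XX_space T \<Omega> q p \<inter> YY_space T \<Omega>. \<forall>v\<in>XX_space T \<Omega> q p.
            integrable (lebesgue_on {0<..<T}) (\<lambda>t. A t (\<lambda>x. u (t, x)) (\<lambda>x. v (t, x)))) \<and>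
         maps_to_dual (lebesgue_on ({0<..<T} \<times> \<Omega>))
            (XX_space T \<Omega> q p \<inter> YY_space T \<Omega>) (XX_space T \<Omega> q p) (XX_norm T \<Omega> q p)
            (induced_operator T A) \<and>
         bounded_operator (XX_space T \<Omega> q p \<inter> YY_space T \<Omega>)
            (\<lambda>u. XX_norm T \<Omega> q p u + YY_norm T \<Omega> u)
            (dual_norm (XX_space T \<Omega> q p) (XX_norm T \<Omega> q p))
            (induced_operator T A)"
proof -
  have \<Omega>: "open \<Omega>" "\<Omega> \<noteq> {}" using Omega(1) unfolding lipschitz_domain_def by auto
  have Q: "open ({0<..<T} \<times> \<Omega>)" "bounded ({0<..<T} \<times> \<Omega>)"
    using \<Omega> Omega(2) by (auto intro: open_Times bounded_Times)
  obtain Qb where Qb: "bounded_exponent ({0<..<T} \<times> \<Omega>) q Qb"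
    using log_exponents_bounded_exponent[OF q(1) Q] by blast
  obtain Pb where Pb: "bounded_exponent ({0<..<T} \<times> \<Omega>) p Pb"
    using log_exponents_bounded_exponent[OF p(1) Q] by blast
  from C3 show ?thesis
  proof (elim exE conjE, goal_cases)
    case (1 \<alpha> B)
    interpret operator_family T \<Omega> q Qb p Pb A \<alpha> B
      using \<Omega> Omega(2) T q(1) p(1) A C1 C2 1
      by (intro operator_family.intro cylinder.intro cylinder_axioms.intro operator_family_axioms.intro Qb Pb)
        (auto simp: log_exponents_def)
    show ?case
      using integrable_pairing maps_to_dual_induced_operator bounded_induced_operator by blast
  qed
qed

end
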